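(* Let $a:\mathbb{Z}\to(0,\infty)$ be a periodic sequence. Let $\mathcal{L}$ be the set of real-valued limit-periodic sequences on $\mathbb{Z}$, with the $\ell^\infty$ metric. For $0<\tau<1$, let $\mathcal{H}^a_\tau$ be the set of all $b\in\mathcal{L}$ such that $\sigma(J_{a,b})$ is a $\tau$-homogeneous Cantor set and the spectrum of $J_{a,b}$ is purely absolutely continuous. Then $\mathcal{H}^a_\tau$ is dense in $\mathcal{L}$ for every $0<\tau<1$.
   Context: For bounded real sequences $a,b$ on $\mathbb{Z}$ with $a$ positive and bounded away from zero, the Jacobi operator $J_{a,b}:\ell^2(\mathbb{Z})\to\ell^2(\mathbb{Z})$ is the bounded self-adjoint operator $(J_{a,b}\psi)(n)=a(n-1)\psi(n-1)+a(n)\psi(n+1)+b(n)\psi(n)$, $n\in\mathbb{Z}$. A sequence on $\mathbb{Z}$ is limit-periodic if it is a limit in $\ell^\infty(\mathbb{Z})$ (uniform limit) of periodic sequences (periodic sequences themselves are included). For $\tau>0$, a compact set $K\subseteq\mathbb{R}$ is $\tau$-homogeneous if there exists $\delta_0>0$ such that $|(x-\delta,x+\delta)\cap K|\ge\tau\delta$ for every $x\in K$ and every $0<\delta\le\delta_0$, where $|\cdot|$ is Lebesgue measure. A Cantor set is a totally disconnected (nonempty) compact set with no isolated points. *)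

theory Defs
  imports "HOL-Analysis.Analysis"
begin

section \<open>The Hilbert space of square-summable sequences on the integers\<close>

definition l2 :: "(int \<Rightarrow> complex) set" where
  "l2 = {\<psi>. (\<lambda>n. (cmod (\<psi> n))\<^sup>2) summable_on UNIV}"

text \<open>The inner product is linear in the second argument.\<close>

definition l2_inner :: "(int \<Rightarrow> complex) \<Rightarrow> (int \<Rightarrow> complex) \<Rightarrow> complex" where
  "l2_inner \<phi> \<psi> = (\<Sum>\<^sub>\<infinity>n. cnj (\<phi> n) * \<psi> n)"

definition l2_norm :: "(int \<Rightarrow> complex) \<Rightarrow> real" where
  "l2_norm \<psi> = sqrt (\<Sum>\<^sub>\<infinity>n. (cmod (\<psi> n))\<^sup>2)"


section \<open>Spectral theory of bounded operators\<close>

text \<open>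
  An operator on \<^term>\<open>l2\<close> is a map on all complex sequences of which only the restriction to
  \<^term>\<open>l2\<close> matters.
\<close>

type_synonym operator = "(int \<Rightarrow> complex) \<Rightarrow> (int \<Rightarrow> complex)"

definition shifted :: "operator \<Rightarrow> complex \<Rightarrow> operator" where
  "shifted T z = (\<lambda>\<psi> n. T \<psi> n - z * \<psi> n)"

definition resolvent :: "operator \<Rightarrow> complex \<Rightarrow> operator" where
  "resolvent T z = inv_into l2 (shifted T z)"

definition resolvent_set :: "operator \<Rightarrow> complex set" where
  "resolvent_set T =
     {z. bij_betw (shifted T z) l2 l2 \<and> (\<exists>C. \<forall>\<psi>\<in>l2. l2_norm (resolvent T z \<psi>) \<le> C * l2_norm \<psi>)}"

definition spectrum :: "operator \<Rightarrow> complex set" where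
  "spectrum T = - resolvent_set T"

text \<open>
  The spectrum as a set of real numbers; for a self-adjoint operator this is the whole spectrum.
\<close>

definition real_spectrum :: "operator \<Rightarrow> real set" where
  "real_spectrum T = {x. complex_of_real x \<in> spectrum T}"

text \<open>
  The spectral measure of a self-adjoint operator \<open>T\<close> and a vector \<open>\<psi>\<close> is the finite Borel measure
  \<open>\<mu>\<close> on the line whose Borel transform is the diagonal matrix element
  \<open>\<langle>\<psi>, (T - z)\<^sup>-\<^sup>1 \<psi>\<rangle>\<close> of the resolvent. It exists by the spectral theorem and is unique by
  Stieltjes inversion.
\<close>

definition is_spectral_measure :: "operator \<Rightarrow> (int \<Rightarrow> complex) \<Rightarrow> real measure \<Rightarrow> bool" where
  "is_spectral_measure T \<psi> \<mu> \<longleftrightarrow>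
     finite_measure \<mu> \<and> sets \<mu> = sets borel \<and>
     (\<forall>z. Im z \<noteq> 0 \<longrightarrow>
        l2_inner \<psi> (resolvent T z \<psi>) = (\<integral>x. 1 / (complex_of_real x - z) \<partial>\<mu>))"

definition purely_absolutely_continuous_spectrum :: "operator \<Rightarrow> bool" where
  "purely_absolutely_continuous_spectrum T \<longleftrightarrow>
     (\<forall>\<psi>\<in>l2. \<exists>\<mu>. is_spectral_measure T \<psi> \<mu> \<and> absolutely_continuous lborel \<mu>)"


section \<open>Jacobi operators and limit-periodic sequences\<close>

definition jacobi :: "(int \<Rightarrow> real) \<Rightarrow> (int \<Rightarrow> real) \<Rightarrow> operator" where
  "jacobi a b \<psi> = (\<lambda>n. complex_of_real (a (n - 1)) * \<psi> (n - 1)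
     + complex_of_real (a n) * \<psi> (n + 1) + complex_of_real (b n) * \<psi> n)"

definition periodic :: "(int \<Rightarrow> 'a) \<Rightarrow> bool" where
  "periodic f \<longleftrightarrow> (\<exists>p>0. \<forall>n. f (n + p) = f n)"

text \<open>
  The integers carry the discrete topology, so \<^typ>\<open>int \<Rightarrow>\<^sub>C real\<close> is the space of all bounded
  real sequences on the integers with the supremum metric.
\<close>

definition limit_periodic :: "(int \<Rightarrow>\<^sub>C real) set" where
  "limit_periodic = closure {f. periodic (apply_bcontfun f)}"


section \<open>Homogeneous Cantor sets\<close>

definition homogeneous :: "real \<Rightarrow> real set \<Rightarrow> bool" where
  "homogeneous \<tau> K \<longleftrightarrow> compact K \<and>
     (\<exists>\<delta>0>0. \<forall>x\<in>K. \<forall>\<delta>. 0 < \<delta> \<and> \<delta> \<le> \<delta>0 \<longrightarrow>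
        measure lebesgue ({x - \<delta><..<x + \<delta>} \<inter> K) \<ge> \<tau> * \<delta>)"

definition totally_disconnected :: "'a::topological_space set \<Rightarrow> bool" where
  "totally_disconnected K \<longleftrightarrow> (\<forall>C. C \<subseteq> K \<and> connected C \<longrightarrow> (\<exists>x. C \<subseteq> {x}))"

definition cantor_set :: "'a::topological_space set \<Rightarrow> bool" where
  "cantor_set K \<longleftrightarrow>
     K \<noteq> {} \<and> compact K \<and> totally_disconnected K \<and> (\<forall>x\<in>K. \<not> x isolated_in K)"

definition homogeneous_ac :: "(int \<Rightarrow> real) \<Rightarrow> real \<Rightarrow> (int \<Rightarrow>\<^sub>C real) set" where
  "homogeneous_ac a \<tau> = {b \<in> limit_periodic.
     homogeneous \<tau> (real_spectrum (jacobi a (apply_bcontfun b))) \<and>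
     cantor_set (real_spectrum (jacobi a (apply_bcontfun b))) \<and>
     purely_absolutely_continuous_spectrum (jacobi a (apply_bcontfun b))}"

end

theory Submission
  imports Defs "HOL-Computational_Algebra.Fundamental_Theorem_Algebra"
begin

text \<open>
  Starting from a periodic \<open>b\<close>, add \<open>t\<close> to its value at all multiples of a large common period
  \<open>N\<close>. Since this changes one site per period, the discriminant changes exactly by
  \<open>-(t / a 0) S\<close>, where \<open>S\<close> is an entry of the monodromy matrix that does not depend on \<open>t\<close>.
  At the energies inside a band where the monodromy matrix is plus or minus the identity, the
  discriminant keeps the value \<open>\<plusminus>2\<close> but acquires a nonzero slope, so every \<open>t \<noteq> 0\<close> opens a gap
  there; such energies fill the bands more and more densely as \<open>N\<close> grows. As \<open>t\<close> tends to 0, the spectral densities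
  converge in \<open>L\<^sup>1\<close> by Scheffe's lemma, the bands stay bounded below in length, and the measure
  lost from the old bands tends to 0, so the homogeneity constant drops by as little as desired.
  Iterating with summable errors gives a limit-periodic operator: it has spectral densities, being
  an \<open>L\<^sup>1\<close> limit, and its spectrum contains every point lying in infinitely many of the band sets,
  which yields homogeneity, while the stable gaps make it totally disconnected.
\<close>

text \<open>Spectral measures are prescribed through Borel transforms of resolvents, so the analysis
  is carried by an explicit object, the \<open>spectral_kernel\<close>: a matrix of L1 functions of
  the energy that is positive semidefinite, has the identity matrix as total mass and solves the
  eigenvalue equation in each column. Off its support the resolvent can be written down as an
  integral, and the defining conditions survive entrywise limits; this lets absolute continuity pass
  to an operator whose spectrum has no bands left. Homogeneity starts from the constant 1, because
  within distance \<delta> of a point of an interval of length at least \<delta> there is at least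
  \<delta> of that interval; the difference between 1 and \<tau> is the budget for infinitely many
  steps. The scale \<open>\<delta>\<^sub>0\<close> never shrinks: below the current band length the
  constant 1 is available again, and above it the lost measure is small compared with \<delta>. In
  each step the period must be fixed before the size of the perturbation, since how small t has to
  be depends on the period.\<close>

section \<open>Square-summable sequences\<close>

lemma l2I_finite:
  assumes "\<And>F. finite F \<Longrightarrow> (\<Sum>n\<in>F. (cmod (\<psi> n))\<^sup>2) \<le> B\<^sup>2" "B \<ge> 0"
  shows "\<psi> \<in> l2" "l2_norm \<psi> \<le> B"
proof -
  have s: "(\<lambda>n. (cmod (\<psi> n))\<^sup>2) summable_on UNIV"
    by (rule nonneg_bdd_above_summable_on) (use assms in \<open>auto intro!: bdd_aboveI2\<close>)
  then show "\<psi> \<in> l2" by (simp add: l2_def)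
  have "(\<Sum>\<^sub>\<infinity>n. (cmod (\<psi> n))\<^sup>2) \<le> B\<^sup>2"
    by (rule infsum_le_finite_sums[OF s]) (use assms in auto)
  then show "l2_norm \<psi> \<le> B"
    unfolding l2_norm_def by (rule real_le_lsqrt[OF assms(2)])
qed

lemma l2_norm_nonneg [simp]: "l2_norm \<psi> \<ge> 0"
  by (simp add: l2_norm_def infsum_nonneg)

lemma l2_norm_square: "(l2_norm \<psi>)\<^sup>2 = (\<Sum>\<^sub>\<infinity>n. (cmod (\<psi> n))\<^sup>2)"
  by (simp add: l2_norm_def infsum_nonneg)

lemma sum_le_l2_norm:
  assumes "\<psi> \<in> l2" "finite F"
  shows "(\<Sum>n\<in>F. (cmod (\<psi> n))\<^sup>2) \<le> (l2_norm \<psi>)\<^sup>2"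
  unfolding l2_norm_square by (rule finite_sum_le_infsum) (use assms in \<open>auto simp: l2_def\<close>)

lemma norm_le_l2_norm: "\<psi> \<in> l2 \<Longrightarrow> cmod (\<psi> n) \<le> l2_norm \<psi>"
  using sum_le_l2_norm[of \<psi> "{n}"] by (intro power2_le_imp_le[OF _ l2_norm_nonneg]) simp

lemma L2_set_le_l2_norm:
  assumes "\<psi> \<in> l2" "finite F"
  shows "L2_set (\<lambda>n. cmod (\<psi> n)) F \<le> l2_norm \<psi>"
  unfolding L2_set_def by (rule real_le_lsqrt[OF l2_norm_nonneg sum_le_l2_norm[OF assms]])

text \<open>Reduction to finite sections: once the \<open>L2_set\<close> norms over finite sets are
  bounded, the finite Minkowski inequality and termwise domination transfer to
  \<open>l2\<close>.\<close>

lemma l2I_L2_set: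
  assumes "\<And>F. finite F \<Longrightarrow> L2_set (\<lambda>n. cmod (\<psi> n)) F \<le> B"
  shows "\<psi> \<in> l2" "l2_norm \<psi> \<le> B"
proof -
  have "B \<ge> 0" using assms[of "{}"] by simp
  moreover have "(\<Sum>n\<in>F. (cmod (\<psi> n))\<^sup>2) \<le> B\<^sup>2" if "finite F" for F
    using assms[OF that] unfolding L2_set_def by (rule sqrt_le_D)
  ultimately show "\<psi> \<in> l2" "l2_norm \<psi> \<le> B" using l2I_finite by blast+
qed

lemma
  assumes "\<psi> \<in> l2" "\<phi> \<in> l2"
  shows l2_add: "(\<lambda>n. \<psi> n + \<phi> n) \<in> l2"
    and l2_norm_add: "l2_norm (\<lambda>n. \<psi> n + \<phi> n) \<le> l2_norm \<psi> + l2_norm \<phi>"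
proof -
  have "L2_set (\<lambda>n. cmod (\<psi> n + \<phi> n)) F \<le> l2_norm \<psi> + l2_norm \<phi>" if "finite F" for F
  proof -
    have "L2_set (\<lambda>n. cmod (\<psi> n + \<phi> n)) F \<le> L2_set (\<lambda>n. cmod (\<psi> n) + cmod (\<phi> n)) F"
      by (rule L2_set_mono) (auto intro: norm_triangle_ineq)
    also have "\<dots> \<le> L2_set (\<lambda>n. cmod (\<psi> n)) F + L2_set (\<lambda>n. cmod (\<phi> n)) F"
      by (rule L2_set_triangle_ineq)
    finally show ?thesis using L2_set_le_l2_norm[OF assms(1) that] L2_set_le_l2_norm[OF assms(2) that]
      by linarith
  qed
  from l2I_L2_set[OF this] show "(\<lambda>n. \<psi> n + \<phi> n) \<in> l2"
    "l2_norm (\<lambda>n. \<psi> n + \<phi> n) \<le> l2_norm \<psi> + l2_norm \<phi>" by blast+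
qed

lemma
  assumes "\<psi> \<in> l2" "B \<ge> 0" "\<And>n. cmod (\<phi> n) \<le> B * cmod (\<psi> n)"
  shows l2_dominated: "\<phi> \<in> l2" and l2_norm_dominated: "l2_norm \<phi> \<le> B * l2_norm \<psi>"
proof -
  have "L2_set (\<lambda>n. cmod (\<phi> n)) F \<le> B * l2_norm \<psi>" if "finite F" for F
  proof -
    have "L2_set (\<lambda>n. cmod (\<phi> n)) F \<le> L2_set (\<lambda>n. B * cmod (\<psi> n)) F"
      by (rule L2_set_mono) (use assms in auto)
    also have "\<dots> = B * L2_set (\<lambda>n. cmod (\<psi> n)) F"
      by (simp add: L2_set_right_distrib[OF assms(2)])
    finally show ?thesis using L2_set_le_l2_norm[OF assms(1) that] assms(2)
      by (meson mult_left_mono order_trans)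
  qed
  from l2I_L2_set[OF this] show "\<phi> \<in> l2" "l2_norm \<phi> \<le> B * l2_norm \<psi>" by blast+
qed

lemma l2_scale: "\<psi> \<in> l2 \<Longrightarrow> (\<lambda>n. c * \<psi> n) \<in> l2"
  by (rule l2_dominated[of \<psi> "cmod c"]) (auto simp: norm_mult)

lemma l2_uminus: "\<psi> \<in> l2 \<Longrightarrow> (\<lambda>n. - \<psi> n) \<in> l2"
  by (rule l2_dominated[of \<psi> 1]) auto

lemma l2_norm_uminus: "l2_norm (\<lambda>n. - \<psi> n) = l2_norm \<psi>"
  by (simp add: l2_norm_def)

lemma l2_diff: "\<psi> \<in> l2 \<Longrightarrow> \<phi> \<in> l2 \<Longrightarrow> (\<lambda>n. \<psi> n - \<phi> n) \<in> l2"
  using l2_add[of \<psi> "\<lambda>n. - \<phi> n"] l2_uminus[of \<phi>] by simp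

lemma l2_norm_diff: "\<psi> \<in> l2 \<Longrightarrow> \<phi> \<in> l2 \<Longrightarrow> l2_norm (\<lambda>n. \<psi> n - \<phi> n) \<le> l2_norm \<psi> + l2_norm \<phi>"
  using l2_norm_add[of \<psi> "\<lambda>n. - \<phi> n"] l2_uminus[of \<phi>] l2_norm_uminus[of \<phi>] by simp

lemma l2_shift: "\<psi> \<in> l2 \<Longrightarrow> (\<lambda>n. \<psi> (n + k)) \<in> l2"
proof -
  assume "\<psi> \<in> l2"
  have "bij_betw (\<lambda>n::int. n + k) UNIV UNIV"
    by (rule bij_betw_byWitness[where f' = "\<lambda>n. n - k"]) auto
  from summable_on_reindex_bij_betw[OF this, of "\<lambda>n. (cmod (\<psi> n))\<^sup>2"] \<open>\<psi> \<in> l2\<close>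
  show ?thesis by (simp add: l2_def)
qed

text \<open>The pairing is bilinear, without conjugation: it serves to apply a row of the Green
  function to a vector, and the conjugate in an inner product is inserted by hand.\<close>

lemma
  assumes "\<phi> \<in> l2" "\<psi> \<in> l2"
  shows l2_inner_abs_summable: "(\<lambda>n. norm (\<phi> n * \<psi> n)) summable_on UNIV"
    and l2_Cauchy_Schwarz: "cmod (\<Sum>\<^sub>\<infinity>n. \<phi> n * \<psi> n) \<le> l2_norm \<phi> * l2_norm \<psi>"
proof -
  have fin: "(\<Sum>n\<in>F. norm (\<phi> n * \<psi> n)) \<le> l2_norm \<phi> * l2_norm \<psi>" if "finite F" for F
  proof -
    have "(\<Sum>n\<in>F. norm (\<phi> n * \<psi> n)) = (\<Sum>n\<in>F. \<bar>cmod (\<phi> n)\<bar> * \<bar>cmod (\<psi> n)\<bar>)"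
      by (simp add: norm_mult)
    also have "\<dots> \<le> L2_set (\<lambda>n. cmod (\<phi> n)) F * L2_set (\<lambda>n. cmod (\<psi> n)) F"
      by (rule L2_set_mult_ineq)
    also have "\<dots> \<le> l2_norm \<phi> * l2_norm \<psi>"
      by (intro mult_mono L2_set_le_l2_norm assms that) auto
    finally show ?thesis .
  qed
  show s: "(\<lambda>n. norm (\<phi> n * \<psi> n)) summable_on UNIV"
    by (rule nonneg_bdd_above_summable_on) (use fin in \<open>auto intro!: bdd_aboveI2\<close>)
  have "cmod (\<Sum>\<^sub>\<infinity>n. \<phi> n * \<psi> n) \<le> (\<Sum>\<^sub>\<infinity>n. norm (\<phi> n * \<psi> n))"
    by (rule norm_infsum_bound[OF s])
  also have "\<dots> \<le> l2_norm \<phi> * l2_norm \<psi>"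
    by (rule infsum_le_finite_sums[OF s]) (use fin in auto)
  finally show "cmod (\<Sum>\<^sub>\<infinity>n. \<phi> n * \<psi> n) \<le> l2_norm \<phi> * l2_norm \<psi>" .
qed

lemma l2_summable: "\<phi> \<in> l2 \<Longrightarrow> \<psi> \<in> l2 \<Longrightarrow> (\<lambda>n. \<phi> n * \<psi> n) summable_on UNIV"
  by (rule abs_summable_summable[OF l2_inner_abs_summable])

section \<open>Bounded coefficients and criteria for the resolvent set\<close>

definition bseq :: "(int \<Rightarrow> real) \<Rightarrow> bool" where
  "bseq a \<longleftrightarrow> (\<exists>A. \<forall>n. \<bar>a n\<bar> \<le> A)"

lemma l2_mult_bounded:
  assumes "bseq a" "\<psi> \<in> l2"
  shows "(\<lambda>n. complex_of_real (a n) * \<psi> n) \<in> l2"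
proof -
  obtain A where A: "\<And>n. \<bar>a n\<bar> \<le> A" using assms(1) by (auto simp: bseq_def)
  then have "A \<ge> 0" using abs_ge_zero order_trans by blast
  then show ?thesis
    by (rule l2_dominated[OF assms(2)]) (auto simp: norm_mult intro!: mult_right_mono A)
qed

lemma jacobi_l2:
  assumes "bseq a" "bseq b" "\<psi> \<in> l2"
  shows "jacobi a b \<psi> \<in> l2"
proof -
  have "(\<lambda>n. complex_of_real (a (n-1)) * \<psi> (n-1)) \<in> l2"
    using l2_shift[OF l2_mult_bounded[OF assms(1,3)], of "-1"] by simp
  moreover have "(\<lambda>n. complex_of_real (a n) * \<psi> (n+1)) \<in> l2"
    using l2_mult_bounded[OF assms(1) l2_shift[OF assms(3), of 1]] .
  moreover have "(\<lambda>n. complex_of_real (b n) * \<psi> n) \<in> l2"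
    using l2_mult_bounded[OF assms(2,3)] .
  ultimately show ?thesis unfolding jacobi_def
    by (intro l2_add) auto
qed

lemma shifted_jacobi_l2:
  "bseq a \<Longrightarrow> bseq b \<Longrightarrow> \<psi> \<in> l2 \<Longrightarrow> shifted (jacobi a b) z \<psi> \<in> l2"
  unfolding shifted_def by (intro l2_diff jacobi_l2 l2_scale)

text \<open>\<open>resolvent\<close> is an \<open>inv_into\<close>, so a bounded two-sided inverse
  on \<open>l2\<close> yields bijectivity and at the same time identifies the resolvent with
  R.\<close>

lemma resolvent_setI:
  assumes "\<And>\<psi>. \<psi> \<in> l2 \<Longrightarrow> T \<psi> \<in> l2"
    and "\<And>\<psi>. \<psi> \<in> l2 \<Longrightarrow> R \<psi> \<in> l2" "\<And>\<psi>. \<psi> \<in> l2 \<Longrightarrow> l2_norm (R \<psi>) \<le> C * l2_norm \<psi>"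
    and "\<And>\<psi>. \<psi> \<in> l2 \<Longrightarrow> shifted T z (R \<psi>) = \<psi>" "\<And>\<psi>. \<psi> \<in> l2 \<Longrightarrow> R (shifted T z \<psi>) = \<psi>"
  shows "z \<in> resolvent_set T" "\<And>\<psi>. \<psi> \<in> l2 \<Longrightarrow> resolvent T z \<psi> = R \<psi>"
proof -
  have sh: "shifted T z \<psi> \<in> l2" if "\<psi> \<in> l2" for \<psi>
    unfolding shifted_def by (intro l2_diff l2_scale assms that)
  have bij: "bij_betw (shifted T z) l2 l2"
    by (rule bij_betw_byWitness[where f' = R])
      (simp_all add: assms(4,5) image_subset_iff sh assms(2))
  show r: "resolvent T z \<psi> = R \<psi>" if "\<psi> \<in> l2" for \<psi>
    unfolding resolvent_def
    by (rule inv_into_f_eq) (use bij in \<open>simp_all add: bij_betw_def assms(2,4) that\<close>)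
  show "z \<in> resolvent_set T" unfolding resolvent_set_def using bij r assms(3) by auto
qed

text \<open>A bounded inverse makes the shifted operator bounded below; approximate eigenvectors
  will contradict this.\<close>

lemma resolvent_set_bounded_below:
  assumes "z \<in> resolvent_set T"
  obtains C where "\<And>\<psi>. \<psi> \<in> l2 \<Longrightarrow> l2_norm \<psi> \<le> C * l2_norm (shifted T z \<psi>)"
proof -
  obtain C where C: "\<forall>\<psi>\<in>l2. l2_norm (resolvent T z \<psi>) \<le> C * l2_norm \<psi>"
    and bij: "bij_betw (shifted T z) l2 l2"
    using assms by (auto simp: resolvent_set_def)
  have "l2_norm \<psi> \<le> C * l2_norm (shifted T z \<psi>)" if "\<psi> \<in> l2" for \<psi>
  proof -
    have "shifted T z \<psi> \<in> l2" using bij that by (auto simp: bij_betw_def)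
    moreover have "resolvent T z (shifted T z \<psi>) = \<psi>"
      unfolding resolvent_def by (rule inv_into_f_f) (use bij that in \<open>auto simp: bij_betw_def\<close>)
    ultimately show ?thesis using C by metis
  qed
  then show thesis using that by blast
qed

section \<open>Spectral kernels\<close>

definition sesq :: "int set \<Rightarrow> (int \<Rightarrow> int \<Rightarrow> real) \<Rightarrow> (int \<Rightarrow> complex) \<Rightarrow> (int \<Rightarrow> complex) \<Rightarrow> complex" where
  "sesq F M \<phi> \<psi> = (\<Sum>j\<in>F. \<Sum>k\<in>F. cnj (\<phi> j) * \<psi> k * of_real (M j k))"

definition psd :: "(int \<Rightarrow> int \<Rightarrow> real) \<Rightarrow> bool" where
  "psd M \<longleftrightarrow> (\<forall>j k. M j k = M k j) \<and>
     (\<forall>F c. finite F \<longrightarrow> 0 \<le> (\<Sum>j\<in>F. \<Sum>k\<in>F. c j * c k * M j k))"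

lemma sesq_add_left: "sesq F M (\<lambda>j. \<phi> j + \<phi>' j) \<psi> = sesq F M \<phi> \<psi> + sesq F M \<phi>' \<psi>"
  by (simp add: sesq_def algebra_simps sum.distrib)

lemma sesq_add_right: "sesq F M \<phi> (\<lambda>j. \<psi> j + \<psi>' j) = sesq F M \<phi> \<psi> + sesq F M \<phi> \<psi>'"
  by (simp add: sesq_def algebra_simps sum.distrib)

lemma sesq_scale_left: "sesq F M (\<lambda>j. c * \<phi> j) \<psi> = cnj c * sesq F M \<phi> \<psi>"
  by (simp add: sesq_def algebra_simps sum_distrib_left)

lemma sesq_scale_right: "sesq F M \<phi> (\<lambda>j. c * \<psi> j) = c * sesq F M \<phi> \<psi>"
  by (simp add: sesq_def algebra_simps sum_distrib_left)

lemma sesq_cnj: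
  assumes "psd M"
  shows "sesq F M \<psi> \<phi> = cnj (sesq F M \<phi> \<psi>)"
proof -
  have s: "M j k = M k j" for j k using assms by (simp add: psd_def)
  have "sesq F M \<psi> \<phi> = (\<Sum>k\<in>F. \<Sum>j\<in>F. cnj (\<psi> j) * \<phi> k * of_real (M j k))"
    unfolding sesq_def by (rule sum.swap)
  also have "\<dots> = cnj (sesq F M \<phi> \<psi>)"
    unfolding sesq_def cnj_sum
    by (intro sum.cong refl) (simp add: s mult.commute mult.left_commute)
  finally show ?thesis .
qed

text \<open>Since the matrix is real, the real part of the form at \<psi> is the sum of the real
  forms at the real and imaginary parts of \<psi>, so real test vectors suffice in
  \<open>psd\<close>.\<close>

lemma sesq_nonneg:
  assumes "psd M" "finite F"
  shows "0 \<le> Re (sesq F M \<psi> \<psi>)"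
proof -
  have "Re (sesq F M \<psi> \<psi>) = (\<Sum>j\<in>F. \<Sum>k\<in>F. Re (\<psi> j) * Re (\<psi> k) * M j k)
     + (\<Sum>j\<in>F. \<Sum>k\<in>F. Im (\<psi> j) * Im (\<psi> k) * M j k)"
    by (simp add: sesq_def algebra_simps sum.distrib)
  also have "\<dots> \<ge> 0"
    using assms(1)[unfolded psd_def, THEN conjunct2, rule_format, OF assms(2)]
    by (intro add_nonneg_nonneg)
  finally show ?thesis .
qed

lemma sesq_Im: "psd M \<Longrightarrow> Im (sesq F M \<psi> \<psi>) = 0"
  using sesq_cnj[of M F \<psi> \<psi>] by (simp add: complex_eq_iff)

text \<open>Polarisation by a phase: the unimodular \<omega> turns the cross term into minus its
  modulus, and the form at \<phi> + \<omega> \<psi> is nonnegative. The bound is an arithmetic mean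
  because such a bound can be integrated over the energy term by term.\<close>

lemma sesq_bound:
  assumes "psd M" "finite F"
  shows "cmod (sesq F M \<phi> \<psi>) \<le> (Re (sesq F M \<phi> \<phi>) + Re (sesq F M \<psi> \<psi>)) / 2"
proof (cases "sesq F M \<phi> \<psi> = 0")
  case True
  then show ?thesis using sesq_nonneg[OF assms] by simp
next
  case False
  define s where "s = sesq F M \<phi> \<psi>"
  define \<omega> where "\<omega> = - cnj s / of_real (cmod s)"
  have ns: "cmod s \<noteq> 0" using False by (simp add: s_def)
  have nn: "s * cnj s = of_real (cmod s) * of_real (cmod s)"
    unfolding complex_norm_square[symmetric] by (simp add: power2_eq_square)
  have ns': "complex_of_real (cmod s) \<noteq> 0" using ns by simp
  have os: "\<omega> * s = - of_real (cmod s)"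
  proof -
    have "\<omega> * s = - (s * cnj s) / of_real (cmod s)" by (simp add: \<omega>_def mult.commute)
    also have "\<dots> = - of_real (cmod s)" unfolding nn using ns' by simp
    finally show ?thesis .
  qed
  have oo: "cnj \<omega> * \<omega> = 1"
  proof -
    have "cnj \<omega> * \<omega> = (s * cnj s) / (of_real (cmod s) * of_real (cmod s))" by (simp add: \<omega>_def)
    also have "\<dots> = 1" unfolding nn using ns' by simp
    finally show ?thesis .
  qed
  have sc: "sesq F M \<psi> \<phi> = cnj s" unfolding s_def by (rule sesq_cnj[OF assms(1)])
  have "sesq F M (\<lambda>j. \<phi> j + \<omega> * \<psi> j) (\<lambda>j. \<phi> j + \<omega> * \<psi> j)
     = sesq F M \<phi> \<phi> + \<omega> * s + cnj (\<omega> * s) + cnj \<omega> * \<omega> * sesq F M \<psi> \<psi>"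
    unfolding sesq_add_left sesq_add_right sesq_scale_left sesq_scale_right sc s_def[symmetric]
    by (simp add: algebra_simps)
  also have "Re \<dots> = Re (sesq F M \<phi> \<phi>) - 2 * cmod s + Re (sesq F M \<psi> \<psi>)"
    unfolding os oo by simp
  finally have "0 \<le> Re (sesq F M \<phi> \<phi>) - 2 * cmod s + Re (sesq F M \<psi> \<psi>)"
    using sesq_nonneg[OF assms, of "\<lambda>j. \<phi> j + \<omega> * \<psi> j"] by metis
  then have "cmod s \<le> (Re (sesq F M \<phi> \<phi>) + Re (sesq F M \<psi> \<psi>)) / 2" by (simp add: field_simps)
  then show ?thesis unfolding s_def .
qed

text \<open>The entry at j, k is the density of the spectral measure of the pair of unit vectors at
  j and k. The total masses express completeness of the spectral resolution, and the last clause
  says that at almost every energy each column is a generalised eigenvector. Nothing refers to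
  periodicity, so the notion makes sense for the limit operator as well.\<close>

definition spectral_kernel ::
  "(int \<Rightarrow> real) \<Rightarrow> (int \<Rightarrow> real) \<Rightarrow> (int \<Rightarrow> int \<Rightarrow> real \<Rightarrow> real) \<Rightarrow> bool" where
  "spectral_kernel a b f \<longleftrightarrow>
     (\<forall>j k. integrable lborel (f j k)) \<and>
     (\<forall>j k. (\<integral>t. f j k t \<partial>lborel) = (if j = k then 1 else 0)) \<and>
     (AE t in lborel. psd (\<lambda>j k. f j k t)) \<and>
     (AE t in lborel. \<forall>j k. a (j - 1) * f (j - 1) k t + a j * f (j + 1) k t + b j * f j k t
        = t * f j k t)"

text \<open>Candidate for the matrix of the inverse of J - z, to be justified for z away from the
  support of the kernel.\<close>

definition green :: "(int \<Rightarrow> int \<Rightarrow> real \<Rightarrow> real) \<Rightarrow> complex \<Rightarrow> int \<Rightarrow> int \<Rightarrow> complex" where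
  "green f z j k = (\<integral>t. complex_of_real (f j k t) / (complex_of_real t - z) \<partial>lborel)"

lemma integral_double_sum:
  fixes g :: "'i \<Rightarrow> 'j \<Rightarrow> 'a \<Rightarrow> 'b :: {banach, second_countable_topology}"
  assumes "\<And>j k. integrable M (g j k)"
  shows "integrable M (\<lambda>t. \<Sum>j\<in>F. \<Sum>k\<in>H. g j k t)"
    and "(\<integral>t. (\<Sum>j\<in>F. \<Sum>k\<in>H. g j k t) \<partial>M) = (\<Sum>j\<in>F. \<Sum>k\<in>H. \<integral>t. g j k t \<partial>M)"
proof -
  have i: "integrable M (\<lambda>t. \<Sum>k\<in>H. g j k t)" for j
    by (rule Bochner_Integration.integrable_sum) (rule assms)
  show "integrable M (\<lambda>t. \<Sum>j\<in>F. \<Sum>k\<in>H. g j k t)"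
    by (rule Bochner_Integration.integrable_sum) (rule i)
  show "(\<integral>t. (\<Sum>j\<in>F. \<Sum>k\<in>H. g j k t) \<partial>M) = (\<Sum>j\<in>F. \<Sum>k\<in>H. \<integral>t. g j k t \<partial>M)"
    by (simp add: Bochner_Integration.integral_sum i assms)
qed

lemma spectral_kernel_integral_sesq:
  assumes "spectral_kernel a b f" "finite F"
  shows "integrable lborel (\<lambda>t. sesq F (\<lambda>j k. f j k t) \<phi> \<psi>)"
    and "(\<integral>t. sesq F (\<lambda>j k. f j k t) \<phi> \<psi> \<partial>lborel) = (\<Sum>j\<in>F. cnj (\<phi> j) * \<psi> j)"
proof -
  have i: "integrable lborel (f j k)" for j k using assms by (simp add: spectral_kernel_def)
  have e: "(\<integral>t. f j k t \<partial>lborel) = (if j = k then 1 else 0)" for j k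
    using assms by (simp add: spectral_kernel_def)
  have i': "integrable lborel (\<lambda>t. cnj (\<phi> j) * \<psi> k * complex_of_real (f j k t))" for j k
    by (intro integrable_mult_right integrable_of_real i)
  show "integrable lborel (\<lambda>t. sesq F (\<lambda>j k. f j k t) \<phi> \<psi>)"
    unfolding sesq_def by (rule integral_double_sum(1)) (rule i')
  have "(\<integral>t. sesq F (\<lambda>j k. f j k t) \<phi> \<psi> \<partial>lborel)
     = (\<Sum>j\<in>F. \<Sum>k\<in>F. cnj (\<phi> j) * \<psi> k * of_real (if j = k then 1 else 0))"
    unfolding sesq_def by (subst integral_double_sum(2)[OF i']) (simp add: e)
  also have "\<dots> = (\<Sum>j\<in>F. cnj (\<phi> j) * \<psi> j)"
  proof (intro sum.cong refl)
    fix j assume "j \<in> F"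
    have "(\<Sum>k\<in>F. cnj (\<phi> j) * \<psi> k * complex_of_real (if j = k then 1 else 0))
       = (\<Sum>k\<in>F. if j = k then cnj (\<phi> j) * \<psi> k else 0)"
      by (intro sum.cong) auto
    then show "(\<Sum>k\<in>F. cnj (\<phi> j) * \<psi> k * complex_of_real (if j = k then 1 else 0)) = cnj (\<phi> j) * \<psi> j"
      using \<open>j \<in> F\<close> assms(2) by simp
  qed
  finally show "(\<integral>t. sesq F (\<lambda>j k. f j k t) \<phi> \<psi> \<partial>lborel) = (\<Sum>j\<in>F. cnj (\<phi> j) * \<psi> j)" .
qed

text \<open>A Jacobi matrix is real and symmetric, hence symmetric for the bilinear pairing, and z
  stays unconjugated on both sides. Reindexing by one exchanges the two hopping terms.\<close>

lemma jacobi_symmetric: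
  assumes a: "bseq a" and b: "bseq b" and g: "g \<in> l2" and p: "\<psi> \<in> l2"
  shows "(\<Sum>\<^sub>\<infinity>k. g k * shifted (jacobi a b) z \<psi> k) = (\<Sum>\<^sub>\<infinity>k. shifted (jacobi a b) z g k * \<psi> k)"
proof -
  have a1: "(\<lambda>n. complex_of_real (a (n - 1)) * \<phi> (n - 1)) \<in> l2" if "\<phi> \<in> l2" for \<phi>
    using l2_shift[OF l2_mult_bounded[OF a that], of "-1"] by simp
  have a2: "(\<lambda>n. complex_of_real (a n) * \<phi> (n + 1)) \<in> l2" if "\<phi> \<in> l2" for \<phi>
    using l2_mult_bounded[OF a l2_shift[OF that, of 1]] .
  have a3: "(\<lambda>n. (complex_of_real (b n) - z) * \<phi> n) \<in> l2" if "\<phi> \<in> l2" for \<phi>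
    using l2_diff[OF l2_mult_bounded[OF b that] l2_scale[OF that, of z]] by (simp add: algebra_simps)
  have bij: "bij_betw (\<lambda>n::int. n + k) UNIV UNIV" for k
    by (rule bij_betw_byWitness[where f' = "\<lambda>n. n - k"]) auto
  have e1: "(\<Sum>\<^sub>\<infinity>k. g k * (a (k - 1) * \<psi> (k - 1))) = (\<Sum>\<^sub>\<infinity>k. a k * g (k + 1) * \<psi> k)"
    by (subst infsum_reindex_bij_betw[OF bij[of 1], symmetric])
      (intro infsum_cong, simp)
  have e2: "(\<Sum>\<^sub>\<infinity>k. g k * (a k * \<psi> (k + 1))) = (\<Sum>\<^sub>\<infinity>k. a (k - 1) * g (k - 1) * \<psi> k)"
    by (subst infsum_reindex_bij_betw[OF bij[of "-1"], symmetric])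
      (intro infsum_cong, simp)
  have "(\<Sum>\<^sub>\<infinity>k. g k * shifted (jacobi a b) z \<psi> k)
     = (\<Sum>\<^sub>\<infinity>k. g k * (a (k - 1) * \<psi> (k - 1)) + g k * (a k * \<psi> (k + 1)) + g k * ((b k - z) * \<psi> k))"
    by (simp add: shifted_def jacobi_def algebra_simps)
  also have "\<dots> = (\<Sum>\<^sub>\<infinity>k. g k * (a (k - 1) * \<psi> (k - 1))) + (\<Sum>\<^sub>\<infinity>k. g k * (a k * \<psi> (k + 1)))
      + (\<Sum>\<^sub>\<infinity>k. g k * ((b k - z) * \<psi> k))"
    by (subst infsum_add; (intro summable_on_add l2_summable g a1 a2 a3 p)?)
      (subst infsum_add; (intro summable_on_add l2_summable g a1 a2 a3 p refl)?)
  also have "\<dots> = (\<Sum>\<^sub>\<infinity>k. a k * g (k + 1) * \<psi> k) + (\<Sum>\<^sub>\<infinity>k. a (k - 1) * g (k - 1) * \<psi> k)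
      + (\<Sum>\<^sub>\<infinity>k. (b k - z) * g k * \<psi> k)"
    unfolding e1 e2 by (simp add: mult.commute mult.left_commute)
  also have "\<dots> = (\<Sum>\<^sub>\<infinity>k. a k * g (k + 1) * \<psi> k + a (k - 1) * g (k - 1) * \<psi> k + (b k - z) * g k * \<psi> k)"
    by (subst infsum_add; (intro summable_on_add l2_summable g a1 a2 a3 p)?)
      (subst infsum_add; (intro summable_on_add l2_summable g a1 a2 a3 p refl)?)
  also have "\<dots> = (\<Sum>\<^sub>\<infinity>k. shifted (jacobi a b) z g k * \<psi> k)"
    by (simp add: shifted_def jacobi_def algebra_simps)
  finally show ?thesis .
qed

text \<open>The point z keeps distance d from almost all energies that carry the kernel. There are
  two uses: nonreal z with d the modulus of its imaginary part, and real z at positive distance from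
  the bands of a periodic operator.\<close>

locale kernel_off_spectrum =
  fixes a b :: "int \<Rightarrow> real" and f :: "int \<Rightarrow> int \<Rightarrow> real \<Rightarrow> real" and z :: complex and d :: real
  assumes a: "bseq a" and b: "bseq b" and f: "spectral_kernel a b f" and d: "d > 0"
    and supp: "AE t in lborel. \<forall>j k. f j k t \<noteq> 0 \<longrightarrow> d \<le> cmod (complex_of_real t - z)"
begin

lemma integrable_kernel: "integrable lborel (f j k)"
  using f by (simp add: spectral_kernel_def)

lemma measurable_kernel [measurable]: "f j k \<in> borel_measurable lborel"
  using integrable_kernel by blast

lemma integrable_green: "integrable lborel (\<lambda>t. complex_of_real (f j k t) / (complex_of_real t - z))"
proof (rule Bochner_Integration.integrable_bound)
  show "integrable lborel (\<lambda>t. f j k t / d)" by (intro integrable_divide integrable_kernel)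
  show "AE t in lborel. norm (complex_of_real (f j k t) / (complex_of_real t - z)) \<le> norm (f j k t / d)"
    using supp
  proof eventually_elim
    case (elim t)
    show ?case
    proof (cases "f j k t = 0")
      case False
      then have "d \<le> cmod (complex_of_real t - z)" using elim by blast
      then show ?thesis unfolding norm_divide by (intro frac_le) (use d in auto)
    qed simp
  qed
qed measurable

lemma green_sym: "green f z j k = green f z k j"
  unfolding green_def
proof (rule integral_cong_AE)
  have "AE t in lborel. psd (\<lambda>j k. f j k t)" using f by (simp add: spectral_kernel_def)
  then show "AE t in lborel. complex_of_real (f j k t) / (complex_of_real t - z)
      = complex_of_real (f k j t) / (complex_of_real t - z)"
    by eventually_elim (simp add: psd_def)
qed measurable

lemma green_sesq_eq:
  "(\<Sum>j\<in>F. \<Sum>k\<in>F. cnj (\<phi> j) * \<psi> k * green f z j k)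
     = (\<integral>t. sesq F (\<lambda>j k. f j k t) \<phi> \<psi> / (complex_of_real t - z) \<partial>lborel)"
proof -
  have i: "integrable lborel (\<lambda>t. cnj (\<phi> j) * \<psi> k * (complex_of_real (f j k t) / (complex_of_real t - z)))" for j k
    by (intro integrable_mult_right integrable_green)
  show ?thesis
    unfolding sesq_def sum_divide_distrib times_divide_eq_right[symmetric] green_def
    by (subst integral_double_sum(2)[OF i]) (simp only: integral_mult_right_zero)
qed

text \<open>\<open>sesq_bound\<close> at each energy, divided by the distance d and integrated; the
  diagonal forms integrate to squared norms because the total mass is the identity.\<close>

lemma green_sesq_bound:
  assumes F: "finite F"
  shows "cmod (\<Sum>j\<in>F. \<Sum>k\<in>F. cnj (\<phi> j) * \<psi> k * green f z j k)
     \<le> ((\<Sum>j\<in>F. (cmod (\<phi> j))\<^sup>2) + (\<Sum>j\<in>F. (cmod (\<psi> j))\<^sup>2)) / (2 * d)"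
proof -
  let ?q = "\<lambda>\<phi> \<psi> t. sesq F (\<lambda>j k. f j k t) \<phi> \<psi>"
  have [measurable]: "(\<lambda>t. ?q \<phi> \<psi> t) \<in> borel_measurable lborel" for \<phi> \<psi>
    using spectral_kernel_integral_sesq(1)[OF f F] by (rule borel_measurable_integrable)
  have iR: "integrable lborel (\<lambda>t. Re (?q \<phi> \<phi> t))" for \<phi>
    by (intro integrable_Re spectral_kernel_integral_sesq(1)[OF f F])
  have IR: "(\<integral>t. Re (?q \<phi> \<phi> t) \<partial>lborel) = (\<Sum>j\<in>F. (cmod (\<phi> j))\<^sup>2)" for \<phi>
    by (subst integral_Re[OF spectral_kernel_integral_sesq(1)[OF f F]])
      (simp add: spectral_kernel_integral_sesq(2)[OF f F] complex_norm_square[symmetric]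
        mult.commute[of "cnj _"] cmod_power2 power2_eq_square)
  have bd: "AE t in lborel. norm (?q \<phi> \<psi> t / (complex_of_real t - z))
      \<le> (Re (?q \<phi> \<phi> t) + Re (?q \<psi> \<psi> t)) / (2 * d)"
  proof -
    have "AE t in lborel. psd (\<lambda>j k. f j k t)" using f by (simp add: spectral_kernel_def)
    with supp show ?thesis
    proof eventually_elim
      case (elim t)
      note B = sesq_bound[OF elim(2) F, of \<phi> \<psi>] and N = sesq_nonneg[OF elim(2) F]
      show ?case
      proof (cases "?q \<phi> \<psi> t = 0")
        case True
        then show ?thesis using N d by simp
      next
        case False
        then obtain j k where "f j k t \<noteq> 0" unfolding sesq_def
          by (metis (no_types, lifting) mult_zero_right of_real_0 sum.neutral)
        then have dd: "d \<le> cmod (complex_of_real t - z)" using elim by blast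
        have "norm (?q \<phi> \<psi> t / (complex_of_real t - z)) \<le> ((Re (?q \<phi> \<phi> t) + Re (?q \<psi> \<psi> t)) / 2) / d"
          unfolding norm_divide by (rule frac_le) (use B N dd d in auto)
        then show ?thesis by simp
      qed
    qed
  qed
  have ib: "integrable lborel (\<lambda>t. (Re (?q \<phi> \<phi> t) + Re (?q \<psi> \<psi> t)) / (2 * d))"
    by (intro integrable_divide Bochner_Integration.integrable_add iR)
  have "integrable lborel (\<lambda>t. ?q \<phi> \<psi> t / (complex_of_real t - z))"
  proof (rule Bochner_Integration.integrable_bound[OF ib])
    show "AE t in lborel. norm (?q \<phi> \<psi> t / (complex_of_real t - z))
      \<le> norm ((Re (?q \<phi> \<phi> t) + Re (?q \<psi> \<psi> t)) / (2 * d))"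
      using bd by eventually_elim (erule order_trans, simp only: real_norm_def abs_ge_self)
  qed measurable
  then have iq: "integrable lborel (\<lambda>t. norm (?q \<phi> \<psi> t / (complex_of_real t - z)))"
    by (rule integrable_norm)
  have "cmod (\<integral>t. ?q \<phi> \<psi> t / (complex_of_real t - z) \<partial>lborel)
      \<le> (\<integral>t. norm (?q \<phi> \<psi> t / (complex_of_real t - z)) \<partial>lborel)"
    by (rule integral_norm_bound)
  also have "\<dots> \<le> (\<integral>t. (Re (?q \<phi> \<phi> t) + Re (?q \<psi> \<psi> t)) / (2 * d) \<partial>lborel)"
    by (rule integral_mono_AE[OF iq ib bd])
  also have "\<dots> = ((\<Sum>j\<in>F. (cmod (\<phi> j))\<^sup>2) + (\<Sum>j\<in>F. (cmod (\<psi> j))\<^sup>2)) / (2 * d)"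
    by (simp add: iR IR)
  finally show ?thesis by (simp only: green_sesq_eq)
qed

text \<open>The additive bound becomes an operator norm bound when tested with d times the image
  vector: with N the squared norm of the image and S that of \<psi>, it reads d N \<le> (d^2 N + S)
  / (2 d).\<close>

lemma green_block_bound:
  assumes F: "finite F"
  shows "(\<Sum>j\<in>F. (cmod (\<Sum>k\<in>F. green f z j k * \<psi> k))\<^sup>2) \<le> (\<Sum>k\<in>F. (cmod (\<psi> k))\<^sup>2) / d\<^sup>2"
proof -
  define g where "g j = (\<Sum>k\<in>F. green f z j k * \<psi> k)" for j
  define N where "N = (\<Sum>j\<in>F. (cmod (g j))\<^sup>2)"
  have "(\<Sum>k\<in>F. c * \<psi> k * green f z j k) = c * g j" for c j
    by (simp add: g_def sum_distrib_left mult_ac)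
  then have "(\<Sum>j\<in>F. \<Sum>k\<in>F. cnj (of_real d * g j) * \<psi> k * green f z j k) = (\<Sum>j\<in>F. cnj (of_real d * g j) * g j)"
    by (simp only:)
  also have "\<dots> = (\<Sum>j\<in>F. of_real d * (cnj (g j) * g j))"
    by (simp add: mult.assoc)
  also have "\<dots> = of_real (d * N)"
    by (simp add: N_def sum_distrib_left complex_norm_square mult_ac del: of_real_power)
  finally have e: "(\<Sum>j\<in>F. \<Sum>k\<in>F. cnj (of_real d * g j) * \<psi> k * green f z j k) = of_real (d * N)" .
  have N0: "N \<ge> 0" by (simp add: N_def sum_nonneg)
  have "d * N \<le> ((\<Sum>j\<in>F. (cmod (of_real d * g j))\<^sup>2) + (\<Sum>j\<in>F. (cmod (\<psi> j))\<^sup>2)) / (2 * d)"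
    using green_sesq_bound[OF F, of "\<lambda>j. of_real d * g j" \<psi>] N0 d
    unfolding e norm_of_real by simp
  also have "(\<Sum>j\<in>F. (cmod (of_real d * g j))\<^sup>2) = d\<^sup>2 * N"
    by (simp add: N_def norm_mult power_mult_distrib sum_distrib_left)
  finally have "d\<^sup>2 * N \<le> (\<Sum>j\<in>F. (cmod (\<psi> j))\<^sup>2)"
    using d by (simp add: field_simps power2_eq_square)
  then show ?thesis using d by (simp add: N_def g_def field_simps)
qed

text \<open>A rectangular block sits in the square block over the union once \<psi> is extended by
  zero. This form lets the columns grow while the rows stay fixed.\<close>

lemma green_block_bound2:
  assumes F: "finite F" and H: "finite H"
  shows "(\<Sum>j\<in>F. (cmod (\<Sum>k\<in>H. green f z j k * \<psi> k))\<^sup>2) \<le> (\<Sum>k\<in>H. (cmod (\<psi> k))\<^sup>2) / d\<^sup>2"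
proof -
  define \<phi> where "\<phi> k = (if k \<in> H then \<psi> k else 0)" for k
  have 1: "(\<Sum>k\<in>F \<union> H. green f z j k * \<phi> k) = (\<Sum>k\<in>H. green f z j k * \<psi> k)" for j
    by (rule sum.mono_neutral_cong_right) (use F H in \<open>auto simp: \<phi>_def\<close>)
  have 2: "(\<Sum>k\<in>F \<union> H. (cmod (\<phi> k))\<^sup>2) = (\<Sum>k\<in>H. (cmod (\<psi> k))\<^sup>2)"
    by (rule sum.mono_neutral_cong_right) (use F H in \<open>auto simp: \<phi>_def\<close>)
  have "(\<Sum>j\<in>F. (cmod (\<Sum>k\<in>H. green f z j k * \<psi> k))\<^sup>2)
      \<le> (\<Sum>j\<in>F \<union> H. (cmod (\<Sum>k\<in>H. green f z j k * \<psi> k))\<^sup>2)"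
    by (rule sum_mono2) (use F H in auto)
  also have "\<dots> \<le> (\<Sum>k\<in>H. (cmod (\<psi> k))\<^sup>2) / d\<^sup>2"
    using green_block_bound[of "F \<union> H" \<phi>] F H by (simp add: 1 2)
  finally show ?thesis .
qed

lemma green_l2: "(\<lambda>j. green f z j k) \<in> l2" "green f z j \<in> l2"
proof -
  show 1: "(\<lambda>j. green f z j k) \<in> l2" for k
  proof (rule l2I_finite)
    fix F :: "int set" assume "finite F"
    then show "(\<Sum>j\<in>F. (cmod (green f z j k))\<^sup>2) \<le> (1 / d)\<^sup>2"
      using green_block_bound2[of F "{k}" "\<lambda>_. 1"] by (simp add: power_divide)
  qed (use d in auto)
  have "green f z j = (\<lambda>k. green f z k j)" using green_sym by (intro ext)
  then show "green f z j \<in> l2" using 1 by simp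
qed

text \<open>Under the integral the recurrence of the kernel turns J - z into multiplication by t -
  z, which cancels the denominator and leaves the total mass.\<close>

lemma shifted_green: "shifted (jacobi a b) z (\<lambda>j. green f z j k) j = (if j = k then 1 else 0)"
proof -
  let ?g = "\<lambda>j t. complex_of_real (f j k t) / (complex_of_real t - z)"
  have "shifted (jacobi a b) z (\<lambda>j. green f z j k) j
      = (\<integral>t. a (j - 1) * ?g (j - 1) t + a j * ?g (j + 1) t + b j * ?g j t - z * ?g j t \<partial>lborel)"
    unfolding shifted_def jacobi_def green_def
    by (subst Bochner_Integration.integral_diff,
        intro Bochner_Integration.integrable_add integrable_mult_right integrable_green, intro integrable_mult_right integrable_green,
        subst Bochner_Integration.integral_add,
        intro Bochner_Integration.integrable_add integrable_mult_right integrable_green, intro integrable_mult_right integrable_green,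
        subst Bochner_Integration.integral_add, intro integrable_mult_right integrable_green, intro integrable_mult_right integrable_green,
        simp only: integral_mult_right_zero)
  also have "\<dots> = (\<integral>t. complex_of_real (f j k t) \<partial>lborel)"
  proof (rule integral_cong_AE)
    have "AE t in lborel. \<forall>j k. a (j - 1) * f (j - 1) k t + a j * f (j + 1) k t + b j * f j k t
        = t * f j k t" using f by (simp add: spectral_kernel_def)
    with supp show "AE t in lborel. a (j - 1) * ?g (j - 1) t + a j * ?g (j + 1) t + b j * ?g j t - z * ?g j t
        = complex_of_real (f j k t)"
    proof eventually_elim
      case (elim t)
      have "a (j - 1) * ?g (j - 1) t + a j * ?g (j + 1) t + b j * ?g j t - z * ?g j t
          = (complex_of_real (a (j - 1) * f (j - 1) k t + a j * f (j + 1) k t + b j * f j k t) - z * f j k t)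
             / (complex_of_real t - z)"
        by (simp add: add_divide_distrib diff_divide_distrib)
      also have "\<dots> = ((complex_of_real t - z) * f j k t) / (complex_of_real t - z)"
        unfolding elim(2)[rule_format] by (simp add: algebra_simps)
      \<comment> \<open>The denominator can vanish only where the kernel does, and there both sides
        are 0.\<close>
      also have "\<dots> = f j k t"
      proof (cases "f j k t = 0")
        case False
        then have "complex_of_real t - z \<noteq> 0" using elim(1) d by fastforce
        then show ?thesis by simp
      qed simp
      finally show ?case .
    qed
  qed measurable
  also have "\<dots> = (if j = k then 1 else 0)"
    using f by (simp add: spectral_kernel_def)
  finally show ?thesis .
qed

definition R :: "operator" where
  "R \<psi> j = (\<Sum>\<^sub>\<infinity>k. green f z j k * \<psi> k)"

text \<open>For a fixed finite set of rows the block bound is uniform in the set of columns, so the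
  columns are exhausted before the rows.\<close>

lemma R_l2:
  assumes "\<psi> \<in> l2"
  shows "R \<psi> \<in> l2" "l2_norm (R \<psi>) \<le> 1 / d * l2_norm \<psi>"
proof -
  have "(\<Sum>j\<in>F. (cmod (R \<psi> j))\<^sup>2) \<le> (1 / d * l2_norm \<psi>)\<^sup>2" if F: "finite F" for F
  proof (rule tendsto_upperbound)
    have "((\<lambda>H. \<Sum>k\<in>H. green f z j k * \<psi> k) \<longlongrightarrow> R \<psi> j) (finite_subsets_at_top UNIV)" for j
      using has_sum_infsum[OF l2_summable[OF green_l2(2) assms]]
      unfolding has_sum_def R_def .
    then show "((\<lambda>H. \<Sum>j\<in>F. (cmod (\<Sum>k\<in>H. green f z j k * \<psi> k))\<^sup>2) \<longlongrightarrow> (\<Sum>j\<in>F. (cmod (R \<psi> j))\<^sup>2))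
        (finite_subsets_at_top UNIV)"
      by (intro tendsto_intros)
    show "\<forall>\<^sub>F H in finite_subsets_at_top UNIV.
        (\<Sum>j\<in>F. (cmod (\<Sum>k\<in>H. green f z j k * \<psi> k))\<^sup>2) \<le> (1 / d * l2_norm \<psi>)\<^sup>2"
    proof (rule eventually_finite_subsets_at_top_weakI)
      fix H :: "int set" assume H: "finite H"
      show "(\<Sum>j\<in>F. (cmod (\<Sum>k\<in>H. green f z j k * \<psi> k))\<^sup>2) \<le> (1 / d * l2_norm \<psi>)\<^sup>2"
        using green_block_bound2[OF F H, of \<psi>] sum_le_l2_norm[OF assms H] d
          divide_right_mono[OF sum_le_l2_norm[OF assms H], of "d\<^sup>2"]
        by (simp add: power_divide)
    qed
  qed simp
  from l2I_finite[OF this] d show "R \<psi> \<in> l2" "l2_norm (R \<psi>) \<le> 1 / d * l2_norm \<psi>" by simp_all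
qed

lemma infsum_delta: "(\<Sum>\<^sub>\<infinity>k. (if j = k then 1 else 0) * \<psi> k) = (\<psi> j :: complex)"
proof -
  have "(\<Sum>\<^sub>\<infinity>k. (if j = k then 1 else 0) * \<psi> k) = (\<Sum>\<^sub>\<infinity>k\<in>{j}. \<psi> k)"
    by (rule infsum_cong_neutral) auto
  then show ?thesis by simp
qed

text \<open>\<open>jacobi_symmetric\<close> moves the operator from the vector onto a row of the
  Green function, which by symmetry is a column, where \<open>shifted_green\<close> applies.\<close>

lemma R_shifted:
  assumes "\<psi> \<in> l2"
  shows "R (shifted (jacobi a b) z \<psi>) = \<psi>"
proof
  fix j
  have e: "shifted (jacobi a b) z (green f z j) k = (if j = k then 1 else 0)" for k
    using shifted_green[of j k] green_sym[of _ j] by (simp add: shifted_def jacobi_def)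
  show "R (shifted (jacobi a b) z \<psi>) j = \<psi> j"
    unfolding R_def jacobi_symmetric[OF a b green_l2(2) assms] e by (rule infsum_delta)
qed

lemma shifted_R:
  assumes "\<psi> \<in> l2"
  shows "shifted (jacobi a b) z (R \<psi>) = \<psi>"
proof
  fix j
  have s: "(\<lambda>k. c * (green f z j k * \<psi> k)) summable_on UNIV" for c j
    using l2_summable[OF l2_scale[OF green_l2(2)] assms] by (simp add: mult_ac)
  have "shifted (jacobi a b) z (R \<psi>) j = (\<Sum>\<^sub>\<infinity>k. a (j - 1) * (green f z (j - 1) k * \<psi> k))
      + (\<Sum>\<^sub>\<infinity>k. a j * (green f z (j + 1) k * \<psi> k)) + (\<Sum>\<^sub>\<infinity>k. b j * (green f z j k * \<psi> k))
      + (\<Sum>\<^sub>\<infinity>k. (- z) * (green f z j k * \<psi> k))"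
    unfolding shifted_def jacobi_def R_def by (simp add: infsum_cmult_right' infsum_uminus)
  also have "\<dots> = (\<Sum>\<^sub>\<infinity>k. a (j - 1) * (green f z (j - 1) k * \<psi> k) + a j * (green f z (j + 1) k * \<psi> k)
     + b j * (green f z j k * \<psi> k) + (- z) * (green f z j k * \<psi> k))"
    by (simp only: infsum_add summable_on_add s)
  also have "\<dots> = (\<Sum>\<^sub>\<infinity>k. shifted (jacobi a b) z (\<lambda>j. green f z j k) j * \<psi> k)"
    by (simp add: shifted_def jacobi_def algebra_simps)
  also have "\<dots> = \<psi> j" unfolding shifted_green by (rule infsum_delta)
  finally show "shifted (jacobi a b) z (R \<psi>) j = \<psi> j" .
qed

lemma resolvent_set: "z \<in> resolvent_set (jacobi a b)"
  and resolvent_eq: "\<psi> \<in> l2 \<Longrightarrow> resolvent (jacobi a b) z \<psi> = R \<psi>"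
  using resolvent_setI[of "jacobi a b" R "1 / d" z] jacobi_l2[OF a b] R_l2 shifted_R R_shifted by blast+

end

section \<open>Perturbations and limits of spectral kernels\<close>

lemma shifted_jacobi_diff:
  "shifted (jacobi a b) z (\<lambda>n. \<psi> n - \<phi> n) n = shifted (jacobi a b) z \<psi> n - shifted (jacobi a b) z \<phi> n"
  by (simp add: shifted_def jacobi_def algebra_simps)

lemma l2_norm_eq_0: "\<psi> \<in> l2 \<Longrightarrow> l2_norm \<psi> \<le> 0 \<Longrightarrow> \<psi> = (\<lambda>n. 0)"
proof
  fix n assume "\<psi> \<in> l2" "l2_norm \<psi> \<le> 0"
  then have "cmod (\<psi> n) \<le> 0" using norm_le_l2_norm order_trans by blast
  then show "\<psi> n = 0" by simp
qed

text \<open>The lower bound gives injectivity, so an arbitrary choice of preimages is automatically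
  a two-sided bounded inverse.\<close>

lemma jacobi_resolvent_setI:
  assumes ab: "bseq a" "bseq b"
    and sur: "\<And>\<phi>. \<phi> \<in> l2 \<Longrightarrow> \<exists>\<psi>\<in>l2. shifted (jacobi a b) z \<psi> = \<phi>"
    and bd: "\<And>\<psi>. \<psi> \<in> l2 \<Longrightarrow> l2_norm \<psi> \<le> C * l2_norm (shifted (jacobi a b) z \<psi>)"
  shows "z \<in> resolvent_set (jacobi a b)"
proof -
  define R where "R \<phi> = (SOME \<psi>. \<psi> \<in> l2 \<and> shifted (jacobi a b) z \<psi> = \<phi>)" for \<phi>
  have R: "R \<phi> \<in> l2 \<and> shifted (jacobi a b) z (R \<phi>) = \<phi>" if "\<phi> \<in> l2" for \<phi>
  proof -
    have "\<exists>\<psi>. \<psi> \<in> l2 \<and> shifted (jacobi a b) z \<psi> = \<phi>" using sur[OF that] by blast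
    from someI_ex[OF this] show ?thesis unfolding R_def .
  qed
  have inj: "\<psi> = \<phi>" if "\<psi> \<in> l2" "\<phi> \<in> l2" "shifted (jacobi a b) z \<psi> = shifted (jacobi a b) z \<phi>" for \<psi> \<phi>
  proof -
    have "shifted (jacobi a b) z (\<lambda>n. \<psi> n - \<phi> n) = (\<lambda>n. 0)"
      using that(3) by (intro ext) (simp add: shifted_jacobi_diff)
    then have "l2_norm (\<lambda>n. \<psi> n - \<phi> n) \<le> 0"
      using bd[OF l2_diff[OF that(1,2)]] by (simp add: l2_norm_def)
    then have "(\<lambda>n. \<psi> n - \<phi> n) = (\<lambda>n. 0)" by (rule l2_norm_eq_0[OF l2_diff[OF that(1,2)]])
    then show ?thesis by (metis eq_iff_diff_eq_0 ext)
  qed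
  show ?thesis
  proof (rule resolvent_setI(1)[where R = R and C = C])
    fix \<psi> :: "int \<Rightarrow> complex" assume p: "\<psi> \<in> l2"
    show "jacobi a b \<psi> \<in> l2" by (rule jacobi_l2[OF ab p])
    show "R \<psi> \<in> l2" "shifted (jacobi a b) z (R \<psi>) = \<psi>" using R[OF p] by auto
    show "l2_norm (R \<psi>) \<le> C * l2_norm \<psi>" using bd[of "R \<psi>"] R[OF p] by auto
    have s: "shifted (jacobi a b) z \<psi> \<in> l2" by (rule shifted_jacobi_l2[OF ab p])
    show "R (shifted (jacobi a b) z \<psi>) = \<psi>" by (rule inj) (use R[OF s] p in auto)
  qed
qed

text \<open>Neumann iteration in the potential difference V: R has norm at most 1/d and V at most r
  < d, so the map x -> R (\<phi> - V x) contracts by the factor r/d, and its fixed point solves the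
  perturbed equation.\<close>

lemma resolvent_set_perturb:
  assumes ab: "bseq a" "bseq b" "bseq b'"
    and R: "\<And>\<psi>. \<psi> \<in> l2 \<Longrightarrow> R \<psi> \<in> l2" "\<And>\<psi>. \<psi> \<in> l2 \<Longrightarrow> l2_norm (R \<psi>) \<le> 1 / d * l2_norm \<psi>"
      "\<And>\<psi>. \<psi> \<in> l2 \<Longrightarrow> shifted (jacobi a b) z (R \<psi>) = \<psi>"
      "\<And>\<psi>. \<psi> \<in> l2 \<Longrightarrow> R (shifted (jacobi a b) z \<psi>) = \<psi>"
    and r: "\<And>n. \<bar>b' n - b n\<bar> \<le> r" "r < d"
  shows "z \<in> resolvent_set (jacobi a b')"
proof (rule jacobi_resolvent_setI[OF ab(1,3)])
  have r0: "0 \<le> r" using r(1)[of 0] by linarith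
  then have d0: "0 < d" using r(2) by linarith
  define V where "V \<psi> n = complex_of_real (b' n - b n) * \<psi> n" for \<psi> n
  have V: "V \<psi> \<in> l2" "l2_norm (V \<psi>) \<le> r * l2_norm \<psi>" if "\<psi> \<in> l2" for \<psi>
  proof -
    have *: "cmod (V \<psi> n) \<le> r * cmod (\<psi> n)" for n
      unfolding V_def norm_mult norm_of_real by (intro mult_right_mono r) auto
    show "V \<psi> \<in> l2" "l2_norm (V \<psi>) \<le> r * l2_norm \<psi>"
      using l2_dominated[OF that r0 *] l2_norm_dominated[OF that r0 *] by auto
  qed
  have S: "shifted (jacobi a b') z \<psi> n = shifted (jacobi a b) z \<psi> n + V \<psi> n" for \<psi> n
    by (simp add: shifted_def jacobi_def V_def algebra_simps)
  have Rd: "(\<lambda>n. R \<psi> n - R \<phi> n) = R (\<lambda>n. \<psi> n - \<phi> n)" if "\<psi> \<in> l2" "\<phi> \<in> l2" for \<psi> \<phi>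
  proof -
    have "shifted (jacobi a b) z (\<lambda>n. R \<psi> n - R \<phi> n) = (\<lambda>n. \<psi> n - \<phi> n)"
      using R(3)[OF that(1)] R(3)[OF that(2)] by (intro ext) (simp add: shifted_jacobi_diff)
    then show ?thesis using R(4)[OF l2_diff[OF R(1)[OF that(1)] R(1)[OF that(2)]]] by simp
  qed
  show "l2_norm \<psi> \<le> 1 / (d - r) * l2_norm (shifted (jacobi a b') z \<psi>)" if p: "\<psi> \<in> l2" for \<psi>
  proof -
    let ?s = "shifted (jacobi a b') z \<psi>"
    have s: "?s \<in> l2" by (rule shifted_jacobi_l2[OF ab(1,3) p])
    have "shifted (jacobi a b) z \<psi> = (\<lambda>n. ?s n - V \<psi> n)" by (intro ext) (simp add: S)
    then have "\<psi> = R (\<lambda>n. ?s n - V \<psi> n)" using R(4)[OF p] by simp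
    then have "l2_norm \<psi> \<le> 1 / d * l2_norm (\<lambda>n. ?s n - V \<psi> n)"
      using R(2)[OF l2_diff[OF s V(1)[OF p]]] by metis
    also have "\<dots> \<le> 1 / d * (l2_norm ?s + r * l2_norm \<psi>)"
      using l2_norm_diff[OF s V(1)[OF p]] V(2)[OF p] d0 by (intro mult_left_mono) auto
    finally show ?thesis using d0 r by (simp add: field_simps)
  qed
  fix \<phi> :: "int \<Rightarrow> complex" assume p: "\<phi> \<in> l2"
  define x where "x = rec_nat (\<lambda>n. 0) (\<lambda>m \<psi>. R (\<lambda>n. \<phi> n - V \<psi> n))"
  have x0: "x 0 = (\<lambda>n. 0)" and xS: "x (Suc m) = R (\<lambda>n. \<phi> n - V (x m) n)" for m
    by (simp_all add: x_def)
  have z0: "(\<lambda>n. 0) \<in> l2" by (simp add: l2_def)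
  have x: "x m \<in> l2" for m
    by (induction m) (auto simp: x0 xS z0 intro!: R V l2_diff p)
  have xb: "l2_norm (x m) \<le> l2_norm \<phi> / (d - r)" for m
  proof (induction m)
    case 0
    have "l2_norm (\<lambda>n. 0) = 0" by (simp add: l2_norm_def)
    then show ?case using r by (simp add: x0)
  next
    case (Suc m)
    have "l2_norm (x (Suc m)) \<le> 1 / d * l2_norm (\<lambda>n. \<phi> n - V (x m) n)"
      unfolding xS by (intro R l2_diff p V x)
    also have "\<dots> \<le> 1 / d * (l2_norm \<phi> + r * (l2_norm \<phi> / (d - r)))"
      using l2_norm_diff[OF p V(1)[OF x[of m]]] V(2)[OF x[of m]] d0 mult_left_mono[OF Suc r0]
      by (intro mult_left_mono) auto
    also have "\<dots> = l2_norm \<phi> / (d - r)" using d0 r by (simp add: field_simps)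
    finally show ?case .
  qed
  have xd: "l2_norm (\<lambda>n. x (Suc m) n - x m n) \<le> (r / d) ^ m * l2_norm (x 1)" for m
  proof (induction m)
    case 0
    then show ?case by (simp add: x0)
  next
    case (Suc m)
    have e: "(\<lambda>n. x (Suc (Suc m)) n - x (Suc m) n) = R (V (\<lambda>n. x m n - x (Suc m) n))"
    proof -
      define Y where "Y m = (\<lambda>n. \<phi> n - V (x m) n)" for m
      have xY: "x (Suc m) = R (Y m)" for m unfolding Y_def by (rule xS)
      have Y: "Y m \<in> l2" for m unfolding Y_def by (intro l2_diff p V x)
      have "(\<lambda>n. x (Suc (Suc m)) n - x (Suc m) n) = R (\<lambda>n. Y (Suc m) n - Y m n)"
        using Rd[OF Y[of "Suc m"] Y[of m]] xY[of "Suc m"] xY[of m] by simp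
      also have "(\<lambda>n. Y (Suc m) n - Y m n) = V (\<lambda>n. x m n - x (Suc m) n)"
        by (intro ext) (simp add: Y_def V_def algebra_simps)
      finally show ?thesis .
    qed
    have dl: "(\<lambda>n. x m n - x (Suc m) n) \<in> l2" by (intro l2_diff x)
    have "l2_norm (R (V (\<lambda>n. x m n - x (Suc m) n))) \<le> 1 / d * (r * l2_norm (\<lambda>n. x m n - x (Suc m) n))"
      using R(2)[OF V(1)[OF dl]] mult_left_mono[OF V(2)[OF dl], of "1 / d"] d0 by simp
    also have "l2_norm (\<lambda>n. x m n - x (Suc m) n) = l2_norm (\<lambda>n. x (Suc m) n - x m n)"
      using l2_norm_uminus[of "\<lambda>n. x (Suc m) n - x m n"] by simp
    also have "1 / d * (r * l2_norm (\<lambda>n. x (Suc m) n - x m n)) \<le> 1 / d * (r * ((r / d) ^ m * l2_norm (x 1)))"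
      using Suc d0 r0 by (intro mult_left_mono) auto
    finally show ?case unfolding e by simp
  qed
  \<comment> \<open>The limit is taken coordinate by coordinate, the increments being dominated by a
    geometric series; the uniform bound \<open>xb\<close> then places it in
    \<open>l2\<close>.\<close>
  have lim: "\<exists>y. (\<lambda>m. x m n) \<longlonglongrightarrow> y" for n
  proof -
    have "summable (\<lambda>m. x (Suc m) n - x m n)"
    proof (rule summable_comparison_test)
      show "\<exists>N. \<forall>m\<ge>N. norm (x (Suc m) n - x m n) \<le> (r / d) ^ m * l2_norm (x 1)"
      proof (intro exI allI impI)
        fix m :: nat
        show "norm (x (Suc m) n - x m n) \<le> (r / d) ^ m * l2_norm (x 1)"
          using norm_le_l2_norm[OF l2_diff[OF x[of "Suc m"] x[of m]], of n] xd[of m] by (rule order_trans)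
      qed
      show "summable (\<lambda>m. (r / d) ^ m * l2_norm (x 1))"
        by (intro summable_mult2 summable_geometric) (use r r0 d0 in auto)
    qed
    then have "(\<lambda>m. \<Sum>i<m. x (Suc i) n - x i n) \<longlonglongrightarrow> (\<Sum>m. x (Suc m) n - x m n)"
      by (rule summable_LIMSEQ)
    moreover have "(\<Sum>i<m. x (Suc i) n - x i n) = x m n" for m
      using sum_lessThan_telescope[of "\<lambda>i. x i n" m] by (simp add: x0)
    ultimately show ?thesis by auto
  qed
  then obtain y where y: "\<And>n. (\<lambda>m. x m n) \<longlonglongrightarrow> y n" by metis
  have "y \<in> l2"
  proof (rule l2I_finite)
    fix F :: "int set" assume F: "finite F"
    show "(\<Sum>n\<in>F. (cmod (y n))\<^sup>2) \<le> (l2_norm \<phi> / (d - r))\<^sup>2"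
    proof (rule LIMSEQ_le_const2)
      show "(\<lambda>m. \<Sum>n\<in>F. (cmod (x m n))\<^sup>2) \<longlonglongrightarrow> (\<Sum>n\<in>F. (cmod (y n))\<^sup>2)"
        by (intro tendsto_intros y)
      have "(\<Sum>n\<in>F. (cmod (x m n))\<^sup>2) \<le> (l2_norm \<phi> / (d - r))\<^sup>2" for m
        using sum_le_l2_norm[OF x F] power_mono[OF xb l2_norm_nonneg, of _ 2] order_trans by blast
      then show "\<exists>N. \<forall>m\<ge>N. (\<Sum>n\<in>F. (cmod (x m n))\<^sup>2) \<le> (l2_norm \<phi> / (d - r))\<^sup>2" by blast
    qed
  qed (use r in simp)
  moreover have "shifted (jacobi a b') z y = \<phi>"
  proof
    fix n
    have e: "shifted (jacobi a b) z (x (Suc m)) n = \<phi> n - V (x m) n" for m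
      unfolding xS by (subst R(3)) (auto intro!: l2_diff p V x)
    have "(\<lambda>m. shifted (jacobi a b) z (x (Suc m)) n) \<longlonglongrightarrow> shifted (jacobi a b) z y n"
      unfolding shifted_def jacobi_def by (intro tendsto_intros LIMSEQ_Suc y)
    moreover have "(\<lambda>m. shifted (jacobi a b) z (x (Suc m)) n) \<longlonglongrightarrow> \<phi> n - V y n"
      unfolding e V_def by (intro tendsto_intros y)
    ultimately have "shifted (jacobi a b) z y n = \<phi> n - V y n" by (rule LIMSEQ_unique)
    then show "shifted (jacobi a b') z y n = \<phi> n" by (simp add: S)
  qed
  ultimately show "\<exists>\<psi>\<in>l2. shifted (jacobi a b') z \<psi> = \<phi>" by blast
qed

lemma (in kernel_off_spectrum) resolvent_set_perturb:
  assumes "bseq b'" "\<And>n. \<bar>b' n - b n\<bar> \<le> r" "r < d"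
  shows "z \<in> resolvent_set (jacobi a b')"
  by (rule resolvent_set_perturb[where R = R, OF a b assms(1) _ _ _ _ assms(2,3)])
    (fact R_l2 shifted_R R_shifted)+

text \<open>The increments are summable in L1, so their series converges absolutely almost
  everywhere, and the sum of their moduli dominates the distance of every term to the limit.\<close>

lemma L1_convergent:
  fixes g :: "nat \<Rightarrow> 'a \<Rightarrow> real"
  assumes int: "\<And>i. integrable M (g i)"
    and bd: "\<And>i. (\<integral>x. \<bar>g (Suc i) x - g i x\<bar> \<partial>M) \<le> C / 2 ^ i"
  obtains h where "integrable M h" "AE x in M. (\<lambda>i. g i x) \<longlonglongrightarrow> h x"
    "(\<lambda>i. \<integral>x. \<bar>g i x - h x\<bar> \<partial>M) \<longlonglongrightarrow> 0"
proof -
  have [measurable]: "g i \<in> borel_measurable M" for i using int by blast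
  define u where "u i x = g (Suc i) x - g i x" for i x
  have iu: "integrable M (u i)" for i unfolding u_def by (intro Bochner_Integration.integrable_diff int)
  have [measurable]: "u i \<in> borel_measurable M" for i using iu by blast
  have sumI: "summable (\<lambda>i. \<integral>x. norm (u i x) \<partial>M)"
  proof (rule summable_comparison_test)
    show "\<exists>N. \<forall>i\<ge>N. norm (\<integral>x. norm (u i x) \<partial>M) \<le> C * (1 / 2) ^ i"
      using bd by (auto simp: u_def power_divide)
    show "summable (\<lambda>i. C * (1 / 2 :: real) ^ i)" by (intro summable_mult summable_geometric) auto
  qed
  have "(\<integral>\<^sup>+x. (\<Sum>i. ennreal (norm (u i x))) \<partial>M) = (\<Sum>i. ennreal (\<integral>x. norm (u i x) \<partial>M))"
    by (subst nn_integral_suminf) (auto intro!: suminf_cong nn_integral_eq_integral integrable_norm iu simp del: real_norm_def)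
  also have "\<dots> \<noteq> \<infinity>"
    using sumI by (subst suminf_ennreal2) auto
  finally have "AE x in M. (\<Sum>i. ennreal (norm (u i x))) \<noteq> \<infinity>"
    by (intro nn_integral_PInf_AE) auto
  then have aes: "AE x in M. summable (\<lambda>i. norm (u i x))"
    by eventually_elim (rule summable_suminf_not_top, auto)
  define h where "h x = g 0 x + (\<Sum>i. u i x)" for x
  have ih: "integrable M h"
    unfolding h_def by (intro Bochner_Integration.integrable_add int integrable_suminf iu aes sumI)
  have tele: "g n x = g 0 x + (\<Sum>i<n. u i x)" for n x
    using sum_lessThan_telescope[of "\<lambda>i. g i x" n] by (simp add: u_def)
  have lim: "AE x in M. (\<lambda>i. g i x) \<longlonglongrightarrow> h x"
    using aes
  proof eventually_elim
    case (elim x)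
    have "(\<lambda>n. g 0 x + (\<Sum>i<n. u i x)) \<longlonglongrightarrow> h x"
      unfolding h_def by (intro tendsto_intros summable_LIMSEQ summable_norm_cancel[OF elim])
    then show ?case by (subst tele)
  qed
  have "(\<lambda>i. \<integral>x. \<bar>g i x - h x\<bar> \<partial>M) \<longlonglongrightarrow> (\<integral>x. 0 \<partial>M)"
  proof (rule integral_dominated_convergence[where w = "\<lambda>x. \<Sum>i. norm (u i x)"])
    have [measurable]: "h \<in> borel_measurable M" using ih by blast
    show "(\<lambda>x. \<bar>g i x - h x\<bar>) \<in> borel_measurable M" for i by measurable
    show "integrable M (\<lambda>x. \<Sum>i. norm (u i x))"
      by (intro integrable_suminf integrable_norm iu) (use aes sumI in simp_all)
    show "AE x in M. (\<lambda>i. \<bar>g i x - h x\<bar>) \<longlonglongrightarrow> 0"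
      using lim by eventually_elim (auto intro!: tendsto_rabs_zero LIM_zero)
    show "AE x in M. norm \<bar>g n x - h x\<bar> \<le> (\<Sum>i. norm (u i x))" for n
      using aes
    proof eventually_elim
      case (elim x)
      note s = summable_norm_cancel[OF elim]
      have "h x - g n x = (\<Sum>i. u (i + n) x)"
        unfolding tele[of n] h_def using suminf_split_initial_segment[OF s, of n] by simp
      then have "norm \<bar>g n x - h x\<bar> = norm (\<Sum>i. u (i + n) x)" by (metis abs_idempotent abs_minus_commute real_norm_def)
      also have "\<dots> \<le> (\<Sum>i. norm (u (i + n) x))"
        by (rule summable_norm) (use elim in \<open>simp add: summable_iff_shift[of "\<lambda>i. norm (u i x)"] del: real_norm_def\<close>)
      also have "\<dots> \<le> (\<Sum>i. norm (u i x))"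
        using suminf_split_initial_segment[OF elim, of n] by (simp add: sum_nonneg)
      finally show ?case .
    qed
  qed measurable
  then show thesis using that[OF ih lim] by simp
qed


text \<open>L1 convergence keeps the total masses; convergence almost everywhere keeps positivity
  and, together with pointwise convergence of the potentials, the recurrence.\<close>

lemma spectral_kernel_limit:
  fixes f :: "nat \<Rightarrow> int \<Rightarrow> int \<Rightarrow> real \<Rightarrow> real"
  assumes f: "\<And>n. spectral_kernel a (b n) (f n)"
    and b: "\<And>j. (\<lambda>n. b n j) \<longlonglongrightarrow> b' j"
    and close: "\<And>n j k. \<bar>j\<bar> \<le> int n \<Longrightarrow> \<bar>k\<bar> \<le> int n \<Longrightarrow>
      (\<integral>t. \<bar>f (Suc n) j k t - f n j k t\<bar> \<partial>lborel) \<le> 1 / 2 ^ n"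
  obtains g where "spectral_kernel a b' g"
proof -
  have int: "integrable lborel (f n j k)" for n j k using f by (simp add: spectral_kernel_def)
  have "\<exists>h. integrable lborel h \<and> (AE t in lborel. (\<lambda>n. f n j k t) \<longlonglongrightarrow> h t) \<and>
     (\<integral>t. h t \<partial>lborel) = (if j = k then 1 else 0)" for j k
  proof -
    \<comment> \<open>The entry at j, k is controlled only from stage max \<bar>j\<bar>
      \<bar>k\<bar> on, hence the offset.\<close>
    define m where "m = nat (max \<bar>j\<bar> \<bar>k\<bar>)"
    have "(\<integral>t. \<bar>f (Suc i + m) j k t - f (i + m) j k t\<bar> \<partial>lborel) \<le> 1 / 2 ^ i" for i
    proof -
      have "(\<integral>t. \<bar>f (Suc (i + m)) j k t - f (i + m) j k t\<bar> \<partial>lborel) \<le> 1 / 2 ^ (i + m)"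
        by (rule close) (auto simp: m_def)
      also have "\<dots> \<le> 1 / 2 ^ i" by (intro divide_left_mono power_increasing) auto
      finally show ?thesis by simp
    qed
    from L1_convergent[of lborel "\<lambda>i. f (i + m) j k" 1, OF int this]
    obtain h where h: "integrable lborel h" "AE t in lborel. (\<lambda>i. f (i + m) j k t) \<longlonglongrightarrow> h t"
      "(\<lambda>i. \<integral>t. \<bar>f (i + m) j k t - h t\<bar> \<partial>lborel) \<longlonglongrightarrow> 0" by blast
    have "(\<lambda>i. (\<integral>t. f (i + m) j k t \<partial>lborel) - (\<integral>t. h t \<partial>lborel)) \<longlonglongrightarrow> 0"
    proof (rule tendsto_rabs_zero_cancel, rule tendsto_sandwich[OF _ _ tendsto_const h(3)])
      show "\<forall>\<^sub>F i in sequentially. \<bar>(\<integral>t. f (i + m) j k t \<partial>lborel) - (\<integral>t. h t \<partial>lborel)\<bar>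
        \<le> (\<integral>t. \<bar>f (i + m) j k t - h t\<bar> \<partial>lborel)"
      proof (rule always_eventually, rule allI)
        fix i
        have "(\<integral>t. f (i + m) j k t \<partial>lborel) - (\<integral>t. h t \<partial>lborel) = (\<integral>t. f (i + m) j k t - h t \<partial>lborel)"
          by (rule Bochner_Integration.integral_diff[symmetric]) (fact int h(1))+
        then show "\<bar>(\<integral>t. f (i + m) j k t \<partial>lborel) - (\<integral>t. h t \<partial>lborel)\<bar>
          \<le> (\<integral>t. \<bar>f (i + m) j k t - h t\<bar> \<partial>lborel)"
          using integral_norm_bound[of lborel "\<lambda>t. f (i + m) j k t - h t"] by simp
      qed
    qed simp
    moreover have "(\<integral>t. f (i + m) j k t \<partial>lborel) = (if j = k then 1 else 0)" for i
      using f by (simp add: spectral_kernel_def)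
    ultimately have "(if j = k then 1 else 0) - (\<integral>t. h t \<partial>lborel) = 0"
      by (simp add: LIMSEQ_const_iff)
    moreover have "AE t in lborel. (\<lambda>n. f n j k t) \<longlonglongrightarrow> h t"
      using h(2) by eventually_elim (rule LIMSEQ_offset)
    ultimately show ?thesis using h(1) by (intro exI[of _ h]) auto
  qed
  note ex = this
  define g where "g j k = (SOME h. integrable lborel h \<and> (AE t in lborel. (\<lambda>n. f n j k t) \<longlonglongrightarrow> h t) \<and>
     (\<integral>t. h t \<partial>lborel) = (if j = k then 1 else 0))" for j k
  have g: "integrable lborel (g j k)" "AE t in lborel. (\<lambda>n. f n j k t) \<longlonglongrightarrow> g j k t"
    "(\<integral>t. g j k t \<partial>lborel) = (if j = k then 1 else 0)" for j k
    using someI_ex[OF ex[of j k], folded g_def] by blast+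
  have L: "AE t in lborel. \<forall>j k. (\<lambda>n. f n j k t) \<longlonglongrightarrow> g j k t"
    using g(2) by (simp add: AE_all_countable)
  have P: "AE t in lborel. \<forall>n. psd (\<lambda>j k. f n j k t)"
    unfolding AE_all_countable using f unfolding spectral_kernel_def by blast
  have E: "AE t in lborel. \<forall>n j k. a (j - 1) * f n (j - 1) k t + a j * f n (j + 1) k t + b n j * f n j k t
        = t * f n j k t"
    using f unfolding spectral_kernel_def by (subst AE_all_countable) blast
  have "AE t in lborel. psd (\<lambda>j k. g j k t)"
    using L P
  proof eventually_elim
    case (elim t)
    have l: "(\<lambda>n. f n j k t) \<longlonglongrightarrow> g j k t" for j k using elim by blast
    have sym: "f n j k t = f n k j t" for n j k using elim by (simp add: psd_def)
    have "g j k t = g k j t" for j k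
    proof (rule LIMSEQ_unique[OF l])
      have "(\<lambda>n. f n j k t) = (\<lambda>n. f n k j t)" by (intro ext sym)
      then show "(\<lambda>n. f n j k t) \<longlonglongrightarrow> g k j t" using l[of k j] by simp
    qed
    moreover have "0 \<le> (\<Sum>j\<in>F. \<Sum>k\<in>F. c j * c k * g j k t)" if "finite F" for F c
    proof (rule LIMSEQ_le_const)
      show "(\<lambda>n. \<Sum>j\<in>F. \<Sum>k\<in>F. c j * c k * f n j k t) \<longlonglongrightarrow> (\<Sum>j\<in>F. \<Sum>k\<in>F. c j * c k * g j k t)"
        by (intro tendsto_intros l)
      show "\<exists>N. \<forall>n\<ge>N. 0 \<le> (\<Sum>j\<in>F. \<Sum>k\<in>F. c j * c k * f n j k t)"
        using elim(2)[rule_format, unfolded psd_def, THEN conjunct2, rule_format, OF that] by simp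
    qed
    ultimately show ?case unfolding psd_def by blast
  qed
  moreover have "AE t in lborel. \<forall>j k. a (j - 1) * g (j - 1) k t + a j * g (j + 1) k t + b' j * g j k t
        = t * g j k t"
    using L E
  proof eventually_elim
    case (elim t)
    have l: "(\<lambda>n. f n j k t) \<longlonglongrightarrow> g j k t" for j k using elim by blast
    show ?case
    proof (intro allI)
      fix j k
      have "(\<lambda>n. a (j - 1) * f n (j - 1) k t + a j * f n (j + 1) k t + b n j * f n j k t)
         \<longlonglongrightarrow> a (j - 1) * g (j - 1) k t + a j * g (j + 1) k t + b' j * g j k t"
        by (intro tendsto_intros l b)
      moreover have "(\<lambda>n. a (j - 1) * f n (j - 1) k t + a j * f n (j + 1) k t + b n j * f n j k t)
         \<longlonglongrightarrow> t * g j k t"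
        unfolding elim(2)[rule_format] by (intro tendsto_intros l)
      ultimately show "a (j - 1) * g (j - 1) k t + a j * g (j + 1) k t + b' j * g j k t = t * g j k t"
        by (rule LIMSEQ_unique)
    qed
  qed
  ultimately have "spectral_kernel a b' g" unfolding spectral_kernel_def by (simp add: g)
  then show thesis by (rule that)
qed

section \<open>Absolute continuity from spectral kernels\<close>

text \<open>The two vectors are rescaled by reciprocal factors. A small weight s makes the large
  vector cheap at the expense of the small one.\<close>

lemma sesq_bound_scaled:
  assumes "psd M" "finite F" "s > 0"
  shows "2 * cmod (sesq F M \<phi> \<psi>) \<le> s * Re (sesq F M \<phi> \<phi>) + Re (sesq F M \<psi> \<psi>) / s"
proof -
  define c where "c = sqrt s"
  have c: "c > 0" "c * c = s" using assms(3) by (auto simp: c_def)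
  have "cmod (sesq F M (\<lambda>j. of_real c * \<phi> j) (\<lambda>j. of_real (1 / c) * \<psi> j))
     \<le> (Re (sesq F M (\<lambda>j. of_real c * \<phi> j) (\<lambda>j. of_real c * \<phi> j))
        + Re (sesq F M (\<lambda>j. of_real (1 / c) * \<psi> j) (\<lambda>j. of_real (1 / c) * \<psi> j))) / 2"
    by (rule sesq_bound[OF assms(1,2)])
  moreover have "sesq F M (\<lambda>j. of_real c * \<phi> j) (\<lambda>j. of_real (1 / c) * \<psi> j) = sesq F M \<phi> \<psi>"
    unfolding sesq_scale_left sesq_scale_right using c(1) by simp
  moreover have "sesq F M (\<lambda>j. of_real c * \<phi> j) (\<lambda>j. of_real c * \<phi> j) = of_real s * sesq F M \<phi> \<phi>"
    unfolding sesq_scale_left sesq_scale_right c(2)[symmetric] by simp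
  moreover have "sesq F M (\<lambda>j. of_real (1 / c) * \<psi> j) (\<lambda>j. of_real (1 / c) * \<psi> j) = of_real (1 / s) * sesq F M \<psi> \<psi>"
    unfolding sesq_scale_left sesq_scale_right c(2)[symmetric] by simp
  ultimately show ?thesis by simp
qed

abbreviation centered :: "nat \<Rightarrow> int set" where
  "centered n \<equiv> {- int n..int n}"

lemma filterlim_centered: "filterlim centered (finite_subsets_at_top UNIV) sequentially"
  unfolding filterlim_finite_subsets_at_top
proof (intro allI impI)
  fix X :: "int set" assume "finite X \<and> X \<subseteq> UNIV"
  then have fin: "finite X" by simp
  define N where "N = Max (insert 0 (abs ` X))"
  have N: "\<bar>x\<bar> \<le> N" if "x \<in> X" for x
    unfolding N_def by (rule Max_ge) (use fin that in auto)
  show "\<forall>\<^sub>F n in sequentially. finite (centered n) \<and> X \<subseteq> centered n \<and> centered n \<subseteq> UNIV"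
    unfolding eventually_sequentially
  proof (intro exI[of _ "nat N"] allI impI conjI)
    fix n assume "nat N \<le> n"
    then show "X \<subseteq> centered n" using N by (fastforce simp: abs_le_iff)
  qed auto
qed

lemma sum_centered_tendsto:
  fixes g :: "int \<Rightarrow> 'a :: {topological_comm_monoid_add, t2_space}"
  assumes "g summable_on UNIV"
  shows "(\<lambda>n. sum g (centered n)) \<longlonglongrightarrow> (\<Sum>\<^sub>\<infinity>k. g k)"
  using has_sum_infsum[OF assms] filterlim_centered unfolding has_sum_def by (rule filterlim_compose)

text \<open>Cross terms prevent the truncated densities from being monotone in n, so convergence is
  obtained along a fast subsequence. With \<psi> on the larger window split into the smaller
  truncation \<eta> and the increment \<delta>, the cross term costs s times the total mass plus the
  mass of the increment divided by s.\<close>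

lemma spectral_density_exists:
  assumes f: "spectral_kernel a b f" and p: "\<psi> \<in> l2"
  obtains g r where "integrable lborel g" "AE t in lborel. 0 \<le> g t" "filterlim r sequentially sequentially"
    "(\<lambda>i. \<integral>t. \<bar>Re (sesq (centered (r i)) (\<lambda>j k. f j k t) \<psi> \<psi>) - g t\<bar> \<partial>lborel) \<longlonglongrightarrow> 0"
proof -
  define q where "q n t = Re (sesq (centered n) (\<lambda>j k. f j k t) \<psi> \<psi>)" for n t
  define S where "S n = (\<Sum>k\<in>centered n. (cmod (\<psi> k))\<^sup>2)" for n
  define S\<^sub>0 where "S\<^sub>0 = (\<Sum>\<^sub>\<infinity>k. (cmod (\<psi> k))\<^sup>2)"
  have S0: "S\<^sub>0 \<ge> 0" by (simp add: S\<^sub>0_def infsum_nonneg)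
  have Sb: "S n \<le> S\<^sub>0" for n
    unfolding S_def S\<^sub>0_def by (rule finite_sum_le_infsum) (use p in \<open>auto simp: l2_def\<close>)
  have Sm: "S n \<le> S m" if "n \<le> m" for n m
    unfolding S_def by (rule sum_mono2) (use that in auto)
  have Sl: "S \<longlonglongrightarrow> S\<^sub>0"
    unfolding S_def S\<^sub>0_def by (rule sum_centered_tendsto) (use p in \<open>simp add: l2_def\<close>)
  have psd: "AE t in lborel. psd (\<lambda>j k. f j k t)" using f by (simp add: spectral_kernel_def)
  have iq: "integrable lborel (\<lambda>t. Re (sesq (centered n) (\<lambda>j k. f j k t) \<phi> \<phi>))" for n \<phi>
    by (intro integrable_Re spectral_kernel_integral_sesq(1)[OF f]) simp
  have Iq: "(\<integral>t. Re (sesq (centered n) (\<lambda>j k. f j k t) \<phi> \<phi>) \<partial>lborel) = (\<Sum>k\<in>centered n. (cmod (\<phi> k))\<^sup>2)" for n \<phi>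
    by (subst integral_Re[OF spectral_kernel_integral_sesq(1)[OF f]], simp)
      (simp add: spectral_kernel_integral_sesq(2)[OF f] cmod_power2[unfolded power2_eq_square] power2_eq_square)
  have diff: "(\<integral>t. \<bar>q m t - q n t\<bar> \<partial>lborel) \<le> s * S\<^sub>0 + (1 + 1 / s) * (S m - S n)"
    if nm: "n \<le> m" and s: "s > 0" for n m s
  proof -
    define \<eta> where "\<eta> k = (if k \<in> centered n then \<psi> k else 0)" for k
    define \<delta> where "\<delta> k = (if k \<in> centered n then 0 else \<psi> k)" for k
    have sub: "centered n \<subseteq> centered m" using nm by auto
    have e1: "sesq (centered m) M \<eta> \<eta> = sesq (centered n) M \<psi> \<psi>" for M
    proof -
      have "(\<Sum>j\<in>centered m. \<Sum>k\<in>centered m. cnj (\<eta> j) * \<eta> k * complex_of_real (M j k))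
          = (\<Sum>j\<in>centered n. \<Sum>k\<in>centered m. cnj (\<psi> j) * \<eta> k * complex_of_real (M j k))"
        by (rule sum.mono_neutral_cong_right) (use sub in \<open>auto simp: \<eta>_def\<close>)
      also have "\<dots> = (\<Sum>j\<in>centered n. \<Sum>k\<in>centered n. cnj (\<psi> j) * \<psi> k * complex_of_real (M j k))"
        by (rule sum.cong[OF refl], rule sum.mono_neutral_cong_right) (use sub in \<open>auto simp: \<eta>_def\<close>)
      finally show ?thesis unfolding sesq_def .
    qed
    have pe: "\<psi> = (\<lambda>k. \<eta> k + \<delta> k)" by (auto simp: \<eta>_def \<delta>_def)
    have n1: "(\<Sum>k\<in>centered m. (cmod (\<eta> k))\<^sup>2) = S n"
      unfolding S_def by (rule sum.mono_neutral_cong_right) (use sub in \<open>auto simp: \<eta>_def\<close>)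
    have n2: "(\<Sum>k\<in>centered m. (cmod (\<delta> k))\<^sup>2) = S m - S n"
    proof -
      have "(\<Sum>k\<in>centered m. (cmod (\<delta> k))\<^sup>2) = (\<Sum>k\<in>centered m - centered n. (cmod (\<psi> k))\<^sup>2)"
        by (rule sum.mono_neutral_cong_right) (auto simp: \<delta>_def)
      also have "\<dots> = S m - S n" unfolding S_def by (rule sum_diff) (use sub in auto)
      finally show ?thesis .
    qed
    let ?Q = "\<lambda>\<phi> t. Re (sesq (centered m) (\<lambda>j k. f j k t) \<phi> \<phi>)"
    have "(\<integral>t. \<bar>q m t - q n t\<bar> \<partial>lborel) \<le> (\<integral>t. (s * ?Q \<eta> t + ?Q \<delta> t / s) + ?Q \<delta> t \<partial>lborel)"
    proof (rule integral_mono_AE)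
      show "integrable lborel (\<lambda>t. \<bar>q m t - q n t\<bar>)"
        unfolding q_def by (intro integrable_abs Bochner_Integration.integrable_diff iq)
      show "integrable lborel (\<lambda>t. (s * ?Q \<eta> t + ?Q \<delta> t / s) + ?Q \<delta> t)"
        by (intro Bochner_Integration.integrable_add integrable_divide integrable_mult_right iq)
      show "AE t in lborel. \<bar>q m t - q n t\<bar> \<le> (s * ?Q \<eta> t + ?Q \<delta> t / s) + ?Q \<delta> t"
        using psd
      proof eventually_elim
        case (elim t)
        let ?M = "\<lambda>j k. f j k t"
        have "sesq (centered m) ?M \<psi> \<psi> = sesq (centered n) ?M \<psi> \<psi> + sesq (centered m) ?M \<eta> \<delta>
            + cnj (sesq (centered m) ?M \<eta> \<delta>) + sesq (centered m) ?M \<delta> \<delta>"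
        proof -
          have "sesq (centered m) ?M \<psi> \<psi> = sesq (centered m) ?M (\<lambda>k. \<eta> k + \<delta> k) (\<lambda>k. \<eta> k + \<delta> k)"
            by (simp only: pe[symmetric])
          then show ?thesis
            unfolding sesq_add_left sesq_add_right sesq_cnj[OF elim, of _ \<delta> \<eta>]
            by (simp add: e1 algebra_simps)
        qed
        then have "q m t - q n t = 2 * Re (sesq (centered m) ?M \<eta> \<delta>) + ?Q \<delta> t"
          unfolding q_def by simp
        moreover have "\<bar>Re (sesq (centered m) ?M \<eta> \<delta>)\<bar> \<le> cmod (sesq (centered m) ?M \<eta> \<delta>)"
          by (rule abs_Re_le_cmod)
        moreover have "2 * cmod (sesq (centered m) ?M \<eta> \<delta>) \<le> s * ?Q \<eta> t + ?Q \<delta> t / s"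
          by (rule sesq_bound_scaled[OF elim _ s]) simp
        moreover have "0 \<le> ?Q \<delta> t" by (rule sesq_nonneg[OF elim]) simp
        ultimately show ?case by linarith
      qed
    qed
    also have "\<dots> = s * S n + (S m - S n) / s + (S m - S n)"
    proof -
      have "(\<integral>t. (s * ?Q \<eta> t + ?Q \<delta> t / s) + ?Q \<delta> t \<partial>lborel)
        = s * (\<integral>t. ?Q \<eta> t \<partial>lborel) + (\<integral>t. ?Q \<delta> t \<partial>lborel) / s + (\<integral>t. ?Q \<delta> t \<partial>lborel)"
        by (subst Bochner_Integration.integral_add, intro Bochner_Integration.integrable_add integrable_divide integrable_mult_right iq, rule iq,
           subst Bochner_Integration.integral_add, intro integrable_mult_right iq, intro integrable_divide iq,
           simp only: integral_mult_right_zero integral_divide_zero)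
      then show ?thesis unfolding Iq n1 n2 .
    qed
    also have "\<dots> \<le> s * S\<^sub>0 + (1 + 1 / s) * (S m - S n)"
      using mult_left_mono[OF Sb[of n], of s] s by (simp add: algebra_simps diff_divide_distrib)
    finally show ?thesis .
  qed
  \<comment> \<open>Tails of size 8^-i match the weight s = 2^-i used below, since (1 + 2^i) 8^-i is
    at most 2 * 2^-i.\<close>
  have "\<exists>N. \<forall>n\<ge>N. S\<^sub>0 - S n \<le> 1 / 8 ^ i" for i :: nat
  proof -
    have "\<forall>\<^sub>F n in sequentially. S n > S\<^sub>0 - 1 / 8 ^ i"
      by (rule order_tendstoD(1)[OF Sl]) simp
    then obtain N where "\<forall>n\<ge>N. S n > S\<^sub>0 - 1 / 8 ^ i" unfolding eventually_sequentially by blast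
    then show ?thesis by (intro exI[of _ N]) (auto simp: less_imp_le algebra_simps)
  qed
  then obtain N where N: "\<And>i n. n \<ge> N i \<Longrightarrow> S\<^sub>0 - S n \<le> 1 / 8 ^ i" by metis
  \<comment> \<open>Summing the thresholds makes r strictly increasing while keeping r i \<ge> N
    i.\<close>
  define r where "r i = (\<Sum>l\<le>i. N l + 1)" for i
  have rS: "r (Suc i) = r i + (N (Suc i) + 1)" for i by (simp add: r_def)
  have rN: "N i \<le> r i" for i by (cases i) (auto simp: r_def)
  have ri: "i \<le> r i" for i by (induction i) (auto simp: rS)
  have step: "(\<integral>t. \<bar>q (r (Suc i)) t - q (r i) t\<bar> \<partial>lborel) \<le> (S\<^sub>0 + 2) / 2 ^ i" for i
  proof -
    have "(\<integral>t. \<bar>q (r (Suc i)) t - q (r i) t\<bar> \<partial>lborel)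
        \<le> (1 / 2 ^ i) * S\<^sub>0 + (1 + 1 / (1 / 2 ^ i)) * (S (r (Suc i)) - S (r i))"
      by (rule diff) (auto simp: rS)
    also have "S (r (Suc i)) - S (r i) \<le> 1 / 8 ^ i"
      using N[OF rN[of i]] Sb[of "r (Suc i)"] by linarith
    also have "(1 / 2 ^ i) * S\<^sub>0 + (1 + 1 / (1 / 2 ^ i)) * (1 / 8 ^ i) \<le> (S\<^sub>0 + 2) / 2 ^ i"
    proof -
      have "(1 + 2 ^ i) * 2 ^ i \<le> (2 :: real) * 8 ^ i"
      proof -
        have "(1 + 2 ^ i) * 2 ^ i \<le> (2 * 2 ^ i) * (4 ^ i :: real)"
          by (intro mult_mono power_mono) auto
        also have "\<dots> = 2 * 8 ^ i" by (simp add: power_mult_distrib[symmetric])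
        finally show ?thesis .
      qed
      then have "(1 + 2 ^ i) * (1 / 8 ^ i) \<le> 2 / (2 ^ i :: real)" by (simp add: field_simps)
      then show ?thesis by (simp add: add_divide_distrib)
    qed
    finally show ?thesis by (simp add: mult_left_mono)
  qed
  have "integrable lborel (q n)" for n unfolding q_def by (rule iq)
  from L1_convergent[of lborel "\<lambda>i. q (r i)", OF this step]
  obtain g where g: "integrable lborel g" "AE t in lborel. (\<lambda>i. q (r i) t) \<longlonglongrightarrow> g t"
    "(\<lambda>i. \<integral>t. \<bar>q (r i) t - g t\<bar> \<partial>lborel) \<longlonglongrightarrow> 0" by blast
  have "AE t in lborel. 0 \<le> g t"
    using g(2) psd
  proof eventually_elim
    case (elim t)
    show ?case
      by (rule LIMSEQ_le_const[OF elim(1)]) (auto simp: q_def intro!: exI[of _ 0] sesq_nonneg[OF elim(2)])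
  qed
  moreover have "filterlim r sequentially sequentially"
    by (rule filterlim_at_top_mono[OF filterlim_ident]) (auto simp: ri)
  ultimately show thesis using that g(1,3) unfolding q_def by blast
qed


text \<open>The truncated Green forms \<open>A n\<close> have two limits. Along r they tend to the
  Borel transform of g, because the truncated densities converge in L1 and the denominator is
  bounded below. They also tend to the resolvent matrix element, because R is bounded and the tails
  of \<psi> vanish in norm. Equating both exhibits g as the spectral density.\<close>

lemma spectral_kernel_imp_ac:
  assumes a: "bseq a" and b: "bseq b" and f: "spectral_kernel a b f"
  shows "purely_absolutely_continuous_spectrum (jacobi a b)"
  unfolding purely_absolutely_continuous_spectrum_def
proof
  fix \<psi> :: "int \<Rightarrow> complex" assume p: "\<psi> \<in> l2"
  define q where "q n t = Re (sesq (centered n) (\<lambda>j k. f j k t) \<psi> \<psi>)" for n t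
  obtain g r where g: "integrable lborel g" "AE t in lborel. 0 \<le> g t" and r: "filterlim r sequentially sequentially"
    and lim: "(\<lambda>i. \<integral>t. \<bar>q (r i) t - g t\<bar> \<partial>lborel) \<longlonglongrightarrow> 0"
    using spectral_density_exists[OF f p] unfolding q_def by blast
  have gm [measurable]: "g \<in> borel_measurable lborel" using g(1) by blast
  have iq: "integrable lborel (q n)" for n
    unfolding q_def by (intro integrable_Re spectral_kernel_integral_sesq(1)[OF f]) simp
  define \<mu> where "\<mu> = density lborel (\<lambda>t. ennreal (g t))"
  have psd: "AE t in lborel. psd (\<lambda>j k. f j k t)" using f by (simp add: spectral_kernel_def)
  have "l2_inner \<psi> (resolvent (jacobi a b) z \<psi>) = (\<integral>x. 1 / (complex_of_real x - z) \<partial>\<mu>)" if z: "Im z \<noteq> 0" for z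
  proof -
    define d where "d = \<bar>Im z\<bar>"
    have dz: "d > 0" "d \<le> cmod (complex_of_real t - z)" for t
    proof -
      show "d > 0" using z by (simp add: d_def)
      have "d = \<bar>Im (complex_of_real t - z)\<bar>" by (simp add: d_def)
      then show "d \<le> cmod (complex_of_real t - z)" by (simp only: abs_Im_le_cmod)
    qed
    interpret kernel_off_spectrum a b f z d
      by standard (use a b f dz(1) in \<open>auto intro!: AE_I2 dz(2)\<close>)
    define A where "A n = (\<Sum>j\<in>centered n. \<Sum>k\<in>centered n. cnj (\<psi> j) * \<psi> k * green f z j k)" for n
    define I where "I = (\<integral>t. complex_of_real (g t) / (complex_of_real t - z) \<partial>lborel)"
    have int: "integrable lborel (\<lambda>t. complex_of_real (h t) / (complex_of_real t - z))"
      if "integrable lborel h" for h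
    proof (rule Bochner_Integration.integrable_bound)
      show "integrable lborel (\<lambda>t. h t / d)" by (intro integrable_divide that)
      have [measurable]: "h \<in> borel_measurable lborel" using that by blast
      show "(\<lambda>t. complex_of_real (h t) / (complex_of_real t - z)) \<in> borel_measurable lborel" by measurable
      show "AE t in lborel. norm (complex_of_real (h t) / (complex_of_real t - z)) \<le> norm (h t / d)"
      proof (rule AE_I2)
        fix t
        have "\<bar>h t\<bar> / cmod (complex_of_real t - z) \<le> \<bar>h t\<bar> / d"
          by (intro frac_le) (auto intro: dz)
        then show "norm (complex_of_real (h t) / (complex_of_real t - z)) \<le> norm (h t / d)"
          using dz(1) by (simp add: norm_divide)
      qed
    qed
    have AI: "A n = (\<integral>t. complex_of_real (q n t) / (complex_of_real t - z) \<partial>lborel)" for n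
      unfolding A_def green_sesq_eq
    proof (rule integral_cong_AE)
      have [measurable]: "(\<lambda>t. sesq (centered n) (\<lambda>j k. f j k t) \<psi> \<psi>) \<in> borel_measurable lborel"
        using spectral_kernel_integral_sesq(1)[OF f] by (rule borel_measurable_integrable) simp
      have [measurable]: "q n \<in> borel_measurable lborel" using iq by blast
      show "(\<lambda>t. sesq (centered n) (\<lambda>j k. f j k t) \<psi> \<psi> / (complex_of_real t - z)) \<in> borel_measurable lborel"
        "(\<lambda>t. complex_of_real (q n t) / (complex_of_real t - z)) \<in> borel_measurable lborel" by measurable
      show "AE t in lborel. sesq (centered n) (\<lambda>j k. f j k t) \<psi> \<psi> / (complex_of_real t - z)
         = complex_of_real (q n t) / (complex_of_real t - z)"
        using psd by eventually_elim (simp add: q_def complex_eq_iff[of "sesq _ _ _ _"] sesq_Im)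
    qed
    have "(\<lambda>i. A (r i) - I) \<longlonglongrightarrow> 0"
    proof (rule Lim_null_comparison)
      have "(\<lambda>i. (\<integral>t. \<bar>q (r i) t - g t\<bar> \<partial>lborel) / d) \<longlonglongrightarrow> 0 / d" by (intro tendsto_intros lim) (use d in simp)
      then show "(\<lambda>i. (\<integral>t. \<bar>q (r i) t - g t\<bar> \<partial>lborel) / d) \<longlonglongrightarrow> 0" by simp
      show "\<forall>\<^sub>F i in sequentially. norm (A (r i) - I) \<le> (\<integral>t. \<bar>q (r i) t - g t\<bar> \<partial>lborel) / d"
      proof (rule always_eventually, rule allI)
        fix i
        have dd: "integrable lborel (\<lambda>t. q (r i) t - g t)" by (intro Bochner_Integration.integrable_diff iq g)
        have "A (r i) - I = (\<integral>t. complex_of_real (q (r i) t - g t) / (complex_of_real t - z) \<partial>lborel)"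
          unfolding AI I_def of_real_diff diff_divide_distrib
          by (rule Bochner_Integration.integral_diff[symmetric]) (intro int iq g)+
        also have "norm \<dots> \<le> (\<integral>t. norm (complex_of_real (q (r i) t - g t) / (complex_of_real t - z)) \<partial>lborel)"
          by (rule integral_norm_bound)
        also have "\<dots> \<le> (\<integral>t. \<bar>q (r i) t - g t\<bar> / d \<partial>lborel)"
        proof (rule integral_mono)
          show "integrable lborel (\<lambda>t. norm (complex_of_real (q (r i) t - g t) / (complex_of_real t - z)))"
            by (intro integrable_norm int dd)
          show "integrable lborel (\<lambda>t. \<bar>q (r i) t - g t\<bar> / d)" by (intro integrable_divide integrable_abs dd)
          show "norm (complex_of_real (q (r i) t - g t) / (complex_of_real t - z)) \<le> \<bar>q (r i) t - g t\<bar> / d" for t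
            unfolding norm_divide norm_of_real by (intro frac_le) (auto intro: dz)
        qed
        finally show "norm (A (r i) - I) \<le> (\<integral>t. \<bar>q (r i) t - g t\<bar> \<partial>lborel) / d" by simp
      qed
    qed
    then have lim1: "(\<lambda>i. A (r i)) \<longlonglongrightarrow> I" by (simp add: LIM_zero_iff)
    define B where "B n = (\<Sum>j\<in>centered n. cnj (\<psi> j) * R \<psi> j)" for n
    have cp: "(\<lambda>n. cnj (\<psi> n)) \<in> l2" using p by (simp add: l2_def)
    have Blim: "B \<longlonglongrightarrow> l2_inner \<psi> (R \<psi>)"
      unfolding B_def l2_inner_def by (intro sum_centered_tendsto l2_summable cp R_l2 p)
    define S where "S n = (\<Sum>k\<in>centered n. (cmod (\<psi> k))\<^sup>2)" for n
    have Sl: "S \<longlonglongrightarrow> (l2_norm \<psi>)\<^sup>2"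
      unfolding S_def l2_norm_square by (rule sum_centered_tendsto) (use p in \<open>simp add: l2_def\<close>)
    \<comment> \<open>The error is the pairing of \<psi> with R applied to the tail of \<psi>; the
      norm of the tail is the square root of the mass missing from the window.\<close>
    have AB: "cmod (B n - A n) \<le> l2_norm \<psi> * (sqrt ((l2_norm \<psi>)\<^sup>2 - S n) / d)" for n
    proof -
      define \<delta> where "\<delta> k = (if k \<in> centered n then 0 else \<psi> k)" for k
      have Sn: "S n \<le> (l2_norm \<psi>)\<^sup>2" unfolding S_def by (rule sum_le_l2_norm[OF p]) simp
      have fin: "(\<Sum>k\<in>H. (cmod (\<delta> k))\<^sup>2) \<le> (sqrt ((l2_norm \<psi>)\<^sup>2 - S n))\<^sup>2" if H: "finite H" for H
      proof -
        have "(\<Sum>k\<in>H. (cmod (\<delta> k))\<^sup>2) = (\<Sum>k\<in>H - centered n. (cmod (\<psi> k))\<^sup>2)"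
          by (rule sum.mono_neutral_cong_right) (use H in \<open>auto simp: \<delta>_def\<close>)
        moreover have "(\<Sum>k\<in>H - centered n. (cmod (\<psi> k))\<^sup>2) + S n = (\<Sum>k\<in>(H - centered n) \<union> centered n. (cmod (\<psi> k))\<^sup>2)"
          unfolding S_def by (rule sum.union_disjoint[symmetric]) (use H in auto)
        moreover have "\<dots> \<le> (l2_norm \<psi>)\<^sup>2" by (rule sum_le_l2_norm[OF p]) (use H in simp)
        ultimately show ?thesis using Sn by simp
      qed
      have dl: "\<delta> \<in> l2" "l2_norm \<delta> \<le> sqrt ((l2_norm \<psi>)\<^sup>2 - S n)"
        using l2I_finite[OF fin] Sn by simp_all
      have Rd: "R \<psi> j - (\<Sum>k\<in>centered n. green f z j k * \<psi> k) = R \<delta> j" for j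
      proof -
        have "R \<psi> j = (\<Sum>\<^sub>\<infinity>k. green f z j k * \<delta> k + green f z j k * (\<psi> k - \<delta> k))"
          by (simp add: R_def algebra_simps)
        also have "\<dots> = R \<delta> j + (\<Sum>\<^sub>\<infinity>k. green f z j k * (\<psi> k - \<delta> k))"
          unfolding R_def by (rule infsum_add) (intro l2_summable green_l2 l2_diff p dl)+
        also have "(\<Sum>\<^sub>\<infinity>k. green f z j k * (\<psi> k - \<delta> k)) = (\<Sum>\<^sub>\<infinity>k\<in>centered n. green f z j k * \<psi> k)"
          by (rule infsum_cong_neutral) (auto simp: \<delta>_def)
        finally show ?thesis by (simp add: algebra_simps)
      qed
      have "B n - A n = (\<Sum>j\<in>centered n. cnj (\<psi> j) * R \<delta> j)"
        unfolding A_def B_def Rd[symmetric] sum_subtractf[symmetric]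
        by (intro sum.cong refl) (simp add: right_diff_distrib sum_distrib_left mult_ac)
      also have "cmod \<dots> \<le> (\<Sum>j\<in>centered n. \<bar>cmod (\<psi> j)\<bar> * \<bar>cmod (R \<delta> j)\<bar>)"
        by (rule sum_norm_le) (simp add: norm_mult)
      also have "\<dots> \<le> L2_set (\<lambda>j. cmod (\<psi> j)) (centered n) * L2_set (\<lambda>j. cmod (R \<delta> j)) (centered n)"
        by (rule L2_set_mult_ineq)
      also have "\<dots> \<le> l2_norm \<psi> * (sqrt ((l2_norm \<psi>)\<^sup>2 - S n) / d)"
      proof (intro mult_mono L2_set_le_l2_norm p)
        have "L2_set (\<lambda>j. cmod (R \<delta> j)) (centered n) \<le> l2_norm (R \<delta>)"
          by (intro L2_set_le_l2_norm R_l2 dl) simp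
        also have "\<dots> \<le> 1 / d * l2_norm \<delta>" by (rule R_l2[OF dl(1)])
        also have "\<dots> \<le> 1 / d * sqrt ((l2_norm \<psi>)\<^sup>2 - S n)" using dz(1) dl(2) by (intro mult_left_mono) auto
        finally show "L2_set (\<lambda>j. cmod (R \<delta> j)) (centered n) \<le> sqrt ((l2_norm \<psi>)\<^sup>2 - S n) / d" by simp
      qed auto
      finally show ?thesis .
    qed
    have "(\<lambda>n. B n - A n) \<longlonglongrightarrow> 0"
    proof (rule Lim_null_comparison[OF always_eventually])
      show "\<forall>n. norm (B n - A n) \<le> l2_norm \<psi> * (sqrt ((l2_norm \<psi>)\<^sup>2 - S n) / d)" using AB by simp
      have "(\<lambda>n. l2_norm \<psi> * (sqrt ((l2_norm \<psi>)\<^sup>2 - S n) / d)) \<longlonglongrightarrow> l2_norm \<psi> * (sqrt ((l2_norm \<psi>)\<^sup>2 - (l2_norm \<psi>)\<^sup>2) / d)"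
        by (intro tendsto_intros Sl) (use d in simp)
      then show "(\<lambda>n. l2_norm \<psi> * (sqrt ((l2_norm \<psi>)\<^sup>2 - S n) / d)) \<longlonglongrightarrow> 0" by simp
    qed
    from tendsto_diff[OF Blim this] have "A \<longlonglongrightarrow> l2_inner \<psi> (R \<psi>)" by simp
    from filterlim_compose[OF this r] have "(\<lambda>i. A (r i)) \<longlonglongrightarrow> l2_inner \<psi> (R \<psi>)" .
    with lim1 have "l2_inner \<psi> (R \<psi>) = I" by (rule LIMSEQ_unique[rotated])
    moreover have "(\<integral>x. 1 / (complex_of_real x - z) \<partial>\<mu>) = I"
      unfolding \<mu>_def I_def
      by (subst integral_density) (use g(2) in \<open>auto simp: scaleR_conv_of_real\<close>)
    ultimately show ?thesis by (simp add: resolvent_eq[OF p])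
  qed
  moreover have "finite_measure \<mu>"
  proof (rule finite_measureI)
    have "emeasure \<mu> (space \<mu>) = (\<integral>\<^sup>+t. ennreal (g t) \<partial>lborel)"
      unfolding \<mu>_def by (subst emeasure_density) (auto simp: gm)
    also have "\<dots> = ennreal (\<integral>t. g t \<partial>lborel)" by (rule nn_integral_eq_integral[OF g])
    finally show "emeasure \<mu> (space \<mu>) \<noteq> \<infinity>" by simp
  qed
  moreover have "absolutely_continuous lborel \<mu>"
    unfolding \<mu>_def by (rule absolutely_continuousI_density) measurable
  ultimately show "\<exists>\<mu>. is_spectral_measure (jacobi a b) \<psi> \<mu> \<and> absolutely_continuous lborel \<mu>"
    by (intro exI[of _ \<mu>]) (auto simp: is_spectral_measure_def \<mu>_def)
qed

section \<open>Transfer matrices and the discriminant\<close>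

text \<open>Solution of the eigenvalue equation with values \<alpha> at site 0 and \<beta> at site
  1. It is polymorphic in the field since the same recursion is needed at real energies, for the
  bands, and at complex ones, for counting roots.\<close>

fun sol :: "(int \<Rightarrow> real) \<Rightarrow> (int \<Rightarrow> real) \<Rightarrow> 'a::real_field \<Rightarrow> 'a \<Rightarrow> 'a \<Rightarrow> nat \<Rightarrow> 'a" where
  "sol a b z \<alpha> \<beta> 0 = \<alpha>"
| "sol a b z \<alpha> \<beta> (Suc 0) = \<beta>"
| "sol a b z \<alpha> \<beta> (Suc (Suc n)) = ((z - of_real (b (int (Suc n)))) * sol a b z \<alpha> \<beta> (Suc n)
     - of_real (a (int n)) * sol a b z \<alpha> \<beta> n) / of_real (a (int (Suc n)))"

declare sol.simps(3) [simp del]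

lemma nat_two_step_induct [case_names 0 1 Suc]:
  "P 0 \<Longrightarrow> P (Suc 0) \<Longrightarrow> (\<And>n. P n \<Longrightarrow> P (Suc n) \<Longrightarrow> P (Suc (Suc n))) \<Longrightarrow> P n"
  by (induction n rule: induct_nat_012) auto

lemma sol_linear: "sol a b z \<alpha> \<beta> n = \<alpha> * sol a b z 1 0 n + \<beta> * sol a b z 0 1 n"
proof (induction n rule: nat_two_step_induct)
  case (Suc n)
  show ?case
    unfolding sol.simps Suc by (simp add: add_divide_distrib diff_divide_distrib algebra_simps)
qed auto

lemma sol_scale: "sol a b z (c * \<alpha>) (c * \<beta>) n = c * sol a b z \<alpha> \<beta> n"
  by (subst (1 2) sol_linear) (simp add: algebra_simps)

lemma sol_of_real:
  "sol a b (of_real x) (of_real \<alpha>) (of_real \<beta>) n = (of_real (sol a b x \<alpha> \<beta> n) :: 'a::real_field)"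
  by (induction n rule: nat_two_step_induct) (auto simp: sol.simps(3))

lemmas sol_of_real_01 = sol_of_real[of a b x 0 1, simplified] sol_of_real[of a b x 1 0, simplified] for a b x

text \<open>Trace of the monodromy matrix: the entries are the solutions with data (1, 0) and (0, 1)
  at the sites p and p + 1. Below these solutions are called C and S.\<close>

definition discr :: "(int \<Rightarrow> real) \<Rightarrow> (int \<Rightarrow> real) \<Rightarrow> nat \<Rightarrow> 'a::real_field \<Rightarrow> 'a" where
  "discr a b p z = sol a b z 1 0 p + sol a b z 0 1 (Suc p)"

lemma discr_of_real: "discr a b p (of_real x) = (of_real (discr a b p x) :: 'a::real_field)"
  by (simp add: discr_def sol_of_real_01)

lemma sol_poly: "\<exists>P. \<forall>z::'a::real_field. sol a b z \<alpha> \<beta> n = poly P z"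
proof (induction n rule: nat_two_step_induct)
  case 0
  show ?case by (rule exI[of _ "[:\<alpha>:]"]) simp
next
  case 1
  show ?case by (rule exI[of _ "[:\<beta>:]"]) simp
next
  case (Suc n)
  then obtain P Q where "\<forall>z. sol a b z \<alpha> \<beta> n = poly P z" "\<forall>z. sol a b z \<alpha> \<beta> (Suc n) = poly Q z" by blast
  then show ?case
    by (intro exI[of _ "smult (1 / of_real (a (int (Suc n)))) ([:- of_real (b (int (Suc n))), 1:] * Q
       - smult (of_real (a (int n))) P)"])
      (simp add: sol.simps(3) algebra_simps add_divide_distrib diff_divide_distrib)
qed

lemma sol_cont: "continuous_on A (\<lambda>x::real. sol a b x \<alpha> \<beta> n)"
proof -
  obtain P where P: "\<And>x::real. sol a b x \<alpha> \<beta> n = poly P x" using sol_poly by blast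
  show ?thesis unfolding P by (intro continuous_intros)
qed

lemma sol_DERIV: "\<exists>D. \<forall>x::real. ((\<lambda>x. sol a b x \<alpha> \<beta> n) has_real_derivative D x) (at x)
    \<and> continuous_on UNIV D"
proof -
  obtain P where P: "\<And>x::real. sol a b x \<alpha> \<beta> n = poly P x" using sol_poly by blast
  show ?thesis unfolding P
    by (rule exI[of _ "poly (pderiv P)"]) (auto intro: poly_DERIV continuous_intros)
qed

text \<open>Each step multiplies the leading term by z over a positive coefficient, and the earlier
  solution has too low a degree to cancel it; hence the induction over two consecutive
  indices.\<close>

lemma degree_sol_0_1:
  assumes a: "\<And>n. a n > 0"
  shows "\<exists>P. (\<forall>z::'a::real_field. sol a b z 0 1 (Suc n) = poly P z) \<and> degree P = n"
proof -
  have "\<exists>P Q. (\<forall>z::'a. sol a b z 0 1 n = poly P z) \<and> (\<forall>z::'a. sol a b z 0 1 (Suc n) = poly Q z)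
     \<and> degree Q = n \<and> (n = 0 \<or> degree P < n) \<and> Q \<noteq> 0 \<and> (n = 0 \<longrightarrow> P = 0)"
    (is "\<exists>P Q. ?A n P Q") for n
  proof (induction n)
    case 0
    show ?case by (rule exI[of _ 0], rule exI[of _ 1]) simp
  next
    case (Suc n)
    then obtain P Q where PQ: "?A n P Q" by (elim exE)
    have P: "sol a b z 0 1 n = poly P z" and Q: "sol a b z 0 1 (Suc n) = poly Q z" for z :: 'a
      using PQ by simp_all
    have d: "degree Q = n" "n = 0 \<or> degree P < n" "Q \<noteq> 0" "n = 0 \<longrightarrow> P = 0"
      using PQ by simp_all
    define L where "L = [:- of_real (b (int (Suc n))), 1:] * Q"
    define H where "H = L - smult (of_real (a (int n))) P"
    have dL: "degree L = Suc n" unfolding L_def using d by (subst degree_mult_eq) auto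
    have dP: "degree (smult (of_real (a (int n))) P) < Suc n"
      using d by (auto simp: le_less_trans[OF degree_smult_le])
    have dH: "degree H = Suc n" unfolding H_def
      unfolding diff_conv_add_uminus using dL dP by (subst degree_add_eq_left) simp_all
    have an: "(of_real (a (int (Suc n))) :: 'a) \<noteq> 0" using a[of "int (Suc n)"] by simp
    have "sol a b z 0 1 (Suc (Suc n)) = poly (smult (1 / of_real (a (int (Suc n)))) H) z" for z :: 'a
      unfolding sol.simps H_def L_def using P Q by (simp add: algebra_simps add_divide_distrib diff_divide_distrib)
    moreover have "degree (smult (1 / of_real (a (int (Suc n)))) H) = Suc n" using dH an by simp
    moreover have "smult (1 / of_real (a (int (Suc n)))) H \<noteq> 0" using dH an by auto
    ultimately show ?case using Q d(1)
      by (intro exI[of _ Q] exI[of _ "smult (1 / of_real (a (int (Suc n)))) H"]) auto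
  qed
  then show ?thesis by metis
qed

lemma degree_sol_1_0:
  "\<exists>P. (\<forall>z::'a::real_field. sol a b z 1 0 (Suc n) = poly P z) \<and> degree P \<le> n"
proof -
  have "\<exists>P Q. (\<forall>z::'a. sol a b z 1 0 n = poly P z) \<and> (\<forall>z::'a. sol a b z 1 0 (Suc n) = poly Q z)
     \<and> degree Q \<le> n \<and> degree P \<le> n" (is "\<exists>P Q. ?A n P Q") for n
  proof (induction n)
    case 0
    show ?case by (rule exI[of _ 1], rule exI[of _ 0]) simp
  next
    case (Suc n)
    then obtain P Q where PQ: "?A n P Q" by (elim exE)
    have P: "sol a b z 1 0 n = poly P z" and Q: "sol a b z 1 0 (Suc n) = poly Q z" for z :: 'a
      using PQ by simp_all
    have d: "degree Q \<le> n" "degree P \<le> n" using PQ by simp_all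
    define H where "H = smult (1 / of_real (a (int (Suc n)))) ([:- of_real (b (int (Suc n))), 1:] * Q - smult (of_real (a (int n))) P)"
    have "degree ([:- of_real (b (int (Suc n))), 1:] * Q) \<le> Suc n"
      using degree_mult_le[of "[:- of_real (b (int (Suc n))), 1:]" Q] d by (simp split: if_splits)
    then have "degree H \<le> Suc n"
      unfolding H_def using d
      by (intro order_trans[OF degree_smult_le] degree_diff_le) (auto intro: order_trans[OF degree_smult_le])
    moreover have "sol a b z 1 0 (Suc (Suc n)) = poly H z" for z :: 'a
      unfolding sol.simps H_def using P Q by (simp add: algebra_simps add_divide_distrib diff_divide_distrib)
    ultimately show ?case using Q d by (intro exI[of _ Q] exI[of _ H]) auto
  qed
  then show ?thesis by blast
qed

text \<open>S(p+1) has degree exactly p while C(p) has smaller degree, so the trace keeps the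
  leading term.\<close>

lemma degree_discr:
  assumes "\<And>n. a n > 0" "p > 0"
  obtains P where "\<And>z::'a::real_field. discr a b p z = poly P z" "degree P = p"
proof -
  obtain m where m: "p = Suc m" using assms(2) by (cases p) auto
  obtain P where P: "\<And>z::'a. sol a b z 0 1 (Suc p) = poly P z" "degree P = p"
    using degree_sol_0_1[of a b p, OF assms(1)] by blast
  obtain Q where Q: "\<And>z::'a. sol a b z 1 0 (Suc m) = poly Q z" "degree Q \<le> m"
    using degree_sol_1_0[of a b m] by blast
  show thesis
  proof (rule that)
    show "discr a b p z = poly (Q + P) z" for z :: 'a using P Q by (simp add: discr_def m)
    show "degree (Q + P) = p" using P Q by (subst degree_add_eq_right) (auto simp: m)
  qed
qed

lemma jacobi_sol:
  fixes w :: "int \<Rightarrow> complex"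
  assumes a: "\<And>n. a n > 0" and w: "jacobi a b w = (\<lambda>n. z * w n)"
  shows "w (int n) = sol a b z (w 0) (w 1) n"
proof (induction n rule: nat_two_step_induct)
  case (Suc n)
  have "jacobi a b w (int (Suc n)) = z * w (int (Suc n))" using w by simp
  then have "complex_of_real (a (int (Suc n))) * w (int (Suc (Suc n)))
     = (z - b (int (Suc n))) * w (int (Suc n)) - a (int n) * w (int n)"
    unfolding jacobi_def by (simp add: algebra_simps)
  moreover have "complex_of_real (a (int (Suc n))) \<noteq> 0" using a[of "int (Suc n)"] by simp
  ultimately show ?case unfolding sol.simps Suc[symmetric] by (simp add: field_simps)
qed auto

section \<open>Periodic coefficients, monodromy and Bloch solutions\<close>

locale periodic_jacobi =
  fixes a b :: "int \<Rightarrow> real" and p :: nat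
  assumes p_pos: "p > 0" and a_pos: "\<And>n. a n > 0"
    and a_per: "\<And>n. a (n + int p) = a n" and b_per: "\<And>n. b (n + int p) = b n"
begin

lemma a_nz: "(of_real (a n) :: 'a::real_field) \<noteq> 0"
  using a_pos[of n] by simp

lemma per_mult:
  "a (n + int k * int p) = a n" "b (n + int k * int p) = b n"
proof -
  have "a (n + int k * int p) = a n \<and> b (n + int k * int p) = b n"
  proof (induction k)
    case (Suc k)
    have "n + int (Suc k) * int p = (n + int k * int p) + int p" by (simp add: algebra_simps)
    then show ?case using Suc a_per b_per by metis
  qed simp
  then show "a (n + int k * int p) = a n" "b (n + int k * int p) = b n" by auto
qed

text \<open>Conservation of the Wronskian of C and S. After a period the weight \<open>a\<close>
  returns to its initial value, so the monodromy matrix has determinant 1.\<close>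

lemma wronskian:
  "of_real (a (int n)) * (sol a b z 1 0 n * sol a b z 0 1 (Suc n) - sol a b z 0 1 n * sol a b z 1 0 (Suc n))
    = (of_real (a 0) :: 'a::real_field)"
proof (induction n)
  case (Suc n)
  let ?C = "sol a b z 1 0" and ?S = "sol a b z 0 1"
  have "of_real (a (int (Suc n))) * (?C (Suc n) * ?S (Suc (Suc n)) - ?S (Suc n) * ?C (Suc (Suc n)))
    = ?C (Suc n) * (of_real (a (int (Suc n))) * ?S (Suc (Suc n))) - ?S (Suc n) * (of_real (a (int (Suc n))) * ?C (Suc (Suc n)))"
    by (simp only: algebra_simps)
  also have "of_real (a (int (Suc n))) * ?S (Suc (Suc n))
     = (z - of_real (b (int (Suc n)))) * ?S (Suc n) - of_real (a (int n)) * ?S n"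
    unfolding sol.simps using a_nz by simp
  also have "of_real (a (int (Suc n))) * ?C (Suc (Suc n))
     = (z - of_real (b (int (Suc n)))) * ?C (Suc n) - of_real (a (int n)) * ?C n"
    unfolding sol.simps using a_nz by simp
  also have "?C (Suc n) * ((z - of_real (b (int (Suc n)))) * ?S (Suc n) - of_real (a (int n)) * ?S n)
      - ?S (Suc n) * ((z - of_real (b (int (Suc n)))) * ?C (Suc n) - of_real (a (int n)) * ?C n)
     = of_real (a (int n)) * (?C n * ?S (Suc n) - ?S n * ?C (Suc n))"
    by (simp add: algebra_simps)
  finally show ?case unfolding Suc .
qed simp

lemma det_monodromy:
  "sol a b z 1 0 p * sol a b z 0 1 (Suc p) - sol a b z 0 1 p * sol a b z 1 0 (Suc p) = (1 :: 'a::real_field)"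
proof -
  have "a (int p) = a 0" using a_per[of 0] by simp
  then show ?thesis using wronskian[of p z] a_nz[of 0] by simp
qed

lemma sol_shift: "sol a b z \<alpha> \<beta> (n + p) = sol a b z (sol a b z \<alpha> \<beta> p) (sol a b z \<alpha> \<beta> (Suc p)) n"
proof (induction n rule: nat_two_step_induct)
  case (Suc n)
  have e: "a (int (Suc (n + p))) = a (int (Suc n))" "b (int (Suc (n + p))) = b (int (Suc n))"
     "a (int (n + p)) = a (int n)"
    using a_per[of "int (Suc n)"] b_per[of "int (Suc n)"] a_per[of "int n"] by (simp_all add: algebra_simps)
  have "sol a b z \<alpha> \<beta> (Suc (Suc n) + p) = sol a b z \<alpha> \<beta> (Suc (Suc (n + p)))" by simp
  also have "\<dots> = sol a b z (sol a b z \<alpha> \<beta> p) (sol a b z \<alpha> \<beta> (Suc p)) (Suc (Suc n))"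
    unfolding sol.simps(3) e using Suc by simp
  finally show ?case .
qed auto

lemma bloch_period:
  assumes "sol a b z \<alpha> \<beta> p = \<zeta> * \<alpha>" "sol a b z \<alpha> \<beta> (Suc p) = \<zeta> * \<beta>"
  shows "sol a b z \<alpha> \<beta> (n + k * p) = \<zeta> ^ k * sol a b z \<alpha> \<beta> n"
proof (induction k)
  case (Suc k)
  have "sol a b z \<alpha> \<beta> (n + Suc k * p) = sol a b z \<alpha> \<beta> ((n + k * p) + p)" by (simp add: algebra_simps)
  also have "\<dots> = \<zeta> * sol a b z \<alpha> \<beta> (n + k * p)" unfolding sol_shift assms sol_scale ..
  finally show ?case using Suc by simp
qed simp

end

text \<open>\<open>sol\<close> lives on the naturals. To reach negative sites, the argument is moved
  right by \<bar>n\<bar> periods and the multiplier is divided out once for each; n + \<bar>n\<bar>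
  p is nonnegative as soon as p \<ge> 1.\<close>

definition bloch_ext :: "(int \<Rightarrow> real) \<Rightarrow> (int \<Rightarrow> real) \<Rightarrow> nat \<Rightarrow> complex \<Rightarrow> complex \<Rightarrow> complex \<Rightarrow> complex \<Rightarrow> int \<Rightarrow> complex" where
  "bloch_ext a b p z \<zeta> \<alpha> \<beta> n = sol a b z \<alpha> \<beta> (nat (n + \<bar>n\<bar> * int p)) / \<zeta> ^ nat \<bar>n\<bar>"

locale bloch_wave = periodic_jacobi +
  fixes z \<zeta> \<alpha> \<beta> :: complex
  assumes zeta: "\<zeta> \<noteq> 0" and mono: "sol a b z \<alpha> \<beta> p = \<zeta> * \<alpha>" "sol a b z \<alpha> \<beta> (Suc p) = \<zeta> * \<beta>"
begin

text \<open>Shifting by further periods multiplies numerator and denominator by the same power of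
  \<zeta>, so the number of periods is immaterial. Neighbouring sites can thus be compared with one
  common shift.\<close>

lemma bloch_ext_eq:
  assumes "n + int k * int p \<ge> 0"
  shows "bloch_ext a b p z \<zeta> \<alpha> \<beta> n = sol a b z \<alpha> \<beta> (nat (n + int k * int p)) / \<zeta> ^ k"
proof -
  define N where "N = nat \<bar>n\<bar>"
  have N: "n + int N * int p \<ge> 0"
  proof -
    have "\<bar>n\<bar> * 1 \<le> \<bar>n\<bar> * int p" using p_pos by (intro mult_left_mono) auto
    then show ?thesis by (simp add: N_def)
  qed
  have "sol a b z \<alpha> \<beta> (nat (n + int k * int p) + N * p) = \<zeta> ^ N * sol a b z \<alpha> \<beta> (nat (n + int k * int p))"
    by (rule bloch_period[OF mono])
  moreover have "sol a b z \<alpha> \<beta> (nat (n + int N * int p) + k * p) = \<zeta> ^ k * sol a b z \<alpha> \<beta> (nat (n + int N * int p))"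
    by (rule bloch_period[OF mono])
  moreover have "nat (n + int k * int p) + N * p = nat (n + int N * int p) + k * p"
  proof -
    have "int (nat (n + int k * int p) + N * p) = int (nat (n + int N * int p) + k * p)"
      using assms N by simp
    then show ?thesis by (simp only: of_nat_eq_iff)
  qed
  ultimately have "\<zeta> ^ N * sol a b z \<alpha> \<beta> (nat (n + int k * int p)) = \<zeta> ^ k * sol a b z \<alpha> \<beta> (nat (n + int N * int p))"
    by simp
  then show ?thesis unfolding bloch_ext_def using zeta by (simp add: N_def field_simps)
qed

lemma bloch_ext_nat: "bloch_ext a b p z \<zeta> \<alpha> \<beta> (int n) = sol a b z \<alpha> \<beta> n"
  using bloch_ext_eq[of "int n" 0] by simp

text \<open>One period more than in \<open>bloch_ext\<close>, so that the left neighbour n - 1 also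
  lands on a nonnegative index.\<close>

lemma abs_period: "n + int (nat \<bar>n\<bar> + 1) * int p \<ge> 1"
proof -
  have "\<bar>n\<bar> * 1 \<le> \<bar>n\<bar> * int p" using p_pos by (intro mult_left_mono) auto
  then show ?thesis using p_pos by (simp add: algebra_simps)
qed

lemma bloch_ext_shift: "bloch_ext a b p z \<zeta> \<alpha> \<beta> (n + int p) = \<zeta> * bloch_ext a b p z \<zeta> \<alpha> \<beta> n"
proof -
  define k where "k = nat \<bar>n\<bar> + 1"
  have k: "n + int k * int p \<ge> 1" unfolding k_def by (rule abs_period)
  have "nat (n + int p + int k * int p) = nat (n + int k * int p) + 1 * p" using k by simp
  then have "sol a b z \<alpha> \<beta> (nat (n + int p + int k * int p)) = \<zeta> * sol a b z \<alpha> \<beta> (nat (n + int k * int p))"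
    using bloch_period[OF mono, of "nat (n + int k * int p)" 1] by simp
  then show ?thesis using bloch_ext_eq[of n k] bloch_ext_eq[of "n + int p" k] k by simp
qed

lemma bloch_ext_jacobi: "jacobi a b (bloch_ext a b p z \<zeta> \<alpha> \<beta>) = (\<lambda>n. z * bloch_ext a b p z \<zeta> \<alpha> \<beta> n)"
proof
  fix n
  let ?w = "bloch_ext a b p z \<zeta> \<alpha> \<beta>" and ?s = "sol a b z \<alpha> \<beta>"
  define k where "k = nat \<bar>n\<bar> + 1"
  define m where "m = nat (n - 1 + int k * int p)"
  have k: "n + int k * int p \<ge> 1" unfolding k_def by (rule abs_period)
  then have m: "int m = n - 1 + int k * int p" by (simp add: m_def)
  have nm: "nat (n + int k * int p) = Suc m" "nat (n + 1 + int k * int p) = Suc (Suc m)"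
    using m by simp_all
  have w: "?w (n - 1) = ?s m / \<zeta> ^ k" "?w n = ?s (Suc m) / \<zeta> ^ k" "?w (n + 1) = ?s (Suc (Suc m)) / \<zeta> ^ k"
    using bloch_ext_eq[of "n - 1" k] bloch_ext_eq[of n k] bloch_ext_eq[of "n + 1" k] k m
    by (simp_all add: nm m_def[symmetric])
  have ab: "a (int m) = a (n - 1)" "a (int (Suc m)) = a n" "b (int (Suc m)) = b n"
  proof -
    have m': "int (Suc m) = n + int k * int p" using m by simp
    show "a (int m) = a (n - 1)" "a (int (Suc m)) = a n" "b (int (Suc m)) = b n"
      unfolding m m' by (rule per_mult)+
  qed
  have "complex_of_real (a n) * ?s (Suc (Suc m)) = (z - b n) * ?s (Suc m) - a (n - 1) * ?s m"
    unfolding sol.simps ab using a_nz[of n] by simp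
  then show "jacobi a b ?w n = z * ?w n"
    unfolding jacobi_def w by (simp add: algebra_simps add_divide_distrib[symmetric] diff_divide_distrib[symmetric])
qed

end

text \<open>Wronskian of w with the conjugate of v: the boundary term produced by moving J across
  the inner product of w and v.\<close>

definition wron :: "(int \<Rightarrow> real) \<Rightarrow> (int \<Rightarrow> complex) \<Rightarrow> (int \<Rightarrow> complex) \<Rightarrow> int \<Rightarrow> complex" where
  "wron a w v n = complex_of_real (a n) * (w (n + 1) * cnj (v n) - w n * cnj (v (n + 1)))"

lemma wron_step:
  assumes "jacobi a b w = (\<lambda>n. z * w n)" "jacobi a b v = (\<lambda>n. y * v n)"
  shows "(z - cnj y) * (w n * cnj (v n)) = wron a w v n - wron a w v (n - 1)"
proof -
  have "z * w n = jacobi a b w n" "cnj y * cnj (v n) = cnj (jacobi a b v n)" using assms by simp_all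
  then have "(z - cnj y) * (w n * cnj (v n)) = jacobi a b w n * cnj (v n) - w n * cnj (jacobi a b v n)"
    by (simp add: algebra_simps)
  then show ?thesis by (simp add: wron_def jacobi_def algebra_simps)
qed

lemma green_identity:
  assumes "jacobi a b w = (\<lambda>n. z * w n)" "jacobi a b v = (\<lambda>n. y * v n)"
  shows "(z - cnj y) * (\<Sum>n=1..m. w (int n) * cnj (v (int n))) = wron a w v (int m) - wron a w v 0"
proof (induction m)
  case (Suc m)
  have "(z - cnj y) * (\<Sum>n=1..Suc m. w (int n) * cnj (v (int n)))
     = (z - cnj y) * (\<Sum>n=1..m. w (int n) * cnj (v (int n))) + (z - cnj y) * (w (int (Suc m)) * cnj (v (int (Suc m))))"
    by (simp add: algebra_simps)
  then show ?case unfolding Suc wron_step[OF assms] by simp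
qed simp

context periodic_jacobi
begin

lemma wron_bloch:
  assumes "\<And>n. w (n + int p) = \<zeta> * w n" "\<And>n. v (n + int p) = \<xi> * v n"
  shows "wron a w v (int p) = \<zeta> * cnj \<xi> * wron a w v 0"
  using assms(1)[of 0] assms(1)[of 1] assms(2)[of 0] assms(2)[of 1] a_per[of 0]
  by (simp add: wron_def algebra_simps)

text \<open>The vector (S(p), \<zeta> - C(p)) is read off from the first row of the eigenvector
  equation; the second row is the characteristic equation combined with determinant 1.\<close>

lemma bloch_vector:
  assumes "\<zeta>\<^sup>2 - discr a b p z * \<zeta> + 1 = (0 :: complex)" "\<alpha> = sol a b z 0 1 p" "\<beta> = \<zeta> - sol a b z 1 0 p"
  shows "sol a b z \<alpha> \<beta> p = \<zeta> * \<alpha>" "sol a b z \<alpha> \<beta> (Suc p) = \<zeta> * \<beta>"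
proof -
  show "sol a b z \<alpha> \<beta> p = \<zeta> * \<alpha>"
    by (subst sol_linear) (simp add: assms algebra_simps)
  have d: "sol a b z 0 1 p * sol a b z 1 0 (Suc p) = sol a b z 1 0 p * sol a b z 0 1 (Suc p) - 1"
    using det_monodromy[of z] by (simp add: algebra_simps)
  have q: "\<zeta> * \<zeta> = (sol a b z 1 0 p + sol a b z 0 1 (Suc p)) * \<zeta> - 1"
  proof -
    have "\<zeta> * \<zeta> - discr a b p z * \<zeta> + 1 = 0" using assms(1) by (simp add: power2_eq_square)
    then have "\<zeta> * \<zeta> = discr a b p z * \<zeta> - 1" by algebra
    then show ?thesis unfolding discr_def .
  qed
  show "sol a b z \<alpha> \<beta> (Suc p) = \<zeta> * \<beta>"
    by (subst sol_linear) (simp add: assms(2,3) d q algebra_simps)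
qed

text \<open>Self-adjointness on one period: Green's identity of a Bloch wave with itself has
  cancelling boundary terms when the multiplier is unimodular, and leaves the imaginary part of z
  times a positive sum.\<close>

lemma real_root:
  assumes z: "discr a b p z = complex_of_real s" and s: "\<bar>s\<bar> < 2"
  shows "Im z = 0"
proof -
  define \<theta> where "\<theta> = arccos (s / 2)"
  have c: "2 * cos \<theta> = s" using s by (simp add: \<theta>_def cos_arccos_abs)
  have quad: "(cis \<theta>)\<^sup>2 - discr a b p z * cis \<theta> + 1 = 0"
    unfolding z c[symmetric] using sin_cos_squared_add[of \<theta>]
    by (simp add: complex_eq_iff power2_eq_square algebra_simps)
  obtain \<zeta> \<alpha> \<beta> where m: "sol a b z \<alpha> \<beta> p = \<zeta> * \<alpha>" "sol a b z \<alpha> \<beta> (Suc p) = \<zeta> * \<beta>"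
    and nz: "cmod \<zeta> = 1" "\<alpha> \<noteq> 0 \<or> \<beta> \<noteq> 0"
  proof (cases "sol a b z 0 1 p = 0")
    case False
    then show thesis using that[OF bloch_vector[OF quad refl refl]] by simp
  next
    \<comment> \<open>When S(p) = 0 the standard eigenvector may vanish. Then (0, 1) is an
      eigenvector with multiplier S(p+1), a root of the same quadratic and therefore
      unimodular.\<close>
    case True
    define c where "c = sol a b z 1 0 p"
    define e where "e = sol a b z 0 1 (Suc p)"
    have 1: "c * e = 1" using det_monodromy[of z] True by (simp add: c_def e_def)
    have 2: "c + e = complex_of_real s" using z by (simp add: discr_def c_def e_def)
    have e0: "e \<noteq> 0" using 1 by auto
    have "(e - cis \<theta>) * (e - cis (- \<theta>)) = e * e - (cis \<theta> + cis (- \<theta>)) * e + cis \<theta> * cis (- \<theta>)"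
      by (simp add: algebra_simps)
    also have "cis \<theta> + cis (- \<theta>) = complex_of_real s" using c by (simp add: complex_eq_iff)
    also have "cis \<theta> * cis (- \<theta>) = 1" by (simp add: cis_mult)
    also have "e * e - complex_of_real s * e + 1 = 0" unfolding 2[symmetric] using 1 by (simp add: algebra_simps)
    finally have "e = cis \<theta> \<or> e = cis (- \<theta>)" by simp
    then have "cmod e = 1" by (auto simp: norm_cis)
    moreover have "sol a b z 0 1 p = e * 0" "sol a b z 0 1 (Suc p) = e * 1"
      using True by (simp_all add: e_def)
    ultimately show thesis by (intro that[of 0 1 e]) auto
  qed
  interpret bloch_wave a b p z \<zeta> \<alpha> \<beta>
    by unfold_locales (use m nz in auto)
  define w where "w = bloch_ext a b p z \<zeta> \<alpha> \<beta>"
  have J: "jacobi a b w = (\<lambda>n. z * w n)" unfolding w_def by (rule bloch_ext_jacobi)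
  have "(z - cnj z) * (\<Sum>n=1..p. w (int n) * cnj (w (int n))) = wron a w w (int p) - wron a w w 0"
    by (rule green_identity[OF J J])
  also have "\<dots> = 0"
  proof -
    have "\<zeta> * cnj \<zeta> = 1" using nz(1) complex_norm_square[of \<zeta>] by simp
    then show ?thesis using wron_bloch[of w \<zeta> w \<zeta>] bloch_ext_shift by (simp add: w_def)
  qed
  finally have e: "(z - cnj z) * (\<Sum>n=1..p. w (int n) * cnj (w (int n))) = 0" .
  have "(\<Sum>n=1..p. (cmod (w (int n)))\<^sup>2) \<noteq> 0"
  proof
    assume "(\<Sum>n=1..p. (cmod (w (int n)))\<^sup>2) = 0"
    then have all: "w (int n) = 0" if "n \<in> {1..p}" for n
      using that by (subst (asm) sum_nonneg_eq_0_iff) auto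
    have w0: "w 0 = \<alpha>" "w 1 = \<beta>" using bloch_ext_nat[of 0] bloch_ext_nat[of 1] by (simp_all add: w_def)
    have "w (int p) = 0" using all[of p] p_pos by simp
    then have "\<alpha> = 0" using bloch_ext_shift[of 0] zeta w0 by (simp add: w_def)
    moreover have "\<beta> = 0" using all[of 1] p_pos w0 by simp
    ultimately show False using nz by simp
  qed
  moreover have "(\<Sum>n=1..p. w (int n) * cnj (w (int n))) = complex_of_real (\<Sum>n=1..p. (cmod (w (int n)))\<^sup>2)"
    by (simp add: complex_norm_square del: of_real_power)
  ultimately have "(z - cnj z) * complex_of_real (\<Sum>n=1..p. (cmod (w (int n)))\<^sup>2) = 0" using e by (simp only:)
  then have "z - cnj z = 0" using \<open>(\<Sum>n=1..p. (cmod (w (int n)))\<^sup>2) \<noteq> 0\<close>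
    unfolding mult_eq_0_iff of_real_eq_0_iff by blast
  then show ?thesis by (simp add: complex_eq_iff)
qed

end

section \<open>Bands and Bloch waves\<close>

text \<open>All points with discriminant \<plusminus>2 are left out, closed gaps included: on this
  open set the two multipliers are distinct and the quasimomentum is differentiable.\<close>

definition bands :: "(int \<Rightarrow> real) \<Rightarrow> (int \<Rightarrow> real) \<Rightarrow> nat \<Rightarrow> real set" where
  "bands a b p = {x. \<bar>discr a b p x\<bar> < 2}"

text \<open>Of the two conjugate multipliers with sum \<open>discr a b p x\<close>, this fixes the
  one in the upper half plane, with argument strictly between 0 and pi on the bands.\<close>

definition quasimom :: "(int \<Rightarrow> real) \<Rightarrow> (int \<Rightarrow> real) \<Rightarrow> nat \<Rightarrow> real \<Rightarrow> real" where
  "quasimom a b p x = arccos (discr a b p x / 2)"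

definition bloch :: "(int \<Rightarrow> real) \<Rightarrow> (int \<Rightarrow> real) \<Rightarrow> nat \<Rightarrow> real \<Rightarrow> int \<Rightarrow> complex" where
  "bloch a b p x = bloch_ext a b p (of_real x) (cis (quasimom a b p x))
     (of_real (sol a b x 0 1 p)) (cis (quasimom a b p x) - of_real (sol a b x 1 0 p))"

definition bloch_mass :: "(int \<Rightarrow> real) \<Rightarrow> (int \<Rightarrow> real) \<Rightarrow> nat \<Rightarrow> real \<Rightarrow> real" where
  "bloch_mass a b p x = (\<Sum>n=1..p. (cmod (bloch a b p x (int n)))\<^sup>2)"

lemma discr_DERIV:
  obtains D where "\<And>x. (discr a b p has_real_derivative D x) (at x)" "continuous_on UNIV D"
proof -
  obtain D1 where D1: "\<And>x. ((\<lambda>x. sol a b x 1 0 p) has_real_derivative D1 x) (at x)" "continuous_on UNIV D1"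
    using sol_DERIV[of a b 1 0 p] by blast
  obtain D2 where D2: "\<And>x. ((\<lambda>x. sol a b x 0 1 (Suc p)) has_real_derivative D2 x) (at x)" "continuous_on UNIV D2"
    using sol_DERIV[of a b 0 1 "Suc p"] by blast
  have e: "discr a b p = (\<lambda>x::real. sol a b x 1 0 p + sol a b x 0 1 (Suc p))"
    by (intro ext) (simp add: discr_def)
  show thesis
  proof (rule that)
    show "(discr a b p has_real_derivative (D1 x + D2 x)) (at x)" for x
      unfolding e by (intro DERIV_add D1 D2)
    show "continuous_on UNIV (\<lambda>x. D1 x + D2 x)" by (intro continuous_on_add D1 D2)
  qed
qed

definition discr' :: "(int \<Rightarrow> real) \<Rightarrow> (int \<Rightarrow> real) \<Rightarrow> nat \<Rightarrow> real \<Rightarrow> real" where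
  "discr' a b p x = (THE d. (discr a b p has_real_derivative d) (at x))"

lemma has_derivative_discr: "(discr a b p has_real_derivative discr' a b p x) (at x)"
  and continuous_discr': "continuous_on A (discr' a b p)"
proof -
  obtain D where D: "\<And>x. (discr a b p has_real_derivative D x) (at x)" "continuous_on UNIV D"
    using discr_DERIV[of a b p] by blast
  have "discr' a b p x = D x" for x
    unfolding discr'_def by (rule the_equality, rule D(1), erule DERIV_unique, rule D(1))
  then have e: "discr' a b p = D" by blast
  show "(discr a b p has_real_derivative discr' a b p x) (at x)" unfolding e by (rule D)
  show "continuous_on A (discr' a b p)" unfolding e by (rule continuous_on_subset[OF D(2)]) simp
qed

lemma continuous_discr: "continuous_on A (discr a b p :: real \<Rightarrow> real)"
  by (intro continuous_at_imp_continuous_on ballI DERIV_isCont[OF has_derivative_discr])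

lemma open_bands: "open (bands a b p)"
  unfolding bands_def by (intro open_Collect_less continuous_intros continuous_discr)

lemma quasimom:
  assumes "x \<in> bands a b p"
  shows "cos (quasimom a b p x) = discr a b p x / 2" "sin (quasimom a b p x) > 0"
    "0 < quasimom a b p x" "quasimom a b p x < pi"
proof -
  have b: "-1 < discr a b p x / 2" "discr a b p x / 2 < 1" using assms by (auto simp: bands_def)
  show "cos (quasimom a b p x) = discr a b p x / 2" unfolding quasimom_def using b by simp
  show q: "0 < quasimom a b p x" "quasimom a b p x < pi"
    unfolding quasimom_def using arccos_lt_bounded[OF b] by auto
  then show "sin (quasimom a b p x) > 0" by (rule sin_gt_zero)
qed

lemma quasimom_DERIV:
  assumes "x \<in> bands a b p"
  shows "(quasimom a b p has_real_derivative - discr' a b p x / (2 * sin (quasimom a b p x))) (at x)"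
proof -
  have b: "-1 < discr a b p x / 2" "discr a b p x / 2 < 1" using assms by (auto simp: bands_def)
  have s: "sqrt (1 - (discr a b p x / 2)\<^sup>2) = sin (quasimom a b p x)"
    unfolding quasimom_def using b by (subst sin_arccos) auto
  have "(quasimom a b p has_real_derivative
      inverse (- sqrt (1 - (discr a b p x / 2)\<^sup>2)) * (discr' a b p x / 2)) (at x)"
    unfolding quasimom_def[abs_def] by (rule DERIV_chain2[where f = arccos and g = "\<lambda>x. discr a b p x / 2", OF DERIV_arccos[OF b]])
      (rule DERIV_cdivide[OF has_derivative_discr])
  moreover have "inverse (- sqrt (1 - (discr a b p x / 2)\<^sup>2)) * (discr' a b p x / 2)
      = - discr' a b p x / (2 * sin (quasimom a b p x))"
    unfolding s using quasimom(2)[OF assms] by (simp add: field_simps)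
  ultimately show ?thesis by (simp only:)
qed

lemma cis_quadratic:
  assumes "x \<in> bands a b p"
  shows "(cis (quasimom a b p x))\<^sup>2 - discr a b p (complex_of_real x) * cis (quasimom a b p x) + 1 = 0"
proof -
  have d: "discr a b p x = 2 * cos (quasimom a b p x)" using quasimom(1)[OF assms] by simp
  show ?thesis
    unfolding discr_of_real d using sin_cos_squared_add[of "quasimom a b p x"]
    by (simp add: complex_eq_iff power2_eq_square algebra_simps)
qed

context periodic_jacobi
begin

lemma bloch_wave_bands:
  assumes "x \<in> bands a b p"
  shows "bloch_wave a b p (of_real x) (cis (quasimom a b p x))
     (of_real (sol a b x 0 1 p)) (cis (quasimom a b p x) - of_real (sol a b x 1 0 p))"
proof
  show "cis (quasimom a b p x) \<noteq> 0" by simp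
  show "sol a b (complex_of_real x) (complex_of_real (sol a b x 0 1 p))
     (cis (quasimom a b p x) - complex_of_real (sol a b x 1 0 p)) p =
    cis (quasimom a b p x) * complex_of_real (sol a b x 0 1 p)"
   "sol a b (complex_of_real x) (complex_of_real (sol a b x 0 1 p))
     (cis (quasimom a b p x) - complex_of_real (sol a b x 1 0 p)) (Suc p) =
    cis (quasimom a b p x) * (cis (quasimom a b p x) - complex_of_real (sol a b x 1 0 p))"
    using bloch_vector[OF cis_quadratic[OF assms] refl refl] by (simp_all add: sol_of_real_01)
qed

lemma bloch_jacobi: "x \<in> bands a b p \<Longrightarrow> jacobi a b (bloch a b p x) = (\<lambda>n. of_real x * bloch a b p x n)"
  unfolding bloch_def by (rule bloch_wave.bloch_ext_jacobi[OF bloch_wave_bands])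

lemma bloch_shift: "x \<in> bands a b p \<Longrightarrow> bloch a b p x (n + int p) = cis (quasimom a b p x) * bloch a b p x n"
  unfolding bloch_def by (rule bloch_wave.bloch_ext_shift[OF bloch_wave_bands])

lemma bloch_nat:
  assumes "x \<in> bands a b p"
  shows "bloch a b p x (int n) = of_real (sol a b x 0 1 p) * of_real (sol a b x 1 0 n)
     + (cis (quasimom a b p x) - of_real (sol a b x 1 0 p)) * of_real (sol a b x 0 1 n)"
  unfolding bloch_def bloch_wave.bloch_ext_nat[OF bloch_wave_bands[OF assms]]
  by (subst sol_linear) (simp add: sol_of_real_01)

lemma bloch_01:
  assumes "x \<in> bands a b p"
  shows "bloch a b p x 0 = of_real (sol a b x 0 1 p)"
    "bloch a b p x 1 = cis (quasimom a b p x) - of_real (sol a b x 1 0 p)"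
  using bloch_nat[OF assms, of 0] bloch_nat[OF assms, of 1] by simp_all

text \<open>If S(p) vanished, the real numbers C(p) and S(p+1) would have product 1 and hence a sum
  of modulus at least 2.\<close>

lemma sol_nonzero:
  assumes "x \<in> bands a b p"
  shows "sol a b x 0 1 p \<noteq> 0"
proof
  assume 0: "sol a b x 0 1 p = 0"
  define c where "c = sol a b x 1 0 p"
  define e where "e = sol a b x 0 1 (Suc p)"
  have 1: "c * e = 1" using det_monodromy[of x] 0 by (simp add: c_def e_def)
  have "\<bar>c + e\<bar> < 2" using assms by (simp add: bands_def discr_def c_def e_def)
  then have "(c + e)\<^sup>2 < 2\<^sup>2" by (metis abs_numeral power2_abs power_strict_mono abs_ge_zero zero_less_numeral)
  moreover have "(c + e)\<^sup>2 = (c - e)\<^sup>2 + 4 * (c * e)" by (simp add: power2_eq_square algebra_simps)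
  ultimately show False using 1 zero_le_power2[of "c - e"] by simp
qed

lemma Im_bloch:
  "x \<in> bands a b p \<Longrightarrow> Im (bloch a b p x 1 * cnj (bloch a b p x 0)) = sol a b x 0 1 p * sin (quasimom a b p x)"
  by (simp add: bloch_01)

text \<open>Green's identity differentiated in the energy. For y \<noteq> x it expresses (x - y)
  times the overlap of the waves at x and y by their Wronskian at 0 and the difference of their
  multipliers; division by x - y and y -> x bring in the derivative of the quasimomentum, and the
  factors sin cancel. The identity shows that the discriminant has no critical points in the bands,
  and it ties the normalisation of Bloch waves to the density of states.\<close>

lemma bloch_mass_identity:
  assumes x: "x \<in> bands a b p"
  shows "bloch_mass a b p x = a 0 * discr' a b p x * sol a b x 0 1 p"
proof -
  let ?q = "quasimom a b p" and ?w = "bloch a b p"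
  define L where "L y = (\<Sum>n=1..p. ?w x (int n) * cnj (?w y (int n)))" for y
  define W where "W y = wron a (?w x) (?w y) 0" for y
  \<comment> \<open>Q is (cis (?q x - ?q y) - 1) / (x - y), split into real and imaginary parts so
    that only real derivatives are needed.\<close>
  define Q where "Q y = - of_real ((cos (?q x - ?q y) - 1) / (y - x)) - \<i> * of_real (sin (?q x - ?q y) / (y - x))" for y
  have ev: "\<forall>\<^sub>F y in at x. y \<in> bands a b p" using open_bands x
    by (metis eventually_at_topological)
  have cq: "isCont ?q x" using quasimom_DERIV[OF x] by (rule DERIV_isCont)
  have cs: "isCont (\<lambda>y::real. sol a b y \<alpha> \<beta> n) x" for \<alpha> \<beta> n
    using sol_cont[of UNIV] by (simp add: continuous_on_eq_continuous_at)
  have cw: "((\<lambda>y. ?w y (int n)) \<longlongrightarrow> ?w x (int n)) (at x)" for n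
  proof -
    have "((\<lambda>y. of_real (sol a b y 0 1 p) * of_real (sol a b y 1 0 n)
      + (cis (?q y) - of_real (sol a b y 1 0 p)) * of_real (sol a b y 0 1 n)) \<longlongrightarrow> ?w x (int n)) (at x)"
      unfolding bloch_nat[OF x] cis_conv_exp
      by (intro tendsto_intros cs[unfolded isCont_def] cq[unfolded isCont_def])
    then show ?thesis
      by (rule Lim_transform_eventually) (use ev in eventually_elim, simp add: bloch_nat)
  qed
  have L: "(L \<longlongrightarrow> L x) (at x)" unfolding L_def by (intro tendsto_intros cw)
  have W: "(W \<longlongrightarrow> W x) (at x)"
    unfolding W_def wron_def using cw[of 0] cw[of 1] by (auto intro!: tendsto_intros)
  have dq: "(?q has_real_derivative - discr' a b p x / (2 * sin (?q x))) (at x)" by (rule quasimom_DERIV[OF x])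
  have "((\<lambda>y. cos (?q x - ?q y)) has_real_derivative 0) (at x)"
    by (rule derivative_eq_intros dq refl | simp)+
  then have c: "((\<lambda>y. (cos (?q x - ?q y) - 1) / (y - x)) \<longlongrightarrow> 0) (at x)"
    by (simp add: has_field_derivative_iff)
  have "((\<lambda>y. sin (?q x - ?q y)) has_real_derivative discr' a b p x / (2 * sin (?q x))) (at x)"
    by (rule derivative_eq_intros dq refl | simp)+
  then have s: "((\<lambda>y. sin (?q x - ?q y) / (y - x)) \<longlongrightarrow> discr' a b p x / (2 * sin (?q x))) (at x)"
    by (simp add: has_field_derivative_iff)
  have Q: "(Q \<longlongrightarrow> - of_real 0 - \<i> * of_real (discr' a b p x / (2 * sin (?q x)))) (at x)"
    unfolding Q_def by (intro tendsto_intros c s)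
  have "\<forall>\<^sub>F y in at x. Q y * W y = L y"
    using ev eventually_neq_at_within[of x x UNIV]
  proof eventually_elim
    case (elim y)
    have "(complex_of_real x - cnj (complex_of_real y)) * L y = wron a (?w x) (?w y) (int p) - W y"
      unfolding L_def W_def
      by (rule green_identity) (rule bloch_jacobi x elim(1))+
    also have "wron a (?w x) (?w y) (int p) = cis (?q x) * cnj (cis (?q y)) * W y"
      unfolding W_def by (rule wron_bloch) (rule bloch_shift x elim(1))+
    also have "cis (?q x) * cnj (cis (?q y)) = cis (?q x - ?q y)" by (simp add: cis_cnj cis_mult)
    finally have "of_real (x - y) * L y = (cis (?q x - ?q y) - 1) * W y" by (simp add: algebra_simps)
    moreover have "of_real (x - y) * Q y = cis (?q x - ?q y) - 1"
    proof -
      have h: "(x - y) * (u / (y - x)) = - u" for u using elim(2) by (simp add: field_simps)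
      have "of_real (x - y) * Q y = - of_real ((x - y) * ((cos (?q x - ?q y) - 1) / (y - x)))
         - \<i> * of_real ((x - y) * (sin (?q x - ?q y) / (y - x)))"
        unfolding Q_def of_real_mult by (simp add: algebra_simps del: of_real_diff of_real_mult of_real_divide)
      then show ?thesis unfolding h by (simp add: complex_eq_iff)
    qed
    ultimately have "of_real (x - y) * L y = of_real (x - y) * (Q y * W y)" by (simp add: mult.assoc)
    moreover have "complex_of_real (x - y) \<noteq> 0" using elim(2) by simp
    ultimately show ?case by (metis mult_left_cancel)
  qed
  then have "(L \<longlongrightarrow> (- of_real 0 - \<i> * of_real (discr' a b p x / (2 * sin (?q x)))) * W x) (at x)"
    by (rule Lim_transform_eventually[OF tendsto_mult[OF Q W]])
  from tendsto_unique[OF _ L this]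
  have "L x = (- \<i> * of_real (discr' a b p x / (2 * sin (?q x)))) * W x" by simp
  moreover have "W x = 2 * \<i> * of_real (a 0 * sol a b x 0 1 p * sin (?q x))"
    unfolding W_def wron_def using Im_bloch[OF x]
    by (simp add: bloch_01[OF x] complex_eq_iff)
  moreover have "L x = of_real (bloch_mass a b p x)"
    unfolding L_def bloch_mass_def by (simp add: complex_norm_square del: of_real_power)
  ultimately have "complex_of_real (bloch_mass a b p x) = of_real (discr' a b p x / (2 * sin (?q x)) * 2 * (a 0 * sol a b x 0 1 p * sin (?q x)))"
    by (simp add: complex_eq_iff)
  then have "bloch_mass a b p x = discr' a b p x / (2 * sin (?q x)) * 2 * (a 0 * sol a b x 0 1 p * sin (?q x))"
    by (simp only: of_real_eq_iff)
  then show ?thesis using quasimom(2)[OF x] by simp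
qed

lemma bloch_mass_pos:
  assumes x: "x \<in> bands a b p"
  shows "bloch_mass a b p x > 0"
proof -
  have "(cmod (bloch a b p x (int p)))\<^sup>2 \<le> bloch_mass a b p x"
    unfolding bloch_mass_def by (rule member_le_sum) (use p_pos in auto)
  moreover have "cmod (bloch a b p x (int p)) \<noteq> 0"
    using bloch_shift[OF x, of 0] bloch_01[OF x] sol_nonzero[OF x] by simp
  ultimately show ?thesis by (metis le_less_trans less_le_trans norm_ge_zero not_le zero_less_power2 power_zero_numeral order_less_le)
qed

lemma discr'_nonzero: "x \<in> bands a b p \<Longrightarrow> discr' a b p x \<noteq> 0"
  using bloch_mass_identity[of x] bloch_mass_pos[of x] by auto

text \<open>The modulus of a Bloch wave is p-periodic, so each of its values occurs in the cell 1..p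
  over which the mass is summed.\<close>

lemma bloch_le_mass:
  assumes x: "x \<in> bands a b p"
  shows "(cmod (bloch a b p x n))\<^sup>2 \<le> bloch_mass a b p x"
proof -
  have 1: "cmod (bloch a b p x (m + int k * int p)) = cmod (bloch a b p x m)" for m k
  proof (induction k)
    case (Suc k)
    have "m + int (Suc k) * int p = (m + int k * int p) + int p" by (simp add: algebra_simps)
    show ?case unfolding \<open>m + int (Suc k) * int p = (m + int k * int p) + int p\<close> bloch_shift[OF x] norm_mult Suc by simp
  qed simp
  define r where "r = (n - 1) mod int p + 1"
  define q where "q = (n - 1) div int p"
  have nq: "n = r + q * int p" by (simp add: r_def q_def)
  have r: "1 \<le> r" "r \<le> int p" using p_pos by (auto simp: r_def) (metis of_nat_0_less_iff pos_mod_bound zless_imp_add1_zle)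
  have "cmod (bloch a b p x n) = cmod (bloch a b p x r)"
  proof (cases "q \<ge> 0")
    case True
    then show ?thesis using 1[of r "nat q"] nq by simp
  next
    case False
    then show ?thesis using 1[of n "nat (- q)"] nq by (simp add: algebra_simps)
  qed
  moreover have "(cmod (bloch a b p x (int (nat r))))\<^sup>2 \<le> bloch_mass a b p x"
    unfolding bloch_mass_def by (rule member_le_sum) (use r in auto)
  ultimately show ?thesis using r by simp
qed

text \<open>The eigenvalue equation is read at a site where the periodic modulus of the Bloch wave
  is maximal.\<close>

lemma bands_bounded:
  assumes x: "x \<in> bands a b p" and A: "\<And>n. \<bar>a n\<bar> \<le> A" and B: "\<And>n. \<bar>b n\<bar> \<le> B"
  shows "\<bar>x\<bar> \<le> 2 * A + B"
proof -
  let ?w = "bloch a b p x"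
  have fin: "finite ((\<lambda>n. cmod (?w (int n))) ` {1..p})" by simp
  have ne: "(\<lambda>n. cmod (?w (int n))) ` {1..p} \<noteq> {}" using p_pos by simp
  obtain m where m: "m \<in> {1..p}" "cmod (?w (int m)) = Max ((\<lambda>n. cmod (?w (int n))) ` {1..p})"
    using Max_in[OF fin ne] by fastforce
  have le: "cmod (?w (int n)) \<le> cmod (?w (int m))" if "n \<in> {1..p}" for n
    unfolding m(2) by (rule Max_ge) (use that in auto)
  have le0: "cmod (?w 0) \<le> cmod (?w (int m))"
    using bloch_shift[OF x, of 0] le[of p] p_pos by (simp add: norm_mult)
  have leS: "cmod (?w (int p + 1)) \<le> cmod (?w (int m))"
    using bloch_shift[OF x, of 1] le[of 1] p_pos by (simp add: norm_mult add.commute)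
  have l1: "cmod (?w (int m - 1)) \<le> cmod (?w (int m))"
  proof (cases "m = 1")
    case False
    then have "int m - 1 = int (m - 1)" "m - 1 \<in> {1..p}" using m by auto
    then show ?thesis using le by metis
  qed (use le0 in simp)
  have l2: "cmod (?w (int m + 1)) \<le> cmod (?w (int m))"
  proof (cases "m = p")
    case False
    then have "int m + 1 = int (m + 1)" "m + 1 \<in> {1..p}" using m by auto
    then show ?thesis using le by metis
  qed (use leS in simp)
  have pos: "cmod (?w (int m)) > 0"
  proof (rule ccontr)
    assume "\<not> ?thesis"
    then have "cmod (?w (int n)) = 0" if "n \<in> {1..p}" for n using le[OF that] norm_ge_zero[of "?w (int n)"] by linarith
    then have "bloch_mass a b p x = 0" unfolding bloch_mass_def by simp
    then show False using bloch_mass_pos[OF x] by simp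
  qed
  have "of_real x * ?w (int m) = a (int m - 1) * ?w (int m - 1) + a (int m) * ?w (int m + 1) + b (int m) * ?w (int m)"
    using fun_cong[OF bloch_jacobi[OF x], of "int m"] by (simp add: jacobi_def)
  then have "\<bar>x\<bar> * cmod (?w (int m)) = cmod (a (int m - 1) * ?w (int m - 1) + a (int m) * ?w (int m + 1) + b (int m) * ?w (int m))"
    by (metis norm_mult norm_of_real)
  also have "\<dots> \<le> cmod (a (int m - 1) * ?w (int m - 1)) + cmod (a (int m) * ?w (int m + 1)) + cmod (b (int m) * ?w (int m))"
    by (intro order_trans[OF norm_triangle_ineq] add_mono norm_triangle_ineq order_refl)
  also have "\<dots> = \<bar>a (int m - 1)\<bar> * cmod (?w (int m - 1)) + \<bar>a (int m)\<bar> * cmod (?w (int m + 1)) + \<bar>b (int m)\<bar> * cmod (?w (int m))"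
    by (simp add: norm_mult)
  also have "\<dots> \<le> A * cmod (?w (int m)) + A * cmod (?w (int m)) + B * cmod (?w (int m))"
    using order_trans[OF abs_ge_zero A] order_trans[OF abs_ge_zero B] by (intro add_mono mult_mono A B l1 l2 order_refl) auto
  finally have "\<bar>x\<bar> * cmod (?w (int m)) \<le> (2 * A + B) * cmod (?w (int m))" by (simp add: algebra_simps)
  then show ?thesis using pos by (simp add: mult_le_cancel_right)
qed

end

section \<open>Energies at a fixed quasimomentum and completeness of Bloch waves\<close>

context periodic_jacobi
begin

text \<open>The discriminant minus s is a complex polynomial of degree p. Its roots are real by
  \<open>real_root\<close> and simple by \<open>discr'_nonzero\<close>, so the number of real
  solutions equals the degree.\<close>

lemma card_level_set:
  assumes s: "\<bar>s\<bar> < 2"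
  shows "finite {x::real. discr a b p x = s}" "card {x::real. discr a b p x = s} = p"
proof -
  obtain P where P: "\<And>z::complex. discr a b p z = poly P z" "degree P = p"
    using degree_discr[of a p b, OF a_pos p_pos] by blast
  define Q where "Q = P - [:of_real s:]"
  have Q0: "poly Q z = 0 \<longleftrightarrow> discr a b p z = complex_of_real s" for z
    by (simp add: Q_def P)
  have dQ: "degree Q = p"
    unfolding Q_def diff_conv_add_uminus using P(2) p_pos by (subst degree_add_eq_left) auto
  have Qn: "Q \<noteq> 0" using dQ p_pos by auto
  have real: "\<exists>x. z = complex_of_real x \<and> discr a b p x = s" if "poly Q z = 0" for z
  proof -
    have 1: "discr a b p z = complex_of_real s" using that Q0 by simp
    then have "Im z = 0" using real_root[OF _ s] by blast
    then have z: "z = complex_of_real (Re z)" by (simp add: complex_eq_iff)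
    then have "complex_of_real (discr a b p (Re z)) = complex_of_real s" using 1 discr_of_real by metis
    then show ?thesis using z by (metis of_real_eq_iff)
  qed
  have simple: "poly (pderiv Q) z \<noteq> 0" if "poly Q z = 0" for z
  proof -
    obtain x where x: "z = complex_of_real x" "discr a b p x = s" using real[OF \<open>poly Q z = 0\<close>] by blast
    have "(poly P has_field_derivative poly (pderiv P) z) (at z)" by (rule poly_DERIV)
    then have "((\<lambda>y. poly P (complex_of_real y)) has_vector_derivative poly (pderiv P) z) (at x)"
      unfolding x(1) by (rule has_vector_derivative_real_field)
    moreover have "poly P (complex_of_real y) = complex_of_real (discr a b p y)" for y
      using P(1) discr_of_real by metis
    ultimately have 1: "((\<lambda>y. complex_of_real (discr a b p y)) has_vector_derivative poly (pderiv P) z) (at x)"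
      by simp
    have 2: "((\<lambda>y. complex_of_real (discr a b p y)) has_vector_derivative complex_of_real (discr' a b p x)) (at x)"
      by (rule has_vector_derivative_of_real[OF has_derivative_discr])
    have "poly (pderiv P) z = complex_of_real (discr' a b p x)"
      by (rule vector_derivative_unique_at[OF 1 2])
    moreover have "discr' a b p x \<noteq> 0" using x(2) s by (intro discr'_nonzero) (simp add: bands_def)
    ultimately show ?thesis by (simp add: Q_def pderiv_diff)
  qed
  have rsq: "rsquarefree Q"
    unfolding rsquarefree_roots using simple by blast
  have fin: "finite {z. poly Q z = 0}" by (rule poly_roots_finite[OF Qn])
  have "degree Q = degree (smult (lead_coeff Q) (\<Prod>z | poly Q z = 0. [:- z, 1:]))"
    by (simp add: complex_poly_decompose_rsquarefree[OF rsq])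
  also have "\<dots> = degree (\<Prod>z | poly Q z = 0. [:- z, 1:])"
    using Qn by simp
  also have "\<dots> = (\<Sum>z | poly Q z = 0. degree [:- z, 1:])"
    by (rule degree_prod_eq_sum_degree) simp
  also have "\<dots> = card {z. poly Q z = 0}" by simp
  finally have card: "card {z. poly Q z = 0} = p" using dQ by simp
  have e: "{z. poly Q z = 0} = complex_of_real ` {x. discr a b p x = s}"
  proof (intro set_eqI iffI)
    fix z assume "z \<in> {z. poly Q z = 0}"
    then show "z \<in> complex_of_real ` {x. discr a b p x = s}" using real[of z] by auto
  next
    fix z assume "z \<in> complex_of_real ` {x. discr a b p x = s}"
    then show "z \<in> {z. poly Q z = 0}" by (auto simp: Q0 discr_of_real)
  qed
  have inj: "inj_on complex_of_real A" for A by (simp add: inj_on_def)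
  show "finite {x::real. discr a b p x = s}" using fin unfolding e by (rule finite_imageD[OF _ inj])
  show "card {x::real. discr a b p x = s} = p" using card unfolding e by (simp add: card_image[OF inj])
qed

text \<open>Equal quasimomenta make the boundary terms of Green's identity cancel, and the energies
  differ.\<close>

lemma bloch_orthogonal:
  assumes x: "x \<in> bands a b p" and y: "y \<in> bands a b p" and xy: "x \<noteq> y" "quasimom a b p x = quasimom a b p y"
  shows "(\<Sum>n=1..p. bloch a b p x (int n) * cnj (bloch a b p y (int n))) = 0"
proof -
  have "(complex_of_real x - cnj (complex_of_real y)) * (\<Sum>n=1..p. bloch a b p x (int n) * cnj (bloch a b p y (int n)))
     = wron a (bloch a b p x) (bloch a b p y) (int p) - wron a (bloch a b p x) (bloch a b p y) 0"
    by (rule green_identity) (rule bloch_jacobi x y)+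
  also have "wron a (bloch a b p x) (bloch a b p y) (int p)
     = cis (quasimom a b p x) * cnj (cis (quasimom a b p y)) * wron a (bloch a b p x) (bloch a b p y) 0"
    by (rule wron_bloch) (rule bloch_shift x y)+
  also have "cis (quasimom a b p x) * cnj (cis (quasimom a b p y)) = 1"
    unfolding xy(2) by (simp add: cis_cnj cis_mult)
  finally show ?thesis using xy(1) by simp
qed

lemma bloch_mult_shift:
  assumes x: "x \<in> bands a b p"
  shows "bloch a b p x (n + m * int p) = cis (quasimom a b p x * of_int m) * bloch a b p x n"
proof -
  have 1: "bloch a b p x (n + int k * int p) = cis (quasimom a b p x * of_nat k) * bloch a b p x n" for n k
  proof (induction k)
    case (Suc k)
    have e: "n + int (Suc k) * int p = (n + int k * int p) + int p" by (simp add: algebra_simps)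
    show ?case unfolding e bloch_shift[OF x] Suc
      by (simp add: mult.assoc[symmetric] cis_mult algebra_simps)
  qed simp
  show ?thesis
  proof (cases "m \<ge> 0")
    case True
    then show ?thesis using 1[of n "nat m"] by simp
  next
    case False
    then have m: "m = - int (nat (- m))" by simp
    have "bloch a b p x n = cis (- (quasimom a b p x * of_int m)) * bloch a b p x (n + m * int p)"
      using 1[of "n + m * int p" "nat (- m)"] False by (simp add: algebra_simps)
    then show ?thesis by (simp add: mult.assoc[symmetric] cis_mult)
  qed
qed

text \<open>A Hilbert--Schmidt computation: \<open>p\<close> orthonormal vectors in a \<open>p\<close>-dimensional space
  satisfy the completeness relation, because the defect has norm zero.\<close>

lemma bloch_complete_cell:
  assumes s: "0 < s" "s < pi" and j: "1 \<le> j" "j \<le> p" and k: "1 \<le> k" "k \<le> p"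
  defines "X \<equiv> {x::real. discr a b p x = 2 * cos s}"
  shows "(\<Sum>x\<in>X. bloch a b p x (int j) * cnj (bloch a b p x (int k)) / bloch_mass a b p x) = (if j = k then 1 else 0)"
proof -
  note One_nat_def [simp del]
  have c: "\<bar>2 * cos s\<bar> < 2"
    using s cos_monotone_0_pi[of 0 s] cos_monotone_0_pi[of s pi] by auto
  have fX: "finite X" and cX: "card X = p" using card_level_set[OF c] by (simp_all add: X_def)
  have Xb: "x \<in> bands a b p" if "x \<in> X" for x using that c by (simp add: X_def bands_def)
  have Xq: "quasimom a b p x = s" if "x \<in> X" for x
    using that s by (simp add: X_def quasimom_def arccos_cos)
  define N where "N x = bloch_mass a b p x" for x
  have Np: "N x > 0" if "x \<in> X" for x unfolding N_def by (rule bloch_mass_pos[OF Xb[OF that]])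
  define v where "v x n = bloch a b p x (int n) / of_real (sqrt (N x))" for x n
  have vN: "v x j * cnj (v x k) = bloch a b p x (int j) * cnj (bloch a b p x (int k)) / N x" if "x \<in> X" for x j k
    using Np[OF that] by (simp add: v_def of_real_mult[symmetric] del: of_real_mult)
  have orth: "(\<Sum>n=1..p. v x n * cnj (v y n)) = (if x = y then 1 else 0)" if "x \<in> X" "y \<in> X" for x y
  proof (cases "x = y")
    case True
    have "(\<Sum>n=1..p. v x n * cnj (v x n)) = (\<Sum>n=1..p. bloch a b p x (int n) * cnj (bloch a b p x (int n))) / N x"
      unfolding vN[OF that(1)] sum_divide_distrib ..
    also have "(\<Sum>n=1..p. bloch a b p x (int n) * cnj (bloch a b p x (int n))) = N x"
      unfolding N_def bloch_mass_def by (simp add: complex_norm_square del: of_real_power)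
    finally show ?thesis using True Np[OF that(1)] by simp
  next
    case False
    have "(\<Sum>n=1..p. v x n * cnj (v y n)) = (\<Sum>n=1..p. bloch a b p x (int n) * cnj (bloch a b p y (int n))) / (of_real (sqrt (N x)) * of_real (sqrt (N y)))"
      unfolding v_def sum_divide_distrib by simp
    then show ?thesis using bloch_orthogonal[OF Xb[OF that(1)] Xb[OF that(2)] False] Xq that False by simp
  qed
  define P where "P j k = (\<Sum>x\<in>X. v x j * cnj (v x k))" for j k
  have trP: "(\<Sum>j=1..p. P j j) = of_nat p"
  proof -
    have "(\<Sum>j=1..p. P j j) = (\<Sum>x\<in>X. \<Sum>j=1..p. v x j * cnj (v x j))" unfolding P_def by (rule sum.swap)
    also have "\<dots> = (\<Sum>x\<in>X. 1)" by (intro sum.cong refl) (simp add: orth)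
    finally show ?thesis by (simp add: cX)
  qed
  have PP: "(\<Sum>j=1..p. \<Sum>k=1..p. P j k * cnj (P j k)) = of_nat p"
  proof -
    have "(\<Sum>j=1..p. \<Sum>k=1..p. P j k * cnj (P j k))
       = (\<Sum>j=1..p. \<Sum>k=1..p. \<Sum>x\<in>X. \<Sum>y\<in>X. (v x j * cnj (v y j)) * (v y k * cnj (v x k)))"
      unfolding P_def cnj_sum sum_product by (intro sum.cong refl) (simp add: mult_ac)
    also have "\<dots> = (\<Sum>j=1..p. \<Sum>x\<in>X. \<Sum>k=1..p. \<Sum>y\<in>X. (v x j * cnj (v y j)) * (v y k * cnj (v x k)))"
      by (rule sum.cong[OF refl], rule sum.swap)
    also have "\<dots> = (\<Sum>x\<in>X. \<Sum>j=1..p. \<Sum>k=1..p. \<Sum>y\<in>X. (v x j * cnj (v y j)) * (v y k * cnj (v x k)))"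
      by (rule sum.swap)
    also have "\<dots> = (\<Sum>x\<in>X. \<Sum>j=1..p. \<Sum>y\<in>X. \<Sum>k=1..p. (v x j * cnj (v y j)) * (v y k * cnj (v x k)))"
      by (rule sum.cong[OF refl], rule sum.cong[OF refl], rule sum.swap)
    also have "\<dots> = (\<Sum>x\<in>X. \<Sum>y\<in>X. \<Sum>j=1..p. \<Sum>k=1..p. (v x j * cnj (v y j)) * (v y k * cnj (v x k)))"
      by (rule sum.cong[OF refl], rule sum.swap)
    also have "\<dots> = (\<Sum>x\<in>X. \<Sum>y\<in>X. (\<Sum>j=1..p. v x j * cnj (v y j)) * (\<Sum>k=1..p. v y k * cnj (v x k)))"
      unfolding sum_product ..
    also have "\<dots> = (\<Sum>x\<in>X. \<Sum>y\<in>X. if x = y then 1 else 0)"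
      by (intro sum.cong refl) (simp add: orth)
    also have "\<dots> = of_nat p" using fX cX by simp
    finally show ?thesis .
  qed
  define D where "D j k = (if j = k then 1 else 0) - P j k" for j k
  have Pdiag: "cnj (P j j) = P j j" for j unfolding P_def cnj_sum by (intro sum.cong refl) (simp add: mult.commute)
  have "(\<Sum>j=1..p. \<Sum>k=1..p. D j k * cnj (D j k))
     = (\<Sum>j=1..p. \<Sum>k=1..p. (if j = k then 1 - 2 * P j j else 0) + P j k * cnj (P j k))"
    by (intro sum.cong refl) (auto simp: D_def Pdiag algebra_simps)
  also have "\<dots> = (\<Sum>j=1..p. 1 - 2 * P j j) + of_nat p"
    by (simp add: sum.distrib PP)
  also have "\<dots> = 0" using trP by (simp add: sum_subtractf sum_distrib_left[symmetric])
  finally have "complex_of_real (\<Sum>j=1..p. \<Sum>k=1..p. (cmod (D j k))\<^sup>2) = 0"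
    by (simp add: complex_norm_square del: of_real_power)
  then have z: "(\<Sum>j=1..p. \<Sum>k=1..p. (cmod (D j k))\<^sup>2) = 0" by (simp only: of_real_eq_0_iff)
  then have "(\<Sum>k=1..p. (cmod (D j k))\<^sup>2) = 0"
    using j by (subst (asm) sum_nonneg_eq_0_iff) (auto intro: sum_nonneg)
  then have "(cmod (D j k))\<^sup>2 = 0"
    using k by (subst (asm) sum_nonneg_eq_0_iff) auto
  then have "P j k = (if j = k then 1 else 0)" by (simp add: D_def)
  then show ?thesis unfolding P_def using vN by (simp add: N_def)
qed

text \<open>Sites are numbered 1 to p, not 0 to p - 1, to match the cell over which
  \<open>bloch_mass\<close> and the orthogonality sums run.\<close>

definition cell :: "int \<Rightarrow> int" where "cell n = (n - 1) div int p"
definition site :: "int \<Rightarrow> int" where "site n = (n - 1) mod int p + 1"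

lemma cell_site: "n = site n + cell n * int p" "1 \<le> site n" "site n \<le> int p"
proof -
  show "n = site n + cell n * int p" by (simp add: cell_def site_def)
  have "0 \<le> (n - 1) mod int p" "(n - 1) mod int p < int p" using p_pos by simp_all
  then show "1 \<le> site n" "site n \<le> int p" by (simp_all add: site_def)
qed

text \<open>Completeness in one cell, transported to arbitrary cells by the common phase that all
  energies of the level set share.\<close>

lemma bloch_complete:
  assumes s: "0 < s" "s < pi"
  defines "X \<equiv> {x::real. discr a b p x = 2 * cos s}"
  shows "(\<Sum>x\<in>X. Re (bloch a b p x j * cnj (bloch a b p x k)) / bloch_mass a b p x)
    = (if site j = site k then cos (s * of_int (cell j - cell k)) else 0)"
proof -
  have c: "\<bar>2 * cos s\<bar> < 2"
    using s cos_monotone_0_pi[of 0 s] cos_monotone_0_pi[of s pi] by auto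
  have Xb: "x \<in> bands a b p" if "x \<in> X" for x using that c by (simp add: X_def bands_def)
  have Xq: "quasimom a b p x = s" if "x \<in> X" for x
    using that s by (simp add: X_def quasimom_def arccos_cos)
  have w: "bloch a b p x n = cis (s * of_int (cell n)) * bloch a b p x (int (nat (site n)))" if "x \<in> X" for x n
    using bloch_mult_shift[OF Xb[OF that], of "site n" "cell n"] cell_site[of n] Xq[OF that] by simp
  define e where "e = cis (s * of_int (cell j)) * cnj (cis (s * of_int (cell k)))"
  have "(\<Sum>x\<in>X. bloch a b p x j * cnj (bloch a b p x k) / bloch_mass a b p x)
     = e * (\<Sum>x\<in>X. bloch a b p x (int (nat (site j))) * cnj (bloch a b p x (int (nat (site k)))) / bloch_mass a b p x)"
    unfolding sum_distrib_left
  proof (rule sum.cong[OF refl])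
    fix x assume "x \<in> X"
    show "bloch a b p x j * cnj (bloch a b p x k) / bloch_mass a b p x
      = e * (bloch a b p x (int (nat (site j))) * cnj (bloch a b p x (int (nat (site k)))) / bloch_mass a b p x)"
      by (subst w[OF \<open>x \<in> X\<close>, of j], subst w[OF \<open>x \<in> X\<close>, of k]) (simp add: e_def mult_ac)
  qed
  also have "(\<Sum>x\<in>X. bloch a b p x (int (nat (site j))) * cnj (bloch a b p x (int (nat (site k)))) / bloch_mass a b p x)
     = (if nat (site j) = nat (site k) then 1 else 0)"
    unfolding X_def by (rule bloch_complete_cell[OF s]) (use cell_site[of j] cell_site[of k] in auto)
  finally have 1: "(\<Sum>x\<in>X. bloch a b p x j * cnj (bloch a b p x k) / bloch_mass a b p x)
     = (if site j = site k then e else 0)"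
    using cell_site[of j] cell_site[of k] by (simp add: nat_eq_iff)
  have "Re e = cos (s * of_int (cell j - cell k))"
    unfolding e_def cis_cnj cis_mult by (simp add: algebra_simps)
  moreover have "(\<Sum>x\<in>X. Re (bloch a b p x j * cnj (bloch a b p x k)) / bloch_mass a b p x)
     = Re (\<Sum>x\<in>X. bloch a b p x j * cnj (bloch a b p x k) / bloch_mass a b p x)"
    unfolding Re_sum by (intro sum.cong refl) (simp only: Re_divide_of_real)
  ultimately show ?thesis using 1 by simp
qed

text \<open>Orthogonality in the quasimomentum: integrating the phases of
  \<open>bloch_complete\<close> over (0, pi) leaves only pairs of sites in the same cell.\<close>

lemma integral_cos_int: "((\<lambda>s. cos (s * of_int m)) has_integral (if m = 0 then pi else 0)) {0..pi}"
proof (cases "m = 0")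
  case True
  then show ?thesis using has_integral_const_real[of "1::real" 0 pi] by simp
next
  case False
  have "((\<lambda>s. cos (s * of_int m)) has_integral (sin (pi * of_int m) / of_int m - sin (0 * of_int m) / of_int m)) {0..pi}"
  proof (rule fundamental_theorem_of_calculus)
    fix s :: real assume "s \<in> {0..pi}"
    have "((\<lambda>s. sin (s * of_int m) / of_int m) has_real_derivative cos (s * of_int m)) (at s within {0..pi})"
      using False by (auto intro!: derivative_eq_intros)
    then show "((\<lambda>s. sin (s * of_int m) / of_int m) has_vector_derivative cos (s * of_int m)) (at s within {0..pi})"
      by (simp add: has_real_derivative_iff_has_vector_derivative)
  qed simp
  moreover have "sin (pi * of_int m) = 0" using sin_npi_int[of m] by (simp add: mult.commute)
  ultimately show ?thesis using False by simp
qed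

end

lemma periodic_bseq:
  assumes "p > 0" "\<And>n. f (n + int p) = f n"
  shows "bseq f"
proof -
  have 1: "f (n + int k * int p) = f n" for n k
  proof (induction k)
    case (Suc k)
    have "n + int (Suc k) * int p = (n + int k * int p) + int p" by (simp add: algebra_simps)
    then show ?case using assms(2) Suc by metis
  qed simp
  have red: "f n = f (n mod int p)" for n
  proof (cases "n div int p \<ge> 0")
    case True
    then show ?thesis using 1[of "n mod int p" "nat (n div int p)"] by simp
  next
    case False
    have "n + int (nat (- (n div int p))) * int p = n mod int p"
      using False by (simp add: minus_div_mult_eq_mod[symmetric])
    then show ?thesis using 1[of n "nat (- (n div int p))"] by simp
  qed
  have "\<bar>f n\<bar> \<le> Max ((\<lambda>m. \<bar>f m\<bar>) ` {0..<int p})" for n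
    by (subst red, rule Max_ge) (use assms(1) in auto)
  then show ?thesis unfolding bseq_def by blast
qed

lemma (in periodic_jacobi) bseq_ab: "bseq a" "bseq b"
  using periodic_bseq[OF p_pos] a_per b_per by blast+

lemma card_le_inj_bij:
  assumes "finite A" "finite B" "card A = card B" "f ` A \<subseteq> B" "inj_on f A"
  shows "f ` A = B"
  using assms by (metis card_image card_subset_eq)

text \<open>Since the derivative of the discriminant does not vanish where its modulus is below 2,
  it maps every component of that set bijectively onto \<open>(-2, 2)\<close>.\<close>

lemma (in periodic_jacobi) band_interval:
  assumes x: "x \<in> bands a b p"
  obtains \<alpha> \<beta> where "\<alpha> < x" "x < \<beta>" "{\<alpha><..<\<beta>} \<subseteq> bands a b p"
    "\<bar>discr a b p \<alpha>\<bar> = 2" "discr a b p \<beta> = - discr a b p \<alpha>" "inj_on (discr a b p) {\<alpha>..\<beta>}"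
    "discr a b p ` {\<alpha><..<\<beta>} = {-2<..<2}"
proof -
  let ?D = "discr a b p :: real \<Rightarrow> real"
  have fin: "finite {x::real. ?D x = s}" if "\<bar>s\<bar> < 2" for s using card_level_set[OF that] by simp
  obtain A where A: "\<And>n. \<bar>a n\<bar> \<le> A" using bseq_ab(1) unfolding bseq_def by blast
  obtain B where B: "\<And>n. \<bar>b n\<bar> \<le> B" using bseq_ab(2) unfolding bseq_def by blast
  define R where "R = 2 * A + B + 1"
  have R: "\<bar>y\<bar> < R" if "y \<in> bands a b p" for y using bands_bounded[OF that A B] by (simp add: R_def)
  have out: "\<bar>?D y\<bar> \<ge> 2" if "\<bar>y\<bar> \<ge> R" for y using R[of y] that by (force simp: bands_def)
  have Dx: "\<bar>?D x\<bar> < 2" using x by (simp add: bands_def)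
  have cont: "continuous_on S (\<lambda>y. \<bar>?D y\<bar>)" for S by (intro continuous_intros continuous_discr)
  \<comment> \<open>The edges of the band are the nearest points on either side of x where the
    discriminant has modulus at least 2. The window [-R, R] reaches beyond all bands, so neither set
    is empty.\<close>
  define L where "L = {y. -R \<le> y \<and> y \<le> x \<and> 2 \<le> \<bar>?D y\<bar>}"
  define H where "H = {y. x \<le> y \<and> y \<le> R \<and> 2 \<le> \<bar>?D y\<bar>}"
  have Lc: "closed L" "closed H" unfolding L_def H_def
    by (intro closed_Collect_conj closed_Collect_le continuous_intros cont)+
  have Ln: "L \<noteq> {}" using out[of "-R"] R[OF x] by (force simp: L_def)
  have Hn: "H \<noteq> {}" using out[of R] R[OF x] by (force simp: H_def)
  have Lb: "bdd_above L" "bdd_below H" by (auto simp: L_def H_def)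
  define \<alpha> where "\<alpha> = Sup L"
  define \<beta> where "\<beta> = Inf H"
  have aL: "\<alpha> \<in> L" unfolding \<alpha>_def by (rule closed_contains_Sup[OF Ln Lb(1) Lc(1)])
  have bH: "\<beta> \<in> H" unfolding \<beta>_def by (rule closed_contains_Inf[OF Hn Lb(2) Lc(2)])
  have ax: "\<alpha> < x" using aL Dx by (cases "\<alpha> = x") (auto simp: L_def)
  have xb: "x < \<beta>" using bH Dx by (cases "\<beta> = x") (auto simp: H_def)
  have sub: "{\<alpha><..<\<beta>} \<subseteq> bands a b p"
  proof
    fix y assume y: "y \<in> {\<alpha><..<\<beta>}"
    show "y \<in> bands a b p"
    proof (rule ccontr)
      assume "y \<notin> bands a b p"
      then have "2 \<le> \<bar>?D y\<bar>" by (simp add: bands_def)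
      then have "y \<in> L \<or> y \<in> H" using y aL bH by (auto simp: L_def H_def)
      then show False
        using y cSup_upper[OF _ Lb(1), of y] cInf_lower[OF _ Lb(2), of y] by (auto simp: \<alpha>_def \<beta>_def)
    qed
  qed
  have da: "2 \<le> \<bar>?D \<alpha>\<bar>" "2 \<le> \<bar>?D \<beta>\<bar>" using aL bH by (auto simp: L_def H_def)
  have ub: "\<bar>?D y\<bar> \<le> 2" if "y \<in> closure {\<alpha><..<\<beta>}" for y
  proof -
    have "closure {\<alpha><..<\<beta>} \<subseteq> {y. \<bar>?D y\<bar> \<le> 2}"
      by (rule closure_minimal) (use sub in \<open>auto simp: bands_def intro!: closed_Collect_le continuous_intros continuous_discr\<close>)
    then show ?thesis using that by blast
  qed
  have cl: "closure {\<alpha><..<\<beta>} = {\<alpha>..\<beta>}" using ax xb by simp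
  have D2: "\<bar>?D \<alpha>\<bar> = 2" "\<bar>?D \<beta>\<bar> = 2" using ub[of \<alpha>] ub[of \<beta>] da ax xb by (auto simp: cl intro: antisym)
  have rolle: "?D y \<noteq> ?D z" if "y < z" "\<alpha> \<le> y" "z \<le> \<beta>" for y z
  proof
    assume "?D y = ?D z"
    then obtain w where w: "y < w" "w < z" "(?D has_real_derivative 0) (at w)"
      using Rolle[OF \<open>y < z\<close>, of ?D] continuous_discr has_derivative_discr
      by (meson real_differentiable_def)
    then have "discr' a b p w = 0" using DERIV_unique[OF has_derivative_discr] by blast
    moreover have "w \<in> bands a b p" using sub w that by auto
    ultimately show False using discr'_nonzero by blast
  qed
  have inj: "inj_on ?D {\<alpha>..\<beta>}"
    by (rule linorder_inj_onI) (use rolle in auto)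
  have neg: "?D \<beta> = - ?D \<alpha>" using rolle[of \<alpha> \<beta>] ax xb D2 by (auto simp: abs_if split: if_splits)
  have "?D ` {\<alpha><..<\<beta>} = {-2<..<2}"
  proof (intro set_eqI iffI)
    fix s assume "s \<in> ?D ` {\<alpha><..<\<beta>}"
    then show "s \<in> {-2<..<2}" using sub by (auto simp: bands_def)
  next
    fix s :: real assume s: "s \<in> {-2<..<2}"
    have cD: "continuous_on {\<alpha>..\<beta>} ?D" by (rule continuous_discr)
    have "\<exists>y\<ge>\<alpha>. y \<le> \<beta> \<and> ?D y = s"
    proof (cases "?D \<alpha> = 2")
      case True
      then show ?thesis using IVT2'[of ?D \<beta> s \<alpha>] neg s ax xb cD by auto
    next
      case False
      then have "?D \<alpha> = -2" using D2 by auto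
      then show ?thesis using IVT'[of ?D \<alpha> s \<beta>] neg s ax xb cD by auto
    qed
    then obtain y where y: "\<alpha> \<le> y" "y \<le> \<beta>" "?D y = s" by blast
    then have "y \<noteq> \<alpha>" "y \<noteq> \<beta>" using D2 s by auto
    then show "s \<in> ?D ` {\<alpha><..<\<beta>}" using y by force
  qed
  then show thesis using that[of \<alpha> \<beta>] ax xb sub D2(1) neg inj by blast
qed

section \<open>The spectral kernel of a periodic operator\<close>

text \<open>Up to constants the denominator is the Wronskian of the Bloch wave with its conjugate.
  The quotient is therefore invariant under scaling and conjugation of the wave, which makes kernels
  computed with different periods comparable.\<close>

definition per_kernel ::
  "(int \<Rightarrow> real) \<Rightarrow> (int \<Rightarrow> real) \<Rightarrow> nat \<Rightarrow> int \<Rightarrow> int \<Rightarrow> real \<Rightarrow> real" where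
  "per_kernel a b p j k x = (if x \<in> bands a b p
     then Re (bloch a b p x j * cnj (bloch a b p x k))
       / (2 * pi * a 0 * \<bar>Im (bloch a b p x 1 * cnj (bloch a b p x 0))\<bar>) else 0)"

definition quasimom' :: "(int \<Rightarrow> real) \<Rightarrow> (int \<Rightarrow> real) \<Rightarrow> nat \<Rightarrow> real \<Rightarrow> real" where
  "quasimom' a b p x = - discr' a b p x / (2 * sin (quasimom a b p x))"

lemma continuous_quasimom: "continuous_on (bands a b p) (quasimom a b p)"
  by (intro continuous_at_imp_continuous_on ballI DERIV_isCont[OF quasimom_DERIV])

lemma continuous_bloch: "continuous_on (bands a b p) (\<lambda>x. bloch a b p x n)"
proof -
  have e: "bloch a b p x n = (of_real (sol a b x 0 1 p) * of_real (sol a b x 1 0 m)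
     + (cis (quasimom a b p x) - of_real (sol a b x 1 0 p)) * of_real (sol a b x 0 1 m)) / cis (quasimom a b p x) ^ k"
    if "m = nat (n + \<bar>n\<bar> * int p)" "k = nat \<bar>n\<bar>" for x m k
    unfolding bloch_def bloch_ext_def that by (subst sol_linear) (simp add: sol_of_real_01)
  show ?thesis
    unfolding e[OF refl refl] cis_conv_exp
    by (intro continuous_intros continuous_quasimom sol_cont) simp
qed

section \<open>The kernel in the quasimomentum variable\<close>

context periodic_jacobi
begin

definition dens :: "int \<Rightarrow> int \<Rightarrow> real \<Rightarrow> real" where
  "dens j k x = Re (bloch a b p x j * cnj (bloch a b p x k)) / bloch_mass a b p x"

text \<open>By \<open>bloch_mass_identity\<close> the Wronskian normalisation is the cell
  normalisation times the Jacobian of the quasimomentum; this prepares the change of variables on a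
  band.\<close>

lemma per_kernel_eq:
  assumes x: "x \<in> bands a b p"
  shows "per_kernel a b p j k x = \<bar>quasimom' a b p x\<bar> * (dens j k x / pi)"
proof -
  let ?S = "sol a b x 0 1 p" and ?s = "sin (quasimom a b p x)" and ?d = "discr' a b p x"
  have m: "bloch_mass a b p x = a 0 * \<bar>?d\<bar> * \<bar>?S\<bar>"
    using bloch_mass_identity[OF x] bloch_mass_pos[OF x] a_pos[of 0]
    by (metis abs_mult abs_of_pos mult.assoc)
  have s: "?s > 0" "?S \<noteq> 0" "?d \<noteq> 0" "a 0 > 0"
    using quasimom(2)[OF x] sol_nonzero[OF x] discr'_nonzero[OF x] a_pos by auto
  have i: "\<bar>Im (bloch a b p x 1 * cnj (bloch a b p x 0))\<bar> = \<bar>?S\<bar> * ?s"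
    using Im_bloch[OF x] s by (simp add: abs_mult)
  have q: "\<bar>quasimom' a b p x\<bar> = \<bar>?d\<bar> / (2 * ?s)" using s by (simp add: quasimom'_def abs_divide abs_mult)
  show ?thesis unfolding per_kernel_def dens_def if_P[OF x] m i q
    using s by (simp add: divide_simps)
qed

lemma dens_bound:
  assumes x: "x \<in> bands a b p"
  shows "\<bar>dens j k x\<bar> \<le> 1"
proof -
  let ?N = "bloch_mass a b p x"
  have "cmod (bloch a b p x j) \<le> sqrt ?N" "cmod (bloch a b p x k) \<le> sqrt ?N"
    using bloch_le_mass[OF x] by (simp_all add: real_le_rsqrt)
  then have "cmod (bloch a b p x j) * cmod (bloch a b p x k) \<le> sqrt ?N * sqrt ?N"
    by (intro mult_mono) (use bloch_mass_pos[OF x] in auto)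
  moreover have "sqrt ?N * sqrt ?N = ?N" using bloch_mass_pos[OF x] by simp
  ultimately have "cmod (bloch a b p x j * cnj (bloch a b p x k)) \<le> ?N" by (simp add: norm_mult)
  then have "\<bar>Re (bloch a b p x j * cnj (bloch a b p x k))\<bar> \<le> ?N"
    using abs_Re_le_cmod order_trans by blast
  then show ?thesis unfolding dens_def abs_divide using bloch_mass_pos[OF x] by (simp add: divide_simps)
qed

lemma continuous_per_kernel: "continuous_on (bands a b p) (per_kernel a b p j k)"
proof -
  have "continuous_on (bands a b p) (\<lambda>x. Re (bloch a b p x j * cnj (bloch a b p x k))
       / (2 * pi * a 0 * \<bar>Im (bloch a b p x 1 * cnj (bloch a b p x 0))\<bar>))"
  proof (intro continuous_intros continuous_bloch ballI)
    fix x assume x: "x \<in> bands a b p"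
    show "2 * pi * a 0 * \<bar>Im (bloch a b p x 1 * cnj (bloch a b p x 0))\<bar> \<noteq> 0"
      using Im_bloch[OF x] quasimom(2)[OF x] sol_nonzero[OF x] a_pos[of 0] by simp
  qed
  then show ?thesis
    by (rule continuous_on_eq) (simp add: per_kernel_def)
qed

lemma measurable_per_kernel [measurable]: "per_kernel a b p j k \<in> borel_measurable borel"
proof -
  have "(\<lambda>x. if x \<in> bands a b p then per_kernel a b p j k x else 0) \<in> borel_measurable borel"
    by (rule borel_measurable_continuous_on_if)
      (use open_bands[of a b p] continuous_per_kernel in auto)
  moreover have "(\<lambda>x. if x \<in> bands a b p then per_kernel a b p j k x else 0) = per_kernel a b p j k"
    by (intro ext) (simp add: per_kernel_def)
  ultimately show ?thesis by simp
qed

lemma quasimom_band: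
  assumes I: "{\<alpha><..<\<beta>} \<subseteq> bands a b p" and inj: "inj_on (discr a b p) {\<alpha>..\<beta>}"
    and im: "discr a b p ` {\<alpha><..<\<beta>} = {-2<..<2::real}"
  shows "inj_on (quasimom a b p) {\<alpha><..<\<beta>}" "quasimom a b p ` {\<alpha><..<\<beta>} = {0<..<pi}"
proof -
  have D: "discr a b p x = 2 * cos (quasimom a b p x)" if "x \<in> {\<alpha><..<\<beta>}" for x
    using quasimom(1)[of x a b p] I that by auto
  show "inj_on (quasimom a b p) {\<alpha><..<\<beta>}"
  proof (rule inj_onI)
    fix x y assume xy: "x \<in> {\<alpha><..<\<beta>}" "y \<in> {\<alpha><..<\<beta>}" "quasimom a b p x = quasimom a b p y"
    then have "discr a b p x = discr a b p y" using D by simp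
    then show "x = y" by (rule inj_onD[OF inj]) (use xy in auto)
  qed
  show "quasimom a b p ` {\<alpha><..<\<beta>} = {0<..<pi}"
  proof (intro set_eqI iffI)
    fix s assume "s \<in> quasimom a b p ` {\<alpha><..<\<beta>}"
    then show "s \<in> {0<..<pi}" using quasimom(3,4)[of _ a b p] I by fastforce
  next
    fix s assume s: "s \<in> {0<..<pi}"
    then have "2 * cos s \<in> {-2<..<2}"
      using cos_monotone_0_pi[of 0 s] cos_monotone_0_pi[of s pi] by auto
    then obtain x where x: "x \<in> {\<alpha><..<\<beta>}" "discr a b p x = 2 * cos s" using im by (metis imageE)
    then have "quasimom a b p x = s" using s by (simp add: quasimom_def arccos_cos)
    then show "s \<in> quasimom a b p ` {\<alpha><..<\<beta>}" using x by blast
  qed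
qed

text \<open>Change of variables from the energy to the quasimomentum, which maps one band
  bijectively onto (0, pi).\<close>

lemma band_integral:
  fixes j k :: int
  assumes I: "{\<alpha><..<\<beta>} \<subseteq> bands a b p" and inj: "inj_on (quasimom a b p) {\<alpha><..<\<beta>}"
    and im: "quasimom a b p ` {\<alpha><..<\<beta>} = {0<..<pi}"
  defines "h \<equiv> \<lambda>s. dens j k (inv_into {\<alpha><..<\<beta>} (quasimom a b p) s) / pi"
  shows "per_kernel a b p j k absolutely_integrable_on {\<alpha><..<\<beta>}"
    "h absolutely_integrable_on {0<..<pi}"
    "integral {\<alpha><..<\<beta>} (per_kernel a b p j k) = integral {0<..<pi} h"
proof -
  let ?I = "{\<alpha><..<\<beta>}" and ?q = "quasimom a b p" and ?q' = "quasimom' a b p"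
  have leb: "?I \<in> sets lebesgue" by simp
  have der: "(?q has_field_derivative ?q' x) (at x within ?I)" if "x \<in> ?I" for x
    unfolding quasimom'_def by (rule has_field_derivative_at_within[OF quasimom_DERIV]) (use I that in blast)
  note cov = has_absolute_integral_change_of_variables_1'[OF leb der inj, unfolded im]
  \<comment> \<open>Pulling back the constant 1 shows that the Jacobian is integrable on the band;
    since \<open>dens\<close> is bounded by 1, it dominates the kernel.\<close>
  have "(\<lambda>s::real. 1::real) absolutely_integrable_on {0<..<pi}"
    by (intro absolutely_integrable_on_const) simp
  then have "(\<lambda>x. \<bar>?q' x\<bar> * 1) absolutely_integrable_on ?I"
    using cov[of "\<lambda>s. 1" "integral {0<..<pi} (\<lambda>s. 1)"] by simp
  then have "(\<lambda>x. \<bar>?q' x\<bar> / pi) integrable_on ?I"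
    using set_lebesgue_integral_eq_integral(1) integrable_on_divide by fastforce
  moreover have "per_kernel a b p j k \<in> borel_measurable (lebesgue_on ?I)"
    by (rule continuous_imp_measurable_on_sets_lebesgue[OF continuous_on_subset[OF continuous_per_kernel I] leb])
  moreover have "norm (per_kernel a b p j k x) \<le> \<bar>?q' x\<bar> / pi" if "x \<in> ?I" for x
  proof -
    have x: "x \<in> bands a b p" using I that by auto
    have "norm (per_kernel a b p j k x) = \<bar>?q' x\<bar> * (\<bar>dens j k x\<bar> / pi)"
      unfolding per_kernel_eq[OF x] by (simp add: abs_mult)
    also have "\<dots> \<le> \<bar>?q' x\<bar> * (1 / pi)"
      using dens_bound[OF x, of j k] by (intro mult_left_mono divide_right_mono) auto
    finally show ?thesis by simp
  qed
  ultimately show k: "per_kernel a b p j k absolutely_integrable_on ?I"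
    using measurable_bounded_by_integrable_imp_absolutely_integrable[OF _ leb] by blast
  have e: "\<bar>?q' x\<bar> * h (?q x) = per_kernel a b p j k x" if "x \<in> ?I" for x
  proof -
    have "inv_into ?I ?q (?q x) = x" by (rule inv_into_f_f[OF inj that])
    moreover have "x \<in> bands a b p" using I that by auto
    ultimately show ?thesis by (simp add: h_def per_kernel_eq)
  qed
  have "(\<lambda>x. \<bar>?q' x\<bar> * h (?q x)) absolutely_integrable_on ?I
      \<longleftrightarrow> per_kernel a b p j k absolutely_integrable_on ?I"
  proof -
    have "(\<lambda>x. indicator ?I x *\<^sub>R (\<bar>?q' x\<bar> * h (?q x))) = (\<lambda>x. indicator ?I x *\<^sub>R per_kernel a b p j k x)"
      by (intro ext) (auto simp: indicator_def e)
    then show ?thesis unfolding set_integrable_def by simp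
  qed
  moreover have "integral ?I (\<lambda>x. \<bar>?q' x\<bar> * h (?q x)) = integral ?I (per_kernel a b p j k)"
    by (rule integral_cong[OF e])
  ultimately have "h absolutely_integrable_on {0<..<pi} \<and> integral {0<..<pi} h = integral ?I (per_kernel a b p j k)"
    using cov[of h "integral ?I (per_kernel a b p j k)"] k by simp
  then show "h absolutely_integrable_on {0<..<pi}" "integral ?I (per_kernel a b p j k) = integral {0<..<pi} h"
    by auto
qed

text \<open>All bands are carried to the same interval (0, pi). There the sum over bands is, for
  each s, a sum over the level set 2 cos s, which \<open>bloch_complete\<close> evaluates before the
  integration.\<close>

lemma per_kernel_integral:
  "integrable lborel (per_kernel a b p j k)"
  "(\<integral>x. per_kernel a b p j k x \<partial>lborel) = (if j = k then 1 else 0)"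
proof -
  let ?K = "per_kernel a b p j k" and ?q = "quasimom a b p"
  \<comment> \<open>Every band contains exactly one zero of the discriminant, so the zeros label the
    bands.\<close>
  define Z where "Z = {x::real. discr a b p x = 0}"
  have Z: "finite Z" "card Z = p" using card_level_set[of 0] by (simp_all add: Z_def)
  have Zb: "r \<in> bands a b p" if "r \<in> Z" for r using that by (simp add: Z_def bands_def)
  have "\<forall>r\<in>Z. \<exists>\<alpha> \<beta>. \<alpha> < r \<and> r < \<beta> \<and> {\<alpha><..<\<beta>} \<subseteq> bands a b p \<and> \<bar>discr a b p \<alpha>\<bar> = 2 \<and> \<bar>discr a b p \<beta>\<bar> = 2
    \<and> inj_on (discr a b p) {\<alpha>..\<beta>} \<and> discr a b p ` {\<alpha><..<\<beta>} = {-2<..<2::real}"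
    by (rule ballI, rule band_interval, erule Zb) (metis abs_minus_cancel)
  then obtain \<alpha> \<beta> where ab: "\<And>r. r \<in> Z \<Longrightarrow> \<alpha> r < r \<and> r < \<beta> r \<and> {\<alpha> r<..<\<beta> r} \<subseteq> bands a b p
     \<and> \<bar>discr a b p (\<alpha> r)\<bar> = 2 \<and> \<bar>discr a b p (\<beta> r)\<bar> = 2
     \<and> inj_on (discr a b p) {\<alpha> r..\<beta> r} \<and> discr a b p ` {\<alpha> r<..<\<beta> r} = {-2<..<2::real}"
    by metis
  define I where "I r = {\<alpha> r<..<\<beta> r}" for r
  have Ib: "I r \<subseteq> bands a b p" if "r \<in> Z" for r using ab[OF that] by (simp add: I_def)
  have rI: "r \<in> I r" if "r \<in> Z" for r using ab[OF that] by (simp add: I_def)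
  have edge: "\<alpha> r \<notin> bands a b p" "\<beta> r \<notin> bands a b p" if "r \<in> Z" for r
    using ab[OF that] by (auto simp: bands_def)
  have disj: "r = r'" if r: "r \<in> Z" "r' \<in> Z" and x: "x \<in> I r" "x \<in> I r'" for r r' x
  proof -
    have "\<alpha> r = \<alpha> r'"
      using edge(1)[OF r(1)] edge(1)[OF r(2)] Ib[OF r(1)] Ib[OF r(2)] x unfolding I_def
      by (metis greaterThanLessThan_iff less_trans linorder_neqE subsetD)
    moreover have "\<beta> r = \<beta> r'"
      using edge(2)[OF r(1)] edge(2)[OF r(2)] Ib[OF r(1)] Ib[OF r(2)] x unfolding I_def
      by (metis greaterThanLessThan_iff less_trans linorder_neqE subsetD)
    ultimately have "r' \<in> {\<alpha> r..\<beta> r}" "r \<in> {\<alpha> r..\<beta> r}" using ab[OF r(1)] ab[OF r(2)] by auto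
    moreover have "discr a b p r = discr a b p r'" using r by (simp add: Z_def)
    moreover have "inj_on (discr a b p) {\<alpha> r..\<beta> r}" using ab[OF r(1)] by blast
    ultimately show ?thesis by (auto dest: inj_onD)
  qed
  have qI: "inj_on ?q (I r)" "?q ` I r = {0<..<pi}" if "r \<in> Z" for r
    using quasimom_band[of "\<alpha> r" "\<beta> r"] ab[OF that] unfolding I_def by blast+
  define y where "y r s = inv_into (I r) ?q s" for r s
  have y: "y r s \<in> I r" "?q (y r s) = s" if "r \<in> Z" "s \<in> {0<..<pi}" for r s
    unfolding y_def using qI(2)[OF that(1)] that(2) by (auto intro: inv_into_into f_inv_into_f)
  have yZ: "(\<lambda>r. y r s) ` Z = {x. discr a b p x = 2 * cos s}" "inj_on (\<lambda>r. y r s) Z" if s: "s \<in> {0<..<pi}" for s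
  proof -
    have c: "\<bar>2 * cos s\<bar> < 2"
      using s cos_monotone_0_pi[of 0 s] cos_monotone_0_pi[of s pi] by auto
    show inj: "inj_on (\<lambda>r. y r s) Z"
      by (rule inj_onI) (use disj y(1) s in metis)
    \<comment> \<open>The p inverse branches take distinct values in a level set of exactly p
      elements, so they exhaust it.\<close>
    show "(\<lambda>r. y r s) ` Z = {x. discr a b p x = 2 * cos s}"
    proof (rule card_le_inj_bij[OF Z(1) _ _ _ inj])
      show "finite {x::real. discr a b p x = 2 * cos s}" "card Z = card {x::real. discr a b p x = 2 * cos s}"
        using card_level_set[OF c] Z by auto
      show "(\<lambda>r. y r s) ` Z \<subseteq> {x. discr a b p x = 2 * cos s}"
      proof
        fix x assume "x \<in> (\<lambda>r. y r s) ` Z"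
        then obtain r where r: "r \<in> Z" "x = y r s" by blast
        then have "x \<in> bands a b p" "?q x = s" using y[OF r(1) s] Ib[OF r(1)] by auto
        then show "x \<in> {x. discr a b p x = 2 * cos s}" using quasimom(1)[of x a b p] by simp
      qed
    qed
  qed
  have cover: "\<exists>r\<in>Z. x \<in> I r" if x: "x \<in> bands a b p" for x
  proof -
    have s: "?q x \<in> {0<..<pi}" using quasimom(3,4)[OF x] by simp
    have "x \<in> {x'. discr a b p x' = 2 * cos (?q x)}" using quasimom(1)[OF x] by simp
    then obtain r where r: "r \<in> Z" "x = y r (?q x)" unfolding yZ(1)[OF s, symmetric] by blast
    then show ?thesis using y(1)[OF r(1) s] by metis
  qed
  have split: "?K x = (\<Sum>r\<in>Z. indicator (I r) x *\<^sub>R ?K x)" for x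
  proof (cases "x \<in> bands a b p")
    case True
    then obtain r where r: "r \<in> Z" "x \<in> I r" using cover by blast
    have "(\<Sum>r'\<in>Z. indicator (I r') x *\<^sub>R ?K x) = (\<Sum>r'\<in>Z. if r' = r then ?K x else 0)"
      by (intro sum.cong refl) (use r disj in \<open>auto simp: indicator_def\<close>)
    then show ?thesis using r Z(1) by simp
  next
    case False
    then show ?thesis by (simp add: per_kernel_def)
  qed
  define h where "h r s = dens j k (y r s) / pi" for r s
  have B: "?K absolutely_integrable_on I r" "h r absolutely_integrable_on {0<..<pi}"
    "integral (I r) ?K = integral {0<..<pi} (h r)" if "r \<in> Z" for r
    using band_integral[of "\<alpha> r" "\<beta> r" j k] Ib[OF that] qI[OF that] unfolding I_def h_def[abs_def] y_def by blast+
  have Bi: "integrable lebesgue (\<lambda>x. indicator (I r) x *\<^sub>R ?K x)" if "r \<in> Z" for r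
    using B(1)[OF that] by (simp add: set_integrable_def)
  have iK: "integrable lebesgue ?K"
    by (subst split[abs_def], rule Bochner_Integration.integrable_sum) (rule Bi)
  then show "integrable lborel ?K" by (simp add: integrable_completion)
  have "(\<integral>x. ?K x \<partial>lborel) = (\<integral>x. ?K x \<partial>lebesgue)" by (rule integral_completion[symmetric]) simp
  also have "\<dots> = (\<integral>x. (\<Sum>r\<in>Z. indicator (I r) x *\<^sub>R ?K x) \<partial>lebesgue)"
    by (rule Bochner_Integration.integral_cong[OF refl split])
  also have "\<dots> = (\<Sum>r\<in>Z. \<integral>x. indicator (I r) x *\<^sub>R ?K x \<partial>lebesgue)"
    by (rule Bochner_Integration.integral_sum[OF Bi])
  also have "\<dots> = (\<Sum>r\<in>Z. integral {0<..<pi} (h r))"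
  proof (rule sum.cong[OF refl])
    fix r assume r: "r \<in> Z"
    show "(\<integral>x. indicator (I r) x *\<^sub>R ?K x \<partial>lebesgue) = integral {0<..<pi} (h r)"
      using set_lebesgue_integral_eq_integral(2)[OF B(1)[OF r]] B(3)[OF r] by (simp add: set_lebesgue_integral_def)
  qed
  also have "\<dots> = integral {0<..<pi} (\<lambda>s. \<Sum>r\<in>Z. h r s)"
    by (rule Henstock_Kurzweil_Integration.integral_sum[symmetric, OF Z(1)])
      (rule set_lebesgue_integral_eq_integral(1)[OF B(2)])
  also have "\<dots> = integral {0<..<pi} (\<lambda>s. (if site j = site k then cos (s * of_int (cell j - cell k)) else 0) / pi)"
  proof (rule Henstock_Kurzweil_Integration.integral_cong)
    fix s assume s: "s \<in> {0<..<pi}"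
    have "(\<Sum>r\<in>Z. h r s) = (\<Sum>r\<in>Z. dens j k (y r s)) / pi" by (simp add: h_def sum_divide_distrib)
    also have "(\<Sum>r\<in>Z. dens j k (y r s)) = (\<Sum>x\<in>{x. discr a b p x = 2 * cos s}. dens j k x)"
      unfolding yZ(1)[OF s, symmetric] by (rule sum.reindex[OF yZ(2)[OF s], unfolded comp_def, symmetric])
    also have "\<dots> = (if site j = site k then cos (s * of_int (cell j - cell k)) else 0)"
      unfolding dens_def using s by (intro bloch_complete) auto
    finally show "(\<Sum>r\<in>Z. h r s) = (if site j = site k then cos (s * of_int (cell j - cell k)) else 0) / pi" .
  qed
  also have "\<dots> = (if j = k then 1 else 0)"
  proof (cases "site j = site k")
    case True
    have "((\<lambda>s. cos (s * of_int (cell j - cell k)) / pi) has_integral (if cell j - cell k = 0 then pi else 0) / pi) {0<..<pi}"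
      using has_integral_divide[OF integral_cos_int[of "cell j - cell k"], of pi] by (simp add: has_integral_Icc_iff_Ioo)
    then have "integral {0<..<pi} (\<lambda>s. cos (s * of_int (cell j - cell k)) / pi) = (if cell j - cell k = 0 then pi else 0) / pi"
      by (rule integral_unique)
    moreover have "cell j - cell k = 0 \<longleftrightarrow> j = k"
      using cell_site(1)[of j] cell_site(1)[of k] True by (metis diff_self eq_iff_diff_eq_0)
    ultimately show ?thesis using True by simp
  next
    case False
    then have "j \<noteq> k" by auto
    then show ?thesis using False by simp
  qed
  finally show "(\<integral>x. ?K x \<partial>lborel) = (if j = k then 1 else 0)" .
qed

text \<open>The double sum is the squared modulus of a linear combination of values of the Bloch
  wave, up to a nonnegative factor.\<close>

lemma psd_per_kernel: "psd (\<lambda>j k. per_kernel a b p j k x)"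
proof -
  define c where "c = 2 * pi * a 0 * \<bar>Im (bloch a b p x 1 * cnj (bloch a b p x 0))\<bar>"
  have c: "c \<ge> 0" unfolding c_def using a_pos[of 0] by simp
  let ?w = "bloch a b p x"
  have "per_kernel a b p j k x = per_kernel a b p k j x" for j k
    by (simp add: per_kernel_def algebra_simps)
  moreover have "0 \<le> (\<Sum>j\<in>F. \<Sum>k\<in>F. u j * u k * per_kernel a b p j k x)" for F and u :: "int \<Rightarrow> real"
  proof (cases "x \<in> bands a b p")
    case True
    define W where "W = (\<Sum>j\<in>F. of_real (u j) * ?w j)"
    have pk: "per_kernel a b p j k x = Re (?w j * cnj (?w k)) / c" for j k
      unfolding per_kernel_def c_def using True by (simp only: if_True)
    have "(\<Sum>j\<in>F. \<Sum>k\<in>F. u j * u k * per_kernel a b p j k x)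
       = (\<Sum>j\<in>F. \<Sum>k\<in>F. Re ((of_real (u j) * ?w j) * cnj (of_real (u k) * ?w k))) / c"
      unfolding pk sum_divide_distrib by (intro sum.cong refl) (simp add: algebra_simps)
    also have "(\<Sum>j\<in>F. \<Sum>k\<in>F. Re ((of_real (u j) * ?w j) * cnj (of_real (u k) * ?w k))) = Re (W * cnj W)"
      unfolding W_def cnj_sum sum_product Re_sum ..
    also have "Re (W * cnj W) = (cmod W)\<^sup>2" by (simp add: cmod_power2[unfolded power2_eq_square] power2_eq_square)
    finally show ?thesis using c by simp
  qed (simp add: per_kernel_def)
  ultimately show ?thesis unfolding psd_def by blast
qed

lemma per_kernel_recurrence:
  "a (j - 1) * per_kernel a b p (j - 1) k x + a j * per_kernel a b p (j + 1) k x + b j * per_kernel a b p j k x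
    = x * per_kernel a b p j k x"
proof (cases "x \<in> bands a b p")
  case True
  let ?w = "bloch a b p x"
  have "a (j - 1) * ?w (j - 1) + a j * ?w (j + 1) + b j * ?w j = of_real x * ?w j"
    using fun_cong[OF bloch_jacobi[OF True], of j] by (simp add: jacobi_def)
  then have "Re ((a (j - 1) * ?w (j - 1) + a j * ?w (j + 1) + b j * ?w j) * cnj (?w k)) = Re (of_real x * ?w j * cnj (?w k))"
    by simp
  then have "a (j - 1) * Re (?w (j - 1) * cnj (?w k)) + a j * Re (?w (j + 1) * cnj (?w k)) + b j * Re (?w j * cnj (?w k))
     = x * Re (?w j * cnj (?w k))"
    by (simp add: algebra_simps)
  then show ?thesis using True
    by (simp add: per_kernel_def add_divide_distrib[symmetric])
qed (simp add: per_kernel_def)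

lemma spectral_kernel_per_kernel: "spectral_kernel a b (per_kernel a b p)"
  unfolding spectral_kernel_def
  using per_kernel_integral psd_per_kernel per_kernel_recurrence by simp

end

section \<open>Passing to multiples of the period\<close>

context periodic_jacobi
begin

lemma periodic_multiple: "L > 0 \<Longrightarrow> periodic_jacobi a b (L * p)"
  using p_pos a_pos per_mult[of _ L] by unfold_locales auto

lemma finite_discr_level: "finite {x::real. discr a b p x = s}"
proof -
  obtain P where P: "\<And>z::real. discr a b p z = poly P z" "degree P = p"
    using degree_discr[of a p b, OF a_pos p_pos] by blast
  have "degree (P + [:- s:]) = p" using P(2) p_pos by (subst degree_add_eq_left) auto
  then have "P + [:- s:] \<noteq> 0" using p_pos by auto
  then have "finite {x. poly (P + [:- s:]) x = 0}" by (rule poly_roots_finite)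
  then show ?thesis by (simp add: P)
qed

text \<open>Determinant 1 turns the characteristic equation of the monodromy matrix M into M^2 =
  discr * M - 1, applied here to both components of a solution.\<close>

lemma sol_Cayley_Hamilton:
  fixes z :: "'a::real_field"
  shows "sol a b z \<alpha> \<beta> (p + p) = discr a b p z * sol a b z \<alpha> \<beta> p - \<alpha>"
    "sol a b z \<alpha> \<beta> (Suc p + p) = discr a b p z * sol a b z \<alpha> \<beta> (Suc p) - \<beta>"
proof -
  let ?C = "sol a b z 1 0" and ?S = "sol a b z 0 1"
  have d: "?S p * ?C (Suc p) = ?C p * ?S (Suc p) - 1" using det_monodromy[of z] by (simp add: algebra_simps)
  have lin: "sol a b z \<alpha> \<beta> n = \<alpha> * ?C n + \<beta> * ?S n" for \<alpha> \<beta> n by (rule sol_linear)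
  have "sol a b z \<alpha> \<beta> (p + p) = (\<alpha> * ?C p + \<beta> * ?S p) * ?C p + (\<alpha> * ?C (Suc p) + \<beta> * ?S (Suc p)) * ?S p"
    unfolding sol_shift by (subst (1 2 3) lin) simp
  also have "\<dots> = \<alpha> * ?C p * ?C p + \<beta> * ?S p * ?C p + \<alpha> * (?S p * ?C (Suc p)) + \<beta> * ?S (Suc p) * ?S p"
    by (simp add: algebra_simps)
  also have "\<dots> = discr a b p z * (\<alpha> * ?C p + \<beta> * ?S p) - \<alpha>"
    unfolding d discr_def by (simp add: algebra_simps)
  finally show "sol a b z \<alpha> \<beta> (p + p) = discr a b p z * sol a b z \<alpha> \<beta> p - \<alpha>"
    unfolding lin[symmetric] .
  have "sol a b z \<alpha> \<beta> (Suc p + p) = (\<alpha> * ?C p + \<beta> * ?S p) * ?C (Suc p) + (\<alpha> * ?C (Suc p) + \<beta> * ?S (Suc p)) * ?S (Suc p)"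
    unfolding sol_shift by (subst (1 2 3) lin) simp
  also have "\<dots> = \<alpha> * ?C p * ?C (Suc p) + \<beta> * (?S p * ?C (Suc p)) + \<alpha> * ?C (Suc p) * ?S (Suc p) + \<beta> * ?S (Suc p) * ?S (Suc p)"
    by (simp add: algebra_simps)
  also have "\<dots> = discr a b p z * (\<alpha> * ?C (Suc p) + \<beta> * ?S (Suc p)) - \<beta>"
    unfolding d discr_def by (simp add: algebra_simps)
  finally show "sol a b z \<alpha> \<beta> (Suc p + p) = discr a b p z * sol a b z \<alpha> \<beta> (Suc p) - \<beta>"
    unfolding lin[symmetric] .
qed

lemma sol_shift_mult: "sol a b z \<alpha> \<beta> (n + k * p) = sol a b z (sol a b z \<alpha> \<beta> (k * p)) (sol a b z \<alpha> \<beta> (Suc (k * p))) n"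
proof (cases "k = 0")
  case False
  then interpret q: periodic_jacobi a b "k * p" using periodic_multiple by simp
  show ?thesis by (rule q.sol_shift)
qed simp

text \<open>The three-term recursion of the Chebyshev polynomials, for the entries of powers of the
  monodromy matrix; i selects the component at site 0 or 1 of a period.\<close>

lemma sol_mult_recurrence:
  fixes z :: "'a::real_field"
  assumes "i \<le> 1"
  shows "sol a b z \<alpha> \<beta> (Suc (Suc k) * p + i) = discr a b p z * sol a b z \<alpha> \<beta> (Suc k * p + i) - sol a b z \<alpha> \<beta> (k * p + i)"
proof -
  have i: "i = 0 \<or> i = 1" using assms by auto
  have e: "Suc (Suc k) * p + i = (i + p + p) + k * p" "Suc k * p + i = (i + p) + k * p" "k * p + i = i + k * p"
    by (simp_all add: algebra_simps)
  show ?thesis unfolding e sol_shift_mult[of z \<alpha> \<beta> _ k]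
    using i sol_Cayley_Hamilton[of z] by auto
qed

lemma discr_mult_recurrence:
  fixes z :: "'a::real_field"
  shows "discr a b (Suc (Suc k) * p) z = discr a b p z * discr a b (Suc k * p) z - discr a b (k * p) z"
  unfolding discr_def[of a b "Suc (Suc k) * p"] discr_def[of a b "Suc k * p"] discr_def[of a b "k * p"]
  using sol_mult_recurrence[of 0 z 1 0 k] sol_mult_recurrence[of 1 z 0 1 k]
  by (simp add: algebra_simps)

lemma discr_mult:
  assumes x: "x \<in> bands a b p"
  shows "discr a b (k * p) x = 2 * cos (of_nat k * quasimom a b p x)"
proof (induction k rule: nat_two_step_induct)
  case 0
  show ?case by (simp add: discr_def)
next
  case 1
  show ?case using quasimom(1)[OF x] by simp
next
  case (Suc k)
  let ?t = "quasimom a b p x"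
  have "cos (of_nat (Suc (Suc k)) * ?t) + cos (of_nat k * ?t) = 2 * cos ?t * cos (of_nat (Suc k) * ?t)"
    using cos_add[of "of_nat (Suc k) * ?t" ?t] cos_diff[of "of_nat (Suc k) * ?t" ?t]
    by (simp add: algebra_simps)
  moreover have "discr a b p x = 2 * cos ?t" using quasimom(1)[OF x] by simp
  ultimately show ?case unfolding discr_mult_recurrence Suc by (simp add: algebra_simps)
qed

lemma sol_mult:
  assumes x: "x \<in> bands a b p"
  shows "sol a b x 0 1 (k * p) * sin (quasimom a b p x) = sol a b x 0 1 p * sin (of_nat k * quasimom a b p x)"
proof (induction k rule: nat_two_step_induct)
  case (Suc k)
  let ?t = "quasimom a b p x"
  have s: "sin (of_nat (Suc (Suc k)) * ?t) + sin (of_nat k * ?t) = 2 * cos ?t * sin (of_nat (Suc k) * ?t)"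
    using sin_add[of "of_nat (Suc k) * ?t" ?t] sin_diff[of "of_nat (Suc k) * ?t" ?t]
    by (simp add: algebra_simps)
  have d: "discr a b p x = 2 * cos ?t" using quasimom(1)[OF x] by simp
  have "sol a b x 0 1 (Suc (Suc k) * p) * sin ?t
     = 2 * cos ?t * (sol a b x 0 1 (Suc k * p) * sin ?t) - sol a b x 0 1 (k * p) * sin ?t"
  proof -
    have r: "sol a b x 0 1 (Suc (Suc k) * p) = 2 * cos ?t * sol a b x 0 1 (Suc k * p) - sol a b x 0 1 (k * p)"
      using sol_mult_recurrence[of 0 x 0 1 k] unfolding d add_0_right by simp
    show ?thesis unfolding r by (simp only: left_diff_distrib mult.assoc)
  qed
  also have "\<dots> = sol a b x 0 1 p * (2 * cos ?t * sin (of_nat (Suc k) * ?t) - sin (of_nat k * ?t))"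
    unfolding Suc by (simp add: algebra_simps)
  also have "2 * cos ?t * sin (of_nat (Suc k) * ?t) - sin (of_nat k * ?t) = sin (of_nat (Suc (Suc k)) * ?t)"
    using s by simp
  finally show ?case .
qed auto

text \<open>For a trace of modulus at least 2 the recursion makes the moduli nondecreasing in k, so
  points outside the bands stay outside for every multiple of the period.\<close>

lemma discr_mult_outside:
  fixes x :: real
  assumes "\<bar>discr a b p x\<bar> \<ge> 2" "k > 0"
  shows "\<bar>discr a b (k * p) x\<bar> \<ge> \<bar>discr a b p x\<bar>"
proof -
  let ?D = "discr a b p x" and ?d = "\<lambda>k. discr a b (k * p) x"
  have step: "\<bar>?d k\<bar> \<le> \<bar>?d (Suc k)\<bar>" for k
  proof (induction k)
    case 0
    show ?case using assms(1) by (simp add: discr_def)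
  next
    case (Suc k)
    have "2 * \<bar>?d (Suc k)\<bar> \<le> \<bar>?D\<bar> * \<bar>?d (Suc k)\<bar>" using assms(1) by (intro mult_right_mono) auto
    also have "\<dots> = \<bar>?d (Suc (Suc k)) + ?d k\<bar>" unfolding discr_mult_recurrence by (simp add: abs_mult)
    finally show ?case using Suc by linarith
  qed
  have "\<bar>?d 1\<bar> \<le> \<bar>?d k\<bar>"
    by (rule lift_Suc_mono_le[of "\<lambda>k. \<bar>?d k\<bar>", OF step]) (use assms(2) in simp)
  then show ?thesis by simp
qed

lemma bands_mult_subset:
  assumes "k > 0"
  shows "bands a b (k * p) \<subseteq> bands a b p"
proof
  fix x assume "x \<in> bands a b (k * p)"
  then show "x \<in> bands a b p" using discr_mult_outside[of x k] assms unfolding bands_def by force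
qed

text \<open>As S(p) is nonzero, the monodromy equation determines the value at 1 from the value at
  0, so the eigenspace is one-dimensional.\<close>

lemma bloch_unique:
  assumes x: "x \<in> bands a b p" and w: "jacobi a b w = (\<lambda>n. of_real x * w n)"
    and per: "\<And>n. w (n + int p) = cis (quasimom a b p x) * w n"
  obtains c where "\<And>n. w n = c * bloch a b p x n"
proof -
  let ?S = "complex_of_real (sol a b x 0 1 p)" and ?C = "complex_of_real (sol a b x 1 0 p)"
  let ?z = "cis (quasimom a b p x)"
  have S: "?S \<noteq> 0" using sol_nonzero[OF x] by simp
  have wn: "w (int n) = sol a b (of_real x) (w 0) (w 1) n" for n by (rule jacobi_sol[OF a_pos w])
  define c where "c = w 0 / ?S"
  have w0: "w 0 = c * ?S" using S by (simp add: c_def)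
  have "w 0 * ?C + w 1 * ?S = ?z * w 0"
    using wn[of p] per[of 0] sol_linear[of a b "of_real x" "w 0" "w 1" p] by (simp add: sol_of_real_01)
  then have w1: "w 1 = c * (?z - ?C)" using S by (simp add: c_def field_simps)
  have nat: "w (int n) = c * bloch a b p x (int n)" for n
    using jacobi_sol[OF a_pos bloch_jacobi[OF x], of n] wn[of n] unfolding bloch_01[OF x] w0 w1 sol_scale by simp
  have pw: "g (n + int k * int p) = ?z ^ k * g n" if "\<And>n. g (n + int p) = ?z * g n" for g :: "int \<Rightarrow> complex" and k n
  proof (induction k)
    case (Suc k)
    have e: "n + int (Suc k) * int p = (n + int k * int p) + int p" by (simp add: algebra_simps)
    show ?case unfolding e that Suc by simp
  qed simp
  have "w n = c * bloch a b p x n" for n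
  proof -
    define k where "k = nat \<bar>n\<bar>"
    have "\<bar>n\<bar> * 1 \<le> \<bar>n\<bar> * int p" using p_pos by (intro mult_left_mono) auto
    then have "n + int k * int p \<ge> 0" by (simp add: k_def)
    then obtain m where m: "n + int k * int p = int m" using nonneg_int_cases by blast
    have "?z ^ k * w n = c * (?z ^ k * bloch a b p x n)"
      using nat[of m] unfolding m[symmetric] pw[of w, OF per] pw[of "bloch a b p x", OF bloch_shift[OF x]] .
    then show ?thesis by simp
  qed
  then show thesis using that by blast
qed

text \<open>Scaling multiplies numerator and denominator by the same positive factor, and
  conjugation swaps the two multipliers without changing the formula. Any Bloch wave may therefore
  be used to compute the kernel.\<close>

lemma per_kernel_unique:
  assumes x: "x \<in> bands a b p" and w: "jacobi a b w = (\<lambda>n. of_real x * w n)" and w0: "w 0 \<noteq> 0"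
    and per: "\<And>n. w (n + int p) = \<mu> * w n" and \<mu>: "\<mu> = cis (quasimom a b p x) \<or> \<mu> = cis (- quasimom a b p x)"
  shows "per_kernel a b p j k x = Re (w j * cnj (w k)) / (2 * pi * a 0 * \<bar>Im (w 1 * cnj (w 0))\<bar>)"
proof -
  have *: "per_kernel a b p j k x = Re (w j * cnj (w k)) / (2 * pi * a 0 * \<bar>Im (w 1 * cnj (w 0))\<bar>)"
    if w: "jacobi a b w = (\<lambda>n. of_real x * w n)" and w0: "w 0 \<noteq> 0"
    and per: "\<And>n. w (n + int p) = cis (quasimom a b p x) * w n" for w
  proof -
    obtain c where c: "\<And>n. w n = c * bloch a b p x n" using bloch_unique[OF x w per] by blast
    then have c0: "c \<noteq> 0" using w0 by auto
    have e: "w j * cnj (w k) = of_real ((cmod c)\<^sup>2) * (bloch a b p x j * cnj (bloch a b p x k))" for j k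
      unfolding c complex_norm_square by simp
    have r: "Re (of_real r * u) = r * Re u" "Im (of_real r * u) = r * Im u" for r u by simp_all
    have p: "(cmod c)\<^sup>2 > 0" using c0 by simp
    show ?thesis unfolding e r abs_mult per_kernel_def if_P[OF x] using p by (simp add: mult.left_commute)
  qed
  from \<mu> show ?thesis
  proof
    assume "\<mu> = cis (quasimom a b p x)"
    then show ?thesis using *[OF w w0] per by simp
  next
    assume m: "\<mu> = cis (- quasimom a b p x)"
    define v where "v n = cnj (w n)" for n
    have jv: "jacobi a b v = (\<lambda>n. of_real x * v n)"
    proof
      fix n
      have "cnj (jacobi a b w n) = cnj (of_real x * w n)" using w by simp
      then show "jacobi a b v n = of_real x * v n" by (simp add: jacobi_def v_def)
    qed
    have pv: "v (n + int p) = cis (quasimom a b p x) * v n" for n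
      unfolding v_def per m by (simp add: cis_cnj)
    have "v 0 \<noteq> 0" using w0 by (simp add: v_def)
    then have "per_kernel a b p j k x = Re (v j * cnj (v k)) / (2 * pi * a 0 * \<bar>Im (v 1 * cnj (v 0))\<bar>)"
      by (rule *[OF jv _ pv])
    moreover have "Re (v j * cnj (v k)) = Re (w j * cnj (w k))" by (simp add: v_def)
    moreover have "Im (v 1 * cnj (v 0)) = - Im (w 1 * cnj (w 0))" by (simp add: v_def)
    then have "\<bar>Im (v 1 * cnj (v 0))\<bar> = \<bar>Im (w 1 * cnj (w 0))\<bar>" by (simp only: abs_minus_cancel)
    ultimately show ?thesis by (simp only:)
  qed
qed

text \<open>A Bloch wave for p is one for L * p, with the L-th power of the multiplier. Only the
  finitely many energies at which the long discriminant is \<plusminus>2 are lost.\<close>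

lemma per_kernel_multiple:
  assumes L: "L > 0"
  shows "AE x in lborel. \<forall>j k. per_kernel a b (L * p) j k x = per_kernel a b p j k x"
proof -
  interpret q: periodic_jacobi a b "L * p" by (rule periodic_multiple[OF L])
  define E where "E = {x::real. discr a b (L * p) x = 2} \<union> {x. discr a b (L * p) x = -2}"
  have "finite E" unfolding E_def using q.finite_discr_level by blast
  then have "E \<in> null_sets lborel" by (intro finite_imp_null_set_lborel)
  then have "AE x in lborel. x \<notin> E" by (rule AE_not_in)
  then show ?thesis
  proof eventually_elim
    case (elim x)
    show ?case
    proof (cases "x \<in> bands a b p")
      case False
      then show ?thesis using bands_mult_subset[OF L] by (auto simp: per_kernel_def)
    next
      case True
      let ?t = "quasimom a b p x"
      have d: "discr a b (L * p) x = 2 * cos (of_nat L * ?t)" by (rule discr_mult[OF True])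
      have xq: "x \<in> bands a b (L * p)"
      proof -
        have "\<bar>discr a b (L * p) x\<bar> \<le> 2" unfolding d by (simp add: abs_mult)
        moreover have "\<bar>discr a b (L * p) x\<bar> \<noteq> 2" using elim by (auto simp: E_def)
        ultimately show ?thesis by (simp add: bands_def)
      qed
      have "cos (quasimom a b (L * p) x) = cos (of_nat L * ?t)" using quasimom(1)[OF xq] d by simp
      \<comment> \<open>The cosines agree, so the sines agree up to sign: the L-th power may be
        either of the two conjugate multipliers.\<close>
      moreover have "sin (quasimom a b (L * p) x) = sin (of_nat L * ?t) \<or> sin (quasimom a b (L * p) x) = - sin (of_nat L * ?t)"
        using \<open>cos _ = cos _\<close> by (simp add: power2_eq_iff[symmetric] sin_squared_eq)
      ultimately have \<mu>: "cis (of_nat L * ?t) = cis (quasimom a b (L * p) x) \<or> cis (of_nat L * ?t) = cis (- quasimom a b (L * p) x)"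
        by (auto simp: complex_eq_iff)
      have sh: "bloch a b p x (n + int (L * p)) = cis (of_nat L * ?t) * bloch a b p x n" for n
        using bloch_mult_shift[OF True, of n "int L"] by (simp add: mult.commute)
      have w0: "bloch a b p x 0 \<noteq> 0" using bloch_01[OF True] sol_nonzero[OF True] by simp
      show ?thesis
      proof (intro allI)
        fix j k
        show "per_kernel a b (L * p) j k x = per_kernel a b p j k x"
          using q.per_kernel_unique[OF xq bloch_jacobi[OF True] w0 sh \<mu>, of j k] True
          by (simp add: per_kernel_def)
      qed
    qed
  qed
qed

end

section \<open>Approximate eigenvalues\<close>

lemma l2_norm_finite_support:
  assumes F: "finite F" and supp: "\<And>n. n \<notin> F \<Longrightarrow> \<psi> n = 0"
  shows "\<psi> \<in> l2" "(l2_norm \<psi>)\<^sup>2 = (\<Sum>n\<in>F. (cmod (\<psi> n))\<^sup>2)"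
proof -
  have le: "(\<Sum>n\<in>H. (cmod (\<psi> n))\<^sup>2) \<le> (\<Sum>n\<in>F. (cmod (\<psi> n))\<^sup>2)" if H: "finite H" for H
  proof -
    have "(\<Sum>n\<in>H. (cmod (\<psi> n))\<^sup>2) = (\<Sum>n\<in>H \<inter> F. (cmod (\<psi> n))\<^sup>2)"
      by (rule sum.mono_neutral_right) (use H supp in auto)
    also have "\<dots> \<le> (\<Sum>n\<in>F. (cmod (\<psi> n))\<^sup>2)" by (rule sum_mono2) (use F in auto)
    finally show ?thesis .
  qed
  have S: "(\<Sum>n\<in>F. (cmod (\<psi> n))\<^sup>2) \<ge> 0" by (simp add: sum_nonneg)
  have "(\<Sum>n\<in>H. (cmod (\<psi> n))\<^sup>2) \<le> (sqrt (\<Sum>n\<in>F. (cmod (\<psi> n))\<^sup>2))\<^sup>2" if "finite H" for H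
    using le[OF that] S by simp
  from l2I_finite[OF this] S
  have 1: "\<psi> \<in> l2" "l2_norm \<psi> \<le> sqrt (\<Sum>n\<in>F. (cmod (\<psi> n))\<^sup>2)" by simp_all
  have "(l2_norm \<psi>)\<^sup>2 \<le> (sqrt (\<Sum>n\<in>F. (cmod (\<psi> n))\<^sup>2))\<^sup>2" by (rule power_mono[OF 1(2) l2_norm_nonneg])
  then show "\<psi> \<in> l2" "(l2_norm \<psi>)\<^sup>2 = (\<Sum>n\<in>F. (cmod (\<psi> n))\<^sup>2)"
    using 1(1) sum_le_l2_norm[OF 1(1) F] S by simp_all
qed

context periodic_jacobi
begin

lemma bloch_mass_blocks:
  assumes x: "x \<in> bands a b p"
  shows "(\<Sum>n=1..m * p. (cmod (bloch a b p x (int n)))\<^sup>2) = real m * bloch_mass a b p x"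
proof (induction m)
  case (Suc m)
  have "(\<Sum>n=1..Suc m * p. (cmod (bloch a b p x (int n)))\<^sup>2)
     = (\<Sum>n=1..m * p. (cmod (bloch a b p x (int n)))\<^sup>2) + (\<Sum>n=m * p + 1..m * p + p. (cmod (bloch a b p x (int n)))\<^sup>2)"
    using sum.ub_add_nat[of 1 "m * p" "\<lambda>n. (cmod (bloch a b p x (int n)))\<^sup>2" p] by (simp add: add.commute)
  also have "(\<Sum>n=m * p + 1..m * p + p. (cmod (bloch a b p x (int n)))\<^sup>2)
     = (\<Sum>n=1..p. (cmod (bloch a b p x (int (n + m * p))))\<^sup>2)"
    using sum.shift_bounds_cl_nat_ivl[of "\<lambda>n. (cmod (bloch a b p x (int n)))\<^sup>2" 1 "m * p" p] by (simp add: add.commute)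
  also have "\<dots> = bloch_mass a b p x"
    unfolding bloch_mass_def
  proof (rule sum.cong[OF refl])
    fix n
    have "int (n + m * p) = int n + int m * int p" by simp
    then show "(cmod (bloch a b p x (int (n + m * p))))\<^sup>2 = (cmod (bloch a b p x (int n)))\<^sup>2"
      using bloch_mult_shift[OF x, of "int n" "int m"] by (simp add: norm_mult)
  qed
  finally show ?case unfolding Suc by (simp add: algebra_simps)
qed simp

text \<open>A Bloch wave cut off to m periods has squared norm m times its mass, while the cut-off
  error sits on at most four sites and does not grow with m.\<close>

lemma approximate_eigenvector:
  assumes x: "x \<in> bands a b p" and \<epsilon>: "\<epsilon> > 0"
  obtains \<psi> where "\<psi> \<in> l2" "l2_norm \<psi> > 0" "l2_norm (shifted (jacobi a b) (of_real x) \<psi>) \<le> \<epsilon> * l2_norm \<psi>"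
proof -
  let ?w = "bloch a b p x" and ?N = "bloch_mass a b p x"
  obtain A where A: "\<And>n. \<bar>a n\<bar> \<le> A" using bseq_ab(1) unfolding bseq_def by blast
  have A0: "A \<ge> 0" using order_trans[OF abs_ge_zero A] .
  have Np: "?N > 0" by (rule bloch_mass_pos[OF x])
  define K where "K = 2 * A * sqrt ?N"
  have wb: "cmod (?w n) \<le> sqrt ?N" for n using bloch_le_mass[OF x] by (simp add: real_le_rsqrt)
  obtain m :: nat where m: "real m > 4 * K\<^sup>2 / (\<epsilon>\<^sup>2 * ?N)" using reals_Archimedean2 by blast
  have m0: "m > 0"
  proof -
    have "0 \<le> 4 * K\<^sup>2 / (\<epsilon>\<^sup>2 * ?N)" using Np by simp
    then show ?thesis using m by (cases m) auto
  qed
  define q where "q = m * p"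
  have q: "q \<ge> 1" using m0 p_pos by (simp add: q_def)
  define \<psi> where "\<psi> n = (if n \<in> {1..int q} then ?w n else 0)" for n
  have fin: "(\<Sum>n\<in>{1..int q}. (cmod (\<psi> n))\<^sup>2) = (\<Sum>n=1..q. (cmod (?w (int n)))\<^sup>2)"
    by (rule sum.reindex_bij_witness[of _ int nat]) (auto simp: \<psi>_def)
  have s: "\<psi> \<in> l2" "(l2_norm \<psi>)\<^sup>2 = real m * ?N"
  proof -
    have supp: "\<psi> n = 0" if "n \<notin> {1..int q}" for n using that by (simp only: \<psi>_def if_False)
    show "\<psi> \<in> l2" by (rule l2_norm_finite_support(1)[OF finite_atLeastAtMost_int supp])
    have "(l2_norm \<psi>)\<^sup>2 = (\<Sum>n\<in>{1..int q}. (cmod (\<psi> n))\<^sup>2)"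
      by (rule l2_norm_finite_support(2)[OF finite_atLeastAtMost_int supp])
    then show "(l2_norm \<psi>)\<^sup>2 = real m * ?N" using fin bloch_mass_blocks[OF x, of m] by (simp only: q_def)
  qed
  define \<phi> where "\<phi> = shifted (jacobi a b) (of_real x) \<psi>"
  have wJ: "a (n - 1) * ?w (n - 1) + a n * ?w (n + 1) + b n * ?w n = of_real x * ?w n" for n
    using fun_cong[OF bloch_jacobi[OF x], of n] by (simp add: jacobi_def)
  have \<phi>0: "\<phi> n = 0" if "n \<notin> {0, 1, int q, int q + 1}" for n
  proof (cases "n \<in> {1..int q}")
    case True
    then have "\<psi> (n - 1) = ?w (n - 1)" "\<psi> n = ?w n" "\<psi> (n + 1) = ?w (n + 1)"
      using that by (auto simp: \<psi>_def)
    then show ?thesis using wJ[of n] by (simp add: \<phi>_def shifted_def jacobi_def)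
  next
    case False
    then have "\<psi> (n - 1) = 0" "\<psi> n = 0" "\<psi> (n + 1) = 0"
      using that by (auto simp: \<psi>_def)
    then show ?thesis by (simp add: \<phi>_def shifted_def jacobi_def)
  qed
  have \<phi>b: "cmod (\<phi> n) \<le> K" for n
  proof -
    have 1: "\<phi> n = a (n - 1) * (\<psi> (n - 1) - ?w (n - 1)) + a n * (\<psi> (n + 1) - ?w (n + 1))" if "n \<in> {1..int q}"
    proof -
      have "\<psi> n = ?w n" using that by (simp add: \<psi>_def)
      then show ?thesis using wJ[of n] by (simp add: \<phi>_def shifted_def jacobi_def algebra_simps)
    qed
    have 2: "\<phi> n = a (n - 1) * \<psi> (n - 1) + a n * \<psi> (n + 1)" if "n \<notin> {1..int q}"
    proof -
      have "\<psi> n = 0" using that by (simp only: \<psi>_def if_False)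
      then show ?thesis by (simp add: \<phi>_def shifted_def jacobi_def)
    qed
    have 3: "cmod (\<psi> n) \<le> sqrt ?N" "cmod (\<psi> n - ?w n) \<le> sqrt ?N" for n
      using wb[of n] Np by (auto simp: \<psi>_def)
    have 4: "cmod (a (n - 1) * u + a n * v) \<le> K" if "cmod u \<le> sqrt ?N" "cmod v \<le> sqrt ?N" for u v :: complex
    proof -
      have "cmod (a (n - 1) * u + a n * v) \<le> \<bar>a (n - 1)\<bar> * cmod u + \<bar>a n\<bar> * cmod v"
        using norm_triangle_ineq[of "a (n - 1) * u" "a n * v"] by (simp add: norm_mult)
      also have "\<dots> \<le> A * sqrt ?N + A * sqrt ?N"
        by (intro add_mono mult_mono A that A0) auto
      finally show ?thesis by (simp add: K_def)
    qed
    show ?thesis using 1 2 4[OF 3(2) 3(2)] 4[OF 3(1) 3(1)] by (cases "n \<in> {1..int q}") auto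
  qed
  have "(l2_norm \<phi>)\<^sup>2 = (\<Sum>n\<in>{0, 1, int q, int q + 1}. (cmod (\<phi> n))\<^sup>2)"
    by (rule l2_norm_finite_support(2)) (use \<phi>0 in auto)
  also have "\<dots> \<le> (\<Sum>n\<in>{0, 1, int q, int q + 1}. K\<^sup>2)"
    by (intro sum_mono power_mono \<phi>b) auto
  also have "\<dots> \<le> 4 * K\<^sup>2"
  proof -
    have "card {0, 1, int q, int q + 1} \<le> 4" by (auto simp: card_insert_if)
    then show ?thesis by (simp add: mult_right_mono)
  qed
  also have "\<dots> \<le> \<epsilon>\<^sup>2 * (real m * ?N)"
    using m Np \<epsilon> by (simp add: divide_less_eq mult_ac less_imp_le)
  also have "\<dots> = (\<epsilon> * l2_norm \<psi>)\<^sup>2" using s by (simp add: power_mult_distrib)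
  finally have "l2_norm \<phi> \<le> \<epsilon> * l2_norm \<psi>"
    by (rule power2_le_imp_le) (use \<epsilon> in simp)
  moreover have "l2_norm \<psi> > 0"
  proof -
    have "(l2_norm \<psi>)\<^sup>2 > 0" using s(2) m0 Np by simp
    then show ?thesis using l2_norm_nonneg[of \<psi>] by (cases "l2_norm \<psi> = 0") (auto simp: less_le)
  qed
  ultimately show thesis using that s(1) by (simp add: \<phi>_def)
qed

end

text \<open>Points of the bands of periodic operators near the given one are approximate eigenvalues,
  so they stay away from the resolvent set.\<close>

lemma resolvent_set_far_from_bands:
  assumes a: "bseq a" and b': "bseq b'" and y: "complex_of_real y \<in> resolvent_set (jacobi a b')"
  obtains \<delta> where "\<delta> > 0"
    "\<And>b p x r. periodic_jacobi a b p \<Longrightarrow> x \<in> bands a b p \<Longrightarrow> (\<And>n. \<bar>b' n - b n\<bar> \<le> r) \<Longrightarrow> \<delta> \<le> r + \<bar>x - y\<bar>"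
proof -
  obtain C where C: "\<And>\<psi>. \<psi> \<in> l2 \<Longrightarrow> l2_norm \<psi> \<le> C * l2_norm (shifted (jacobi a b') (of_real y) \<psi>)"
    using resolvent_set_bounded_below[OF y] by blast
  \<comment> \<open>The maximum with 1 makes the constant positive, so that 1 / (2 * C') can serve
    as the distance.\<close>
  define C' where "C' = max C 1"
  have C': "C' > 0" "l2_norm \<psi> \<le> C' * l2_norm (shifted (jacobi a b') (of_real y) \<psi>)" if "\<psi> \<in> l2" for \<psi>
    using C[OF that] mult_right_mono[of C C' "l2_norm (shifted (jacobi a b') (of_real y) \<psi>)"]
    by (auto simp: C'_def intro: order_trans)
  have z0: "(\<lambda>n. 0) \<in> l2" by (simp add: l2_def)
  have Cp: "C' > 0" by (rule C'(1)[OF z0])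
  have "1 / (2 * C') \<le> r + \<bar>x - y\<bar>"
    if P: "periodic_jacobi a b p" and x: "x \<in> bands a b p" and r: "\<And>n. \<bar>b' n - b n\<bar> \<le> r" for b p x r
  proof -
    interpret periodic_jacobi a b p by (rule P)
    obtain \<psi> where s: "\<psi> \<in> l2" "l2_norm \<psi> > 0"
      \<comment> \<open>Half of the lower bound is spent on the approximate eigenvector; the other
        half must be paid by the change of potential and energy.\<close>
      and e: "l2_norm (shifted (jacobi a b) (of_real x) \<psi>) \<le> 1 / (2 * C') * l2_norm \<psi>"
      using approximate_eigenvector[OF x, of "1 / (2 * C')"] Cp by auto
    have r0: "r \<ge> 0" using r[of 0] by linarith
    define V where "V n = complex_of_real (b' n - b n + (x - y)) * \<psi> n" for n
    have Vb: "cmod (V n) \<le> (r + \<bar>x - y\<bar>) * cmod (\<psi> n)" for n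
      unfolding V_def norm_mult norm_of_real
      by (intro mult_right_mono order_trans[OF abs_triangle_ineq] add_mono r) auto
    have V: "V \<in> l2" "l2_norm V \<le> (r + \<bar>x - y\<bar>) * l2_norm \<psi>"
      using l2_dominated[OF s(1) _ Vb] l2_norm_dominated[OF s(1) _ Vb] r0 by auto
    have S: "shifted (jacobi a b) (of_real x) \<psi> \<in> l2" by (rule shifted_jacobi_l2[OF bseq_ab s(1)])
    have "shifted (jacobi a b') (of_real y) \<psi> = (\<lambda>n. shifted (jacobi a b) (of_real x) \<psi> n + V n)"
      by (intro ext) (simp add: shifted_def jacobi_def V_def algebra_simps)
    then have "l2_norm (shifted (jacobi a b') (of_real y) \<psi>) \<le> 1 / (2 * C') * l2_norm \<psi> + (r + \<bar>x - y\<bar>) * l2_norm \<psi>"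
      using l2_norm_add[OF S V(1)] e V(2) by simp
    then have "l2_norm \<psi> \<le> C' * (1 / (2 * C') * l2_norm \<psi> + (r + \<bar>x - y\<bar>) * l2_norm \<psi>)"
      using C'(2)[OF s(1)] Cp by (meson mult_left_mono less_imp_le order_trans)
    also have "\<dots> = (1 / 2 + C' * (r + \<bar>x - y\<bar>)) * l2_norm \<psi>"
      using Cp by (simp add: field_simps)
    finally have "1 \<le> 1 / 2 + C' * (r + \<bar>x - y\<bar>)" using s(2) by (simp add: mult_le_cancel_right1)
    then show ?thesis using Cp by (simp add: divide_le_eq mult.commute)
  qed
  moreover have "1 / (2 * C') > 0" using Cp by simp
  ultimately show thesis using that by blast
qed

text \<open>\<open>per_kernel\<close> vanishes off the bands, so a real point at distance d from
  them satisfies the assumptions of \<open>kernel_off_spectrum\<close>, and its inverse tolerates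
  potentials changed by less than d.\<close>

lemma (in periodic_jacobi) spectrum_near_bands:
  assumes b': "bseq b'" and r: "\<And>n. \<bar>b' n - b n\<bar> \<le> r" "r < d"
    and far: "\<And>x. x \<in> bands a b p \<Longrightarrow> d \<le> \<bar>x - y\<bar>"
  shows "complex_of_real y \<in> resolvent_set (jacobi a b')"
proof -
  have "0 \<le> r" using r(1)[of 0] by linarith
  then have d: "d > 0" using r(2) by linarith
  interpret kernel_off_spectrum a b "per_kernel a b p" "of_real y" d
  proof
    show "bseq a" "bseq b" by (rule bseq_ab)+
    show "spectral_kernel a b (per_kernel a b p)" by (rule spectral_kernel_per_kernel)
    show "d > 0" by (rule d)
    show "AE t in lborel. \<forall>j k. per_kernel a b p j k t \<noteq> 0 \<longrightarrow> d \<le> cmod (complex_of_real t - complex_of_real y)"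
    proof (rule AE_I2, intro allI impI)
      fix t j k assume "per_kernel a b p j k t \<noteq> 0"
      then have "t \<in> bands a b p" by (auto simp: per_kernel_def split: if_splits)
      from far[OF this] show "d \<le> cmod (complex_of_real t - complex_of_real y)"
        by (metis norm_of_real of_real_diff)
    qed
  qed
  show ?thesis by (rule resolvent_set_perturb[OF b' r])
qed

text \<open>Otherwise x would lie in the resolvent set of the second operator by perturbation,
  although it belongs to that operator's own bands.\<close>

lemma bands_near_bands:
  assumes P: "periodic_jacobi a b p" and P': "periodic_jacobi a b' p'"
    and x: "x \<in> bands a b' p'" and r: "\<And>n. \<bar>b' n - b n\<bar> \<le> r" "r < d"
  obtains y where "y \<in> bands a b p" "\<bar>x - y\<bar> < d"
proof (rule ccontr)
  assume "\<not> thesis"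
  then have far: "d \<le> \<bar>y - x\<bar>" if "y \<in> bands a b p" for y
    using that \<open>\<And>y. y \<in> bands a b p \<Longrightarrow> \<bar>x - y\<bar> < d \<Longrightarrow> thesis\<close> by (metis abs_minus_commute not_le)
  interpret P': periodic_jacobi a b' p' by (rule P')
  have "complex_of_real x \<in> resolvent_set (jacobi a b')"
    by (rule periodic_jacobi.spectrum_near_bands[OF P P'.bseq_ab(2) r far])
  from resolvent_set_far_from_bands[OF P'.bseq_ab this]
  obtain \<delta> where "\<delta> > 0" "\<And>b p x' r. periodic_jacobi a b p \<Longrightarrow> x' \<in> bands a b p \<Longrightarrow> (\<And>n. \<bar>b' n - b n\<bar> \<le> r) \<Longrightarrow> \<delta> \<le> r + \<bar>x' - x\<bar>"
    by blast
  \<comment> \<open>The operator is compared with itself at the point x itself, so both error terms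
    are 0.\<close>
  from this(1) this(2)[OF P' x, of 0] show False by simp
qed

section \<open>One-site periodic perturbations\<close>

definition pert :: "(int \<Rightarrow> real) \<Rightarrow> nat \<Rightarrow> real \<Rightarrow> int \<Rightarrow> real" where
  "pert b p t n = b n + (if int p dvd n then t else 0)"

lemma pert_0 [simp]: "pert b p 0 = b"
  by (rule ext) (simp add: pert_def)

lemma pert_diff: "\<bar>pert b p t n - b n\<bar> \<le> \<bar>t\<bar>"
  by (simp add: pert_def)

context periodic_jacobi
begin

lemma periodic_pert: "periodic_jacobi a (pert b p t) p"
  using p_pos a_pos a_per b_per by unfold_locales (auto simp: pert_def)

text \<open>Up to index p the recursion reads the potential only at the sites 1 to p - 1, none of
  them a multiple of p. The altered site p enters first in the step to p + 1.\<close>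

lemma sol_pert:
  fixes z :: "'a::real_field"
  shows "n \<le> p \<Longrightarrow> sol a (pert b p t) z \<alpha> \<beta> n = sol a b z \<alpha> \<beta> n"
proof (induction n rule: nat_two_step_induct)
  case (Suc n)
  then have "\<not> p dvd Suc n" by (auto dest: dvd_imp_le)
  then have "pert b p t (int (Suc n)) = b (int (Suc n))" unfolding pert_def int_dvd_int_iff by simp
  then show ?case using Suc unfolding sol.simps by simp
qed auto

lemma sol_pert_Suc:
  fixes z :: "'a::real_field"
  shows "sol a (pert b p t) z \<alpha> \<beta> (Suc p) = sol a b z \<alpha> \<beta> (Suc p) - of_real (t / a 0) * sol a b z \<alpha> \<beta> p"
proof -
  obtain m where m: "p = Suc m" using p_pos by (cases p) auto
  have "pert b p t (int p) = b (int p) + t" by (simp add: pert_def)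
  moreover have "a (int p) = a 0" using a_per[of 0] by simp
  ultimately show ?thesis
    using sol_pert[of p t z \<alpha> \<beta>] sol_pert[of m t z \<alpha> \<beta>]
    unfolding m sol.simps by (simp add: m algebra_simps diff_divide_distrib add_divide_distrib del: of_nat_Suc)
qed

lemma discr_pert: "discr a (pert b p t) p x = discr a b p x - of_real (t / a 0) * sol a b x 0 1 p"
  unfolding discr_def sol_pert_Suc by (simp add: sol_pert)

text \<open>The initial data vary too, since the components of the Bloch vector depend on the
  perturbation through the quasimomentum.\<close>

lemma sol_pert_tendsto:
  fixes z :: "'a::real_normed_field"
  assumes t: "t \<longlonglongrightarrow> 0" and \<alpha>: "\<alpha> \<longlonglongrightarrow> \<alpha>'" and \<beta>: "\<beta> \<longlonglongrightarrow> \<beta>'"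
  shows "(\<lambda>m. sol a (pert b p (t m)) z (\<alpha> m) (\<beta> m) n) \<longlonglongrightarrow> sol a b z \<alpha>' \<beta>' n"
proof (induction n rule: nat_two_step_induct)
  case (Suc n)
  have "(\<lambda>m. pert b p (t m) k) \<longlonglongrightarrow> b k" for k
    unfolding pert_def using t by (cases "int p dvd k") (auto intro!: tendsto_eq_intros)
  then show ?case unfolding sol.simps
    by (intro tendsto_intros Suc) (use a_nz in auto)
qed (use assms in simp_all)

lemma discr_pert_tendsto:
  "t \<longlonglongrightarrow> 0 \<Longrightarrow> (\<lambda>m. discr a (pert b p (t m)) p x) \<longlonglongrightarrow> (discr a b p x :: real)"
  unfolding discr_pert by (auto intro!: tendsto_eq_intros) (use a_pos[of 0] in auto)

lemma bands_pert_eventually: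
  assumes t: "t \<longlonglongrightarrow> 0"
  shows "x \<in> bands a b p \<Longrightarrow> \<forall>\<^sub>F m in sequentially. x \<in> bands a (pert b p (t m)) p"
    and "2 < \<bar>discr a b p x\<bar> \<Longrightarrow> \<forall>\<^sub>F m in sequentially. 2 < \<bar>discr a (pert b p (t m)) p x\<bar>"
proof -
  have l: "(\<lambda>m. \<bar>discr a (pert b p (t m)) p x\<bar>) \<longlonglongrightarrow> \<bar>discr a b p x\<bar>"
    by (intro tendsto_intros discr_pert_tendsto t)
  show "x \<in> bands a b p \<Longrightarrow> \<forall>\<^sub>F m in sequentially. x \<in> bands a (pert b p (t m)) p"
    unfolding bands_def using order_tendstoD(2)[OF l, of 2] by simp
  show "2 < \<bar>discr a b p x\<bar> \<Longrightarrow> \<forall>\<^sub>F m in sequentially. 2 < \<bar>discr a (pert b p (t m)) p x\<bar>"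
    using order_tendstoD(1)[OF l, of 2] by simp
qed

text \<open>Away from discriminant \<plusminus>2, membership in the bands is eventually constant and
  the formula for the kernel depends continuously on t.\<close>

lemma per_kernel_pert_tendsto:
  assumes t: "t \<longlonglongrightarrow> 0" and x: "\<bar>discr a b p x\<bar> \<noteq> 2"
  shows "(\<lambda>m. per_kernel a (pert b p (t m)) p j k x) \<longlonglongrightarrow> per_kernel a b p j k x"
proof (cases "x \<in> bands a b p")
  case False
  then have "2 < \<bar>discr a b p x\<bar>" using x by (simp add: bands_def)
  from bands_pert_eventually(2)[OF t this]
  have "\<forall>\<^sub>F m in sequentially. per_kernel a b p j k x = per_kernel a (pert b p (t m)) p j k x"
    by eventually_elim (use False in \<open>simp add: per_kernel_def bands_def\<close>)
  then show ?thesis by (rule Lim_transform_eventually[OF tendsto_const])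
next
  case True
  let ?q = "\<lambda>m. quasimom a (pert b p (t m)) p x"
  have c: "isCont arccos (discr a b p x / 2)"
    by (rule isCont_arccos) (use True in \<open>auto simp: bands_def\<close>)
  have q: "?q \<longlonglongrightarrow> quasimom a b p x"
    unfolding quasimom_def
    by (rule isCont_tendsto_compose[OF c]) (intro tendsto_intros discr_pert_tendsto t, simp)
  have cq: "(\<lambda>m. cis (?q m)) \<longlonglongrightarrow> cis (quasimom a b p x)"
    unfolding cis_conv_exp by (intro tendsto_intros q)
  have w: "(\<lambda>m. bloch a (pert b p (t m)) p x n) \<longlonglongrightarrow> bloch a b p x n" for n
    unfolding bloch_def bloch_ext_def
    by (intro tendsto_intros sol_pert_tendsto t cq) (simp_all add: sol_pert)
  have "(\<lambda>m. Re (bloch a (pert b p (t m)) p x j * cnj (bloch a (pert b p (t m)) p x k))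
       / (2 * pi * a 0 * \<bar>Im (bloch a (pert b p (t m)) p x 1 * cnj (bloch a (pert b p (t m)) p x 0))\<bar>))
     \<longlonglongrightarrow> Re (bloch a b p x j * cnj (bloch a b p x k)) / (2 * pi * a 0 * \<bar>Im (bloch a b p x 1 * cnj (bloch a b p x 0))\<bar>)"
  proof (intro tendsto_intros w)
    show "2 * pi * a 0 * \<bar>Im (bloch a b p x 1 * cnj (bloch a b p x 0))\<bar> \<noteq> 0"
      using Im_bloch[OF True] quasimom(2)[OF True] sol_nonzero[OF True] a_pos[of 0] by simp
  qed
  then have "(\<lambda>m. Re (bloch a (pert b p (t m)) p x j * cnj (bloch a (pert b p (t m)) p x k))
       / (2 * pi * a 0 * \<bar>Im (bloch a (pert b p (t m)) p x 1 * cnj (bloch a (pert b p (t m)) p x 0))\<bar>))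
     \<longlonglongrightarrow> per_kernel a b p j k x" using True by (simp add: per_kernel_def)
  then show ?thesis
    by (rule Lim_transform_eventually)
      (use bands_pert_eventually(1)[OF t True] in eventually_elim, simp add: per_kernel_def)
qed

text \<open>Scheffe's lemma needs nonnegative functions, which off-diagonal entries are not. By
  positivity, the sum of the two diagonal entries plus or minus twice the off-diagonal one is
  nonnegative and has an integral independent of t; the entry itself is recovered by
  polarisation.\<close>

lemma per_kernel_pert_L1:
  assumes t: "t \<longlonglongrightarrow> 0"
  shows "(\<lambda>m. \<integral>x. \<bar>per_kernel a (pert b p (t m)) p j k x - per_kernel a b p j k x\<bar> \<partial>lborel) \<longlonglongrightarrow> 0"
proof -
  define f where "f m = per_kernel a (pert b p (t m)) p" for m
  define g where "g = per_kernel a b p"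
  have kf: "spectral_kernel a (pert b p (t m)) (f m)" for m
    unfolding f_def by (rule periodic_jacobi.spectral_kernel_per_kernel[OF periodic_pert])
  have kg: "spectral_kernel a b g" unfolding g_def by (rule spectral_kernel_per_kernel)
  have intf: "integrable lborel (f m j k)" for m j k using kf by (simp add: spectral_kernel_def)
  have intg: "integrable lborel (g j k)" for j k using kg by (simp add: spectral_kernel_def)
  have "finite ({x::real. discr a b p x = 2} \<union> {x. discr a b p x = -2})" using finite_discr_level by blast
  then have "AE x in lborel. x \<notin> {x::real. discr a b p x = 2} \<union> {x. discr a b p x = -2}"
    by (intro AE_not_in finite_imp_null_set_lborel)
  then have lim: "AE x in lborel. (\<lambda>m. f m j k x) \<longlonglongrightarrow> g j k x" for j k
    unfolding f_def g_def by eventually_elim (rule per_kernel_pert_tendsto[OF t], auto)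
  have Q: "(\<lambda>m. \<integral>x. \<bar>(f m j j x + f m k k x + 2 * u * f m j k x) - (g j j x + g k k x + 2 * u * g j k x)\<bar> \<partial>lborel) \<longlonglongrightarrow> 0"
    if u: "\<bar>u\<bar> = 1" for u
  proof -
    define F where "F m x = f m j j x + f m k k x + 2 * u * f m j k x" for m x
    define G where "G x = g j j x + g k k x + 2 * u * g j k x" for x
    have iF: "integrable lborel (F m)" for m
      unfolding F_def by (intro Bochner_Integration.integrable_add integrable_mult_right intf)
    have iG: "integrable lborel G"
      unfolding G_def by (intro Bochner_Integration.integrable_add integrable_mult_right intg)
    have pos: "0 \<le> M j j + M k k + 2 * u * M j k" if "psd M" for M
    proof -
      have s: "M j k = M k j" using that by (simp add: psd_def)
      have P: "0 \<le> (\<Sum>i\<in>H. \<Sum>l\<in>H. c i * c l * M i l)" if "finite H" for H c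
        using \<open>psd M\<close> that unfolding psd_def by blast
      show ?thesis
      proof (cases "j = k")
        case True
        then show ?thesis using P[of "{j}" "\<lambda>_. 1"] u by (auto simp: abs_if split: if_splits)
      next
        case False
        have "u = 1 \<or> u = -1" using u by (auto simp: abs_if split: if_splits)
        then show ?thesis using P[of "{j, k}" "\<lambda>i. if i = j then 1 else u"] False s
          by (auto simp: algebra_simps)
      qed
    qed
    have psdf: "psd (\<lambda>j k. f m j k x)" for m x
      unfolding f_def by (rule periodic_jacobi.psd_per_kernel[OF periodic_pert])
    have psdg: "psd (\<lambda>j k. g j k x)" for x
      unfolding g_def by (rule psd_per_kernel)
    have F0: "0 \<le> F m x" for m x unfolding F_def using pos[OF psdf[of m x]] .
    have G0: "0 \<le> G x" for x unfolding G_def using pos[OF psdg[of x]] .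
    have eF: "(\<integral>x. f m j k x \<partial>lborel) = (if j = k then 1 else 0)" for m j k
      using kf by (simp add: spectral_kernel_def)
    have eG: "(\<integral>x. g j k x \<partial>lborel) = (if j = k then 1 else 0)" for j k
      using kg by (simp add: spectral_kernel_def)
    have IF: "(\<integral>x. F m x \<partial>lborel) = 2 + 2 * u * (if j = k then 1 else 0)" for m
      unfolding F_def
      by (subst Bochner_Integration.integral_add, intro Bochner_Integration.integrable_add intf, intro integrable_mult_right intf,
          subst Bochner_Integration.integral_add, rule intf, rule intf) (simp add: eF)
    have IG: "(\<integral>x. G x \<partial>lborel) = 2 + 2 * u * (if j = k then 1 else 0)"
      unfolding G_def
      by (subst Bochner_Integration.integral_add, intro Bochner_Integration.integrable_add intg, intro integrable_mult_right intg,
          subst Bochner_Integration.integral_add, rule intg, rule intg) (simp add: eG)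
    have nF: "(\<integral>\<^sup>+x. norm (F m x) \<partial>lborel) = ennreal (\<integral>x. F m x \<partial>lborel)" for m
      using nn_integral_eq_integral[OF iF] F0 by simp
    have nG: "(\<integral>\<^sup>+x. norm (G x) \<partial>lborel) = ennreal (\<integral>x. G x \<partial>lborel)"
      using nn_integral_eq_integral[OF iG] G0 by simp
    have "(\<lambda>m. \<integral>\<^sup>+x. norm (F m x - G x) \<partial>lborel) \<longlonglongrightarrow> 0"
    proof (rule Scheffe_lemma2)
      show "F m \<in> borel_measurable lborel" for m using iF by blast
      show "integrable lborel G" by (rule iG)
      show "AE x in lborel. (\<lambda>m. F m x) \<longlonglongrightarrow> G x"
        using lim[of j j] lim[of k k] lim[of j k]
        by eventually_elim (auto simp: F_def G_def intro!: tendsto_intros)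
      show "(\<integral>\<^sup>+x. norm (F m x) \<partial>lborel) \<le> (\<integral>\<^sup>+x. norm (G x) \<partial>lborel)" for m
        unfolding nF nG IF IG by simp
    qed
    moreover have "(\<integral>\<^sup>+x. norm (F m x - G x) \<partial>lborel) = ennreal (\<integral>x. \<bar>F m x - G x\<bar> \<partial>lborel)" for m
      using nn_integral_eq_integral[of lborel "\<lambda>x. \<bar>F m x - G x\<bar>"] iF iG by simp
    ultimately have "(\<lambda>m. ennreal (\<integral>x. \<bar>F m x - G x\<bar> \<partial>lborel)) \<longlonglongrightarrow> ennreal 0" by simp
    then have "(\<lambda>m. \<integral>x. \<bar>F m x - G x\<bar> \<partial>lborel) \<longlonglongrightarrow> 0"
      by (subst (asm) tendsto_ennreal_iff) auto
    then show ?thesis unfolding F_def G_def .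
  qed
  have "(\<lambda>m. ((\<integral>x. \<bar>(f m j j x + f m k k x + 2 * 1 * f m j k x) - (g j j x + g k k x + 2 * 1 * g j k x)\<bar> \<partial>lborel)
     + (\<integral>x. \<bar>(f m j j x + f m k k x + 2 * (-1) * f m j k x) - (g j j x + g k k x + 2 * (-1) * g j k x)\<bar> \<partial>lborel)) / 4) \<longlonglongrightarrow> (0 + 0) / 4"
    (is "?R \<longlonglongrightarrow> _")
    by (intro tendsto_intros Q) auto
  then have R: "?R \<longlonglongrightarrow> 0" by simp
  show ?thesis
    unfolding f_def[symmetric] g_def[symmetric]
  proof (rule tendsto_sandwich[OF _ _ tendsto_const R])
    show "\<forall>\<^sub>F m in sequentially. 0 \<le> (\<integral>x. \<bar>f m j k x - g j k x\<bar> \<partial>lborel)" by simp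
    show "\<forall>\<^sub>F m in sequentially. (\<integral>x. \<bar>f m j k x - g j k x\<bar> \<partial>lborel) \<le> ?R m"
    proof (rule always_eventually, rule allI)
      fix m
      have i: "integrable lborel (\<lambda>x. \<bar>(f m j j x + f m k k x + 2 * u * f m j k x) - (g j j x + g k k x + 2 * u * g j k x)\<bar>)" for u
        by (intro integrable_abs Bochner_Integration.integrable_diff Bochner_Integration.integrable_add integrable_mult_right intf intg)
      have abs4: "\<bar>u\<bar> \<le> (\<bar>A\<bar> + \<bar>B\<bar>) / 4" if "4 * u = A - B" for u A B :: real
        using abs_triangle_ineq4[of A B] unfolding that[symmetric] by (simp add: abs_mult)
      have "(\<integral>x. \<bar>f m j k x - g j k x\<bar> \<partial>lborel)
         \<le> (\<integral>x. (\<bar>(f m j j x + f m k k x + 2 * 1 * f m j k x) - (g j j x + g k k x + 2 * 1 * g j k x)\<bar>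
            + \<bar>(f m j j x + f m k k x + 2 * (-1) * f m j k x) - (g j j x + g k k x + 2 * (-1) * g j k x)\<bar>) / 4 \<partial>lborel)"
        by (rule integral_mono, intro integrable_abs Bochner_Integration.integrable_diff intf intg,
            intro integrable_divide Bochner_Integration.integrable_add i, rule abs4) (simp add: algebra_simps)
      also have "\<dots> = ?R m"
        by (subst integral_divide_zero, subst Bochner_Integration.integral_add[OF i i]) (rule refl)
      finally show "(\<integral>x. \<bar>f m j k x - g j k x\<bar> \<partial>lborel) \<le> ?R m" .
    qed
  qed
qed

end

text \<open>Homogeneity with the scale exposed, and for sets that need not be closed, so that one
  \<open>\<delta>\<^sub>0\<close> can be carried through all open band sets.\<close>

definition thick :: "real \<Rightarrow> real \<Rightarrow> real set \<Rightarrow> bool" where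
  "thick \<tau> \<delta>\<^sub>0 U \<longleftrightarrow> (\<forall>x\<in>U. \<forall>\<delta>. 0 < \<delta> \<and> \<delta> \<le> \<delta>\<^sub>0 \<longrightarrow> \<tau> * \<delta> \<le> measure lebesgue ({x - \<delta><..<x + \<delta>} \<inter> U))"

lemma lmeasurable_Ioo_Int_open: "open U \<Longrightarrow> {c<..<d::real} \<inter> U \<in> lmeasurable"
  by (rule lmeasurable_open) (auto intro: bounded_subset[of "{c..d}"])

text \<open>Clipping the window around x to the interval leaves the whole interval, or a half window
  on at least one side of x; either has length at least \<delta>. This is the source of the constant
  1.\<close>

lemma interval_thick:
  fixes x :: real
  assumes U: "open U" and I: "\<alpha> < x" "x < \<beta>" "{\<alpha><..<\<beta>} \<subseteq> U" and \<delta>: "0 < \<delta>" "\<delta> \<le> \<beta> - \<alpha>"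
  shows "\<delta> \<le> measure lebesgue ({x - \<delta><..<x + \<delta>} \<inter> U)"
proof -
  define l where "l = max \<alpha> (x - \<delta>)"
  define u where "u = min \<beta> (x + \<delta>)"
  have lu: "l \<le> u" "\<delta> \<le> u - l" using I \<delta> by (auto simp: l_def u_def)
  then have "\<delta> \<le> measure lebesgue {l<..<u}" by simp
  also have "\<dots> \<le> measure lebesgue ({x - \<delta><..<x + \<delta>} \<inter> U)"
    by (rule measure_mono_fmeasurable[OF _ _ lmeasurable_Ioo_Int_open[OF U]]) (use I in \<open>auto simp: l_def u_def\<close>)
  finally show ?thesis .
qed

section \<open>Uniform band lengths and stability of thickness\<close>

context periodic_jacobi
begin

lemma discr'_pert_bounded:
  obtains C where "C > 0" "\<And>t x. \<bar>t\<bar> \<le> 1 \<Longrightarrow> \<bar>x\<bar> \<le> R \<Longrightarrow> \<bar>discr' a (pert b p t) p x\<bar> \<le> C"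
proof -
  obtain S' where S': "\<And>x. ((\<lambda>x. sol a b x 0 1 p) has_real_derivative S' x) (at x)" "continuous_on UNIV S'"
    using sol_DERIV[of a b 0 1 p] by blast
  have e: "discr' a (pert b p t) p x = discr' a b p x - t / a 0 * S' x" for t x
  proof -
    have "((\<lambda>x. discr a b p x - t / a 0 * sol a b x 0 1 p) has_real_derivative discr' a b p x - t / a 0 * S' x) (at x)"
      by (intro DERIV_diff DERIV_cmult has_derivative_discr S')
    moreover have "(\<lambda>x. discr a b p x - t / a 0 * sol a b x 0 1 p) = discr a (pert b p t) p"
      by (intro ext) (simp add: discr_pert)
    ultimately show ?thesis using DERIV_unique[OF has_derivative_discr] by metis
  qed
  have "bounded (discr' a b p ` {-R..R})" "bounded (S' ` {-R..R})"
    by (intro compact_imp_bounded compact_continuous_image continuous_discr' continuous_on_subset[OF S'(2)]; simp)+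
  then obtain C1 C2 where C: "\<And>x. x \<in> {-R..R} \<Longrightarrow> \<bar>discr' a b p x\<bar> \<le> C1" "\<And>x. x \<in> {-R..R} \<Longrightarrow> \<bar>S' x\<bar> \<le> C2"
    unfolding bounded_iff ball_simps real_norm_def by blast
  define C where "C = \<bar>C1\<bar> + 1 / a 0 * \<bar>C2\<bar> + 1"
  have a0: "a 0 > 0" by (rule a_pos)
  have "\<bar>discr' a (pert b p t) p x\<bar> \<le> C" if "\<bar>t\<bar> \<le> 1" "\<bar>x\<bar> \<le> R" for t x
  proof -
    have x: "x \<in> {-R..R}" using that by auto
    have "\<bar>t / a 0 * S' x\<bar> = \<bar>t\<bar> / a 0 * \<bar>S' x\<bar>" using a0 by (simp add: abs_mult)
    also have "\<dots> \<le> 1 / a 0 * \<bar>C2\<bar>"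
      using that a0 C(2)[OF x] by (intro mult_mono divide_right_mono) auto
    finally show ?thesis unfolding e C_def using C(1)[OF x] by linarith
  qed
  moreover have "C > 0" unfolding C_def using a0 by (simp add: add_nonneg_pos)
  ultimately show thesis using that by blast
qed

text \<open>Across a band the discriminant changes by 4, so by the mean value theorem the length is
  at least 4 over the maximal slope. The slope is affine in t, hence bounded for \<bar>t\<bar> \<le>
  1.\<close>

lemma band_length:
  obtains l where "l > 0"
    "\<And>t x. \<bar>t\<bar> \<le> 1 \<Longrightarrow> x \<in> bands a (pert b p t) p \<Longrightarrow>
       \<exists>\<alpha> \<beta>. \<alpha> < x \<and> x < \<beta> \<and> {\<alpha><..<\<beta>} \<subseteq> bands a (pert b p t) p \<and> l \<le> \<beta> - \<alpha>"
proof -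
  obtain A where A: "\<And>n. \<bar>a n\<bar> \<le> A" using bseq_ab(1) unfolding bseq_def by blast
  obtain B where B: "\<And>n. \<bar>b n\<bar> \<le> B" using bseq_ab(2) unfolding bseq_def by blast
  define R where "R = 2 * A + (B + 1)"
  obtain C where C: "C > 0" "\<And>t x. \<bar>t\<bar> \<le> 1 \<Longrightarrow> \<bar>x\<bar> \<le> R \<Longrightarrow> \<bar>discr' a (pert b p t) p x\<bar> \<le> C"
    using discr'_pert_bounded[of R] by blast
  have "\<exists>\<alpha> \<beta>. \<alpha> < x \<and> x < \<beta> \<and> {\<alpha><..<\<beta>} \<subseteq> bands a (pert b p t) p \<and> 4 / C \<le> \<beta> - \<alpha>"
    if t: "\<bar>t\<bar> \<le> 1" and x: "x \<in> bands a (pert b p t) p" for t x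
  proof -
    let ?D = "discr a (pert b p t) p :: real \<Rightarrow> real"
    interpret q: periodic_jacobi a "pert b p t" p by (rule periodic_pert)
    obtain \<alpha> \<beta> where I: "\<alpha> < x" "x < \<beta>" "{\<alpha><..<\<beta>} \<subseteq> bands a (pert b p t) p"
      "\<bar>?D \<alpha>\<bar> = 2" "?D \<beta> = - ?D \<alpha>" by (rule q.band_interval[OF x])
    have "\<alpha> < \<beta>" using I by simp
    from MVT2[OF this, of ?D "discr' a (pert b p t) p"] has_derivative_discr
    obtain z where z: "\<alpha> < z" "z < \<beta>" "?D \<beta> - ?D \<alpha> = (\<beta> - \<alpha>) * discr' a (pert b p t) p z" by blast
    have zb: "z \<in> bands a (pert b p t) p" using I(3) z by auto
    have pb: "\<bar>pert b p t n\<bar> \<le> B + 1" for n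
      using pert_diff[of b p t n] B[of n] t by linarith
    have "\<bar>z\<bar> \<le> R" unfolding R_def by (rule q.bands_bounded[OF zb A pb])
    then have "\<bar>discr' a (pert b p t) p z\<bar> \<le> C" by (rule C(2)[OF t])
    have "4 = \<bar>?D \<beta> - ?D \<alpha>\<bar>" using I(4,5) by linarith
    also have "\<dots> = (\<beta> - \<alpha>) * \<bar>discr' a (pert b p t) p z\<bar>" unfolding z(3) using \<open>\<alpha> < \<beta>\<close> by (simp add: abs_mult)
    also have "\<dots> \<le> (\<beta> - \<alpha>) * C" using \<open>\<alpha> < \<beta>\<close> \<open>\<bar>discr' a (pert b p t) p z\<bar> \<le> C\<close> by (intro mult_left_mono) auto
    finally have "4 / C \<le> \<beta> - \<alpha>" using C(1) by (simp add: divide_le_eq)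
    then show ?thesis using I by blast
  qed
  moreover have "4 / C > 0" using C by simp
  ultimately show thesis using that by blast
qed

lemma bands_thick:
  obtains \<delta>\<^sub>0 where "\<delta>\<^sub>0 > 0" "thick 1 \<delta>\<^sub>0 (bands a b p)"
proof -
  obtain l where l: "l > 0" "\<And>t x. \<bar>t\<bar> \<le> 1 \<Longrightarrow> x \<in> bands a (pert b p t) p \<Longrightarrow>
       \<exists>\<alpha> \<beta>. \<alpha> < x \<and> x < \<beta> \<and> {\<alpha><..<\<beta>} \<subseteq> bands a (pert b p t) p \<and> l \<le> \<beta> - \<alpha>"
    using band_length by blast
  have "thick 1 l (bands a b p)"
    unfolding thick_def
  proof (intro ballI allI impI)
    fix x \<delta> assume x: "x \<in> bands a b p" and d: "0 < \<delta> \<and> \<delta> \<le> l"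
    obtain \<alpha> \<beta> where I: "\<alpha> < x" "x < \<beta>" "{\<alpha><..<\<beta>} \<subseteq> bands a b p" "l \<le> \<beta> - \<alpha>"
      using l(2)[of 0 x] x by auto
    show "1 * \<delta> \<le> measure lebesgue ({x - \<delta><..<x + \<delta>} \<inter> bands a b p)"
      using interval_thick[OF open_bands I(1-3), of \<delta>] d I(4) by simp
  qed
  then show thesis using that l(1) by blast
qed

lemma bounded_bands: "bounded (bands a b p)"
proof -
  obtain A where A: "\<And>n. \<bar>a n\<bar> \<le> A" using bseq_ab(1) unfolding bseq_def by blast
  obtain B where B: "\<And>n. \<bar>b n\<bar> \<le> B" using bseq_ab(2) unfolding bseq_def by blast
  show ?thesis using bands_bounded[OF _ A B] by (intro boundedI[of _ "2 * A + B"]) auto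
qed

lemma bands_lmeasurable: "bands a b p \<in> lmeasurable"
  by (rule lmeasurable_open[OF bounded_bands open_bands])

text \<open>Each point of the open set \<open>bands a b p\<close> belongs to the perturbed bands
  eventually; dominated convergence does the rest.\<close>

lemma measure_lost_bands:
  assumes t: "t \<longlonglongrightarrow> 0"
  shows "(\<lambda>m. measure lebesgue (bands a b p - bands a (pert b p (t m)) p)) \<longlonglongrightarrow> 0"
proof -
  define E where "E m = bands a b p - bands a (pert b p (t m)) p" for m
  have mE: "E m \<in> sets lebesgue" for m
    unfolding E_def using open_bands by (intro sets.Diff) (auto intro: borel_open)
  have "(\<lambda>m. \<integral>x. indicator (E m) x \<partial>lebesgue :: real) \<longlonglongrightarrow> integral\<^sup>L lebesgue (\<lambda>x::real. 0)"
  proof (rule integral_dominated_convergence[where w = "\<lambda>x. indicator (bands a b p) x"])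
    show "integrable lebesgue (indicator (bands a b p) :: real \<Rightarrow> real)"
      using bands_lmeasurable by (intro integrable_real_indicator) (auto simp: fmeasurable_def)
    show "indicator (E m) \<in> borel_measurable lebesgue" for m using mE by simp
    show "AE x in lebesgue. (\<lambda>m. indicator (E m) x :: real) \<longlonglongrightarrow> 0"
    proof (rule AE_I2)
      fix x
      show "(\<lambda>m. indicator (E m) x :: real) \<longlonglongrightarrow> 0"
      proof (cases "x \<in> bands a b p")
        case True
        have "\<forall>\<^sub>F m in sequentially. 0 = (indicator (E m) x :: real)"
          using bands_pert_eventually(1)[OF t True] by eventually_elim (simp add: E_def)
        then show ?thesis by (rule Lim_transform_eventually[OF tendsto_const])
      qed (simp add: E_def)
    qed
    show "AE x in lebesgue. norm (indicator (E m) x :: real) \<le> indicator (bands a b p) x" for m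
      by (rule AE_I2) (auto simp: E_def indicator_def)
  qed simp
  then show ?thesis unfolding E_def[symmetric] using mE by simp
qed

text \<open>At scales up to the uniform band length l, one band alone gives the constant 1. At
  larger scales a nearby old band point is used, and the fixed error is absorbed by (\<tau> -
  \<tau>') * l.\<close>

lemma thick_pert:
  assumes U: "thick \<tau> \<delta>\<^sub>0 (bands a b p)" and \<tau>: "0 < \<tau>'" "\<tau>' < \<tau>" "\<tau> \<le> 1"
    and t: "t \<longlonglongrightarrow> 0" "\<And>m. 0 \<le> t m"
  shows "\<forall>\<^sub>F m in sequentially. thick \<tau>' \<delta>\<^sub>0 (bands a (pert b p (t m)) p)"
proof -
  obtain l where l: "l > 0" "\<And>t x. \<bar>t\<bar> \<le> 1 \<Longrightarrow> x \<in> bands a (pert b p t) p \<Longrightarrow>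
       \<exists>\<alpha> \<beta>. \<alpha> < x \<and> x < \<beta> \<and> {\<alpha><..<\<beta>} \<subseteq> bands a (pert b p t) p \<and> l \<le> \<beta> - \<alpha>"
    using band_length by blast
  \<comment> \<open>At large scales three errors of size at most d occur: the lost measure and two
    strips of width d from recentring the window. The factor 1/4 keeps their sum below (\<tau> -
    \<tau>') * l.\<close>
  define d where "d = (\<tau> - \<tau>') * l / 4"
  have d: "d > 0" using l \<tau> by (simp add: d_def)
  have "\<forall>\<^sub>F m in sequentially. t m < min d 1" by (rule order_tendstoD(2)[OF t(1)]) (use d in simp)
  moreover have "\<forall>\<^sub>F m in sequentially. measure lebesgue (bands a b p - bands a (pert b p (t m)) p) < d"
    by (rule order_tendstoD(2)[OF measure_lost_bands[OF t(1)] d])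
  ultimately show ?thesis
  proof eventually_elim
    case (elim m)
    let ?V = "bands a (pert b p (t m)) p" and ?U = "bands a b p"
    have t1: "\<bar>t m\<bar> \<le> 1" "t m < d" using elim t(2)[of m] by auto
    show ?case
      unfolding thick_def
    proof (intro ballI allI impI)
      fix x \<delta> assume x: "x \<in> ?V" and \<delta>: "0 < \<delta> \<and> \<delta> \<le> \<delta>\<^sub>0"
      show "\<tau>' * \<delta> \<le> measure lebesgue ({x - \<delta><..<x + \<delta>} \<inter> ?V)"
      proof (cases "\<delta> \<le> l")
        case True
        obtain \<alpha> \<beta> where I: "\<alpha> < x" "x < \<beta>" "{\<alpha><..<\<beta>} \<subseteq> ?V" "l \<le> \<beta> - \<alpha>"
          using l(2)[OF t1(1) x] by blast
        have "\<tau>' * \<delta> \<le> 1 * \<delta>" using \<tau> \<delta> by (intro mult_right_mono) auto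
        also have "1 * \<delta> \<le> measure lebesgue ({x - \<delta><..<x + \<delta>} \<inter> ?V)"
          using interval_thick[OF open_bands I(1-3), of \<delta>] True \<delta> I(4) by simp
        finally show ?thesis .
      next
        case False
        have r: "\<bar>pert b p (t m) n - b n\<bar> \<le> t m" for n using pert_diff[of b p "t m" n] t(2)[of m] by simp
        obtain y where y: "y \<in> ?U" "\<bar>x - y\<bar> < d"
          by (rule bands_near_bands[OF periodic_jacobi_axioms periodic_pert x r t1(2)])
        have "\<tau> * \<delta> \<le> measure lebesgue ({y - \<delta><..<y + \<delta>} \<inter> ?U)"
          using U y(1) \<delta> unfolding thick_def by blast
        also have "\<dots> \<le> measure lebesgue (({x - \<delta><..<x + \<delta>} \<inter> ?V) \<union> ((?U - ?V) \<union> ({x - \<delta> - d..x - \<delta>} \<union> {x + \<delta>..x + \<delta> + d})))"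
        proof (rule measure_mono_fmeasurable)
          show "{y - \<delta><..<y + \<delta>} \<inter> ?U \<subseteq> ({x - \<delta><..<x + \<delta>} \<inter> ?V) \<union> ((?U - ?V) \<union> ({x - \<delta> - d..x - \<delta>} \<union> {x + \<delta>..x + \<delta> + d}))"
            using y(2) by auto
          show "{y - \<delta><..<y + \<delta>} \<inter> ?U \<in> sets lebesgue"
            using lmeasurable_Ioo_Int_open[OF open_bands] by (simp add: fmeasurable_def)
          show "({x - \<delta><..<x + \<delta>} \<inter> ?V) \<union> ((?U - ?V) \<union> ({x - \<delta> - d..x - \<delta>} \<union> {x + \<delta>..x + \<delta> + d})) \<in> lmeasurable"
            by (intro fmeasurable.Un lmeasurable_Ioo_Int_open open_bands fmeasurable.Diff bands_lmeasurable
               periodic_jacobi.bands_lmeasurable[OF periodic_pert]) auto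
        qed
        also have "\<dots> \<le> measure lebesgue ({x - \<delta><..<x + \<delta>} \<inter> ?V) + (measure lebesgue (?U - ?V)
            + (measure lebesgue {x - \<delta> - d..x - \<delta>} + measure lebesgue {x + \<delta>..x + \<delta> + d}))"
          using bands_lmeasurable periodic_jacobi.bands_lmeasurable[OF periodic_pert, of "t m"]
            lmeasurable_Ioo_Int_open[OF open_bands, of "x - \<delta>" "x + \<delta>" a "pert b p (t m)" p]
          by (intro order_trans[OF measure_Un_le] add_mono order_refl) (auto simp: fmeasurable_def)
        also have "measure lebesgue {x - \<delta> - d..x - \<delta>} = d" using d by simp
        also have "measure lebesgue {x + \<delta>..x + \<delta> + d} = d" using d by simp
        finally have "\<tau> * \<delta> \<le> measure lebesgue ({x - \<delta><..<x + \<delta>} \<inter> ?V) + 3 * d" using elim(2) by linarith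
        moreover have "3 * d \<le> (\<tau> - \<tau>') * \<delta>"
        proof -
          have "4 * d = (\<tau> - \<tau>') * l" by (simp add: d_def)
          then have "3 * d \<le> (\<tau> - \<tau>') * l" using d by linarith
          also have "\<dots> \<le> (\<tau> - \<tau>') * \<delta>" using False \<tau> by (intro mult_left_mono) auto
          finally show ?thesis .
        qed
        ultimately show ?thesis by (simp add: algebra_simps)
      qed
    qed
  qed
qed

end

section \<open>Opening gaps\<close>

lemma multiple_between:
  fixes h u v :: real
  assumes "h > 0" "h < v - u"
  obtains m :: int where "u < h * m" "h * m < v"
proof
  let ?m = "\<lfloor>u / h\<rfloor> + 1"
  have "u / h < of_int ?m" by linarith
  then have "h * (u / h) < h * of_int ?m" using assms(1) by (rule mult_strict_left_mono)
  then show "u < h * of_int ?m" using assms(1) by simp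
  have "of_int ?m \<le> u / h + 1" by linarith
  then have "h * of_int ?m \<le> h * (u / h + 1)" using assms(1) by (intro mult_left_mono) auto
  also have "\<dots> = u + h" using assms(1) by (simp add: algebra_simps)
  finally show "h * of_int ?m < v" using assms(2) by linarith
qed

text \<open>A nonzero slope at a point of modulus c pushes the modulus beyond c on one side, the
  side being given by the sign of the slope.\<close>

lemma exceeds_near:
  fixes g :: "real \<Rightarrow> real"
  assumes g: "\<bar>g x\<bar> = c" "c > 0" and D: "(g has_real_derivative d) (at x)" "d \<noteq> 0" and e: "e > 0"
  obtains y where "\<bar>y - x\<bar> < e" "\<bar>g y\<bar> > c"
proof -
  define s where "s = sgn (g x)"
  have s: "s * g x = c" "\<bar>s\<bar> = 1" using g by (auto simp: s_def sgn_if abs_if split: if_splits)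
  have D': "((\<lambda>x. s * g x) has_real_derivative s * d) (at x)" by (rule DERIV_cmult[OF D(1)])
  have "\<exists>y. \<bar>y - x\<bar> < e \<and> s * g y > c"
  proof (cases "s * d > 0")
    case True
    from DERIV_pos_inc_right[OF D' this] obtain r where r: "r > 0" "\<And>h. 0 < h \<Longrightarrow> h < r \<Longrightarrow> s * g x < s * g (x + h)" by blast
    then show ?thesis using r(2)[of "min r e / 2"] e s(1) by (intro exI[of _ "x + min r e / 2"]) auto
  next
    case False
    moreover have "s * d \<noteq> 0" using D(2) s(2) by auto
    ultimately have "s * d < 0" by linarith
    from DERIV_neg_dec_left[OF D' this] obtain r where r: "r > 0" "\<And>h. 0 < h \<Longrightarrow> h < r \<Longrightarrow> s * g x < s * g (x - h)" by blast
    then show ?thesis using r(2)[of "min r e / 2"] e s(1) by (intro exI[of _ "x - min r e / 2"]) auto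
  qed
  then obtain y where y: "\<bar>y - x\<bar> < e" "s * g y > c" by blast
  have "s * g y \<le> \<bar>g y\<bar>" using abs_ge_self[of "s * g y"] s(2) by (simp add: abs_mult)
  then show thesis using that y by force
qed

context periodic_jacobi
begin

text \<open>Over \<open>L\<close> periods the monodromy matrix is \<open>\<plusminus>1\<close> at the points where
  the quasimomentum is a multiple of \<open>\<pi> / L\<close>. There the perturbed discriminant keeps the value
  \<open>\<plusminus>2\<close> but has nonzero slope, which opens a gap.\<close>

lemma gap_opens:
  assumes L: "L > 0" and E: "E \<in> bands a b p" "of_nat L * quasimom a b p E = pi * of_int m"
    and t: "t \<noteq> 0" and e: "e > 0"
  obtains y where "\<bar>y - E\<bar> < e" "2 < \<bar>discr a (pert b (L * p) t) (L * p) y\<bar>"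
proof -
  interpret q: periodic_jacobi a b "L * p" by (rule periodic_multiple[OF L])
  let ?q = "quasimom a b p" and ?q' = "quasimom' a b p E"
  \<comment> \<open>The perturbed discriminant in terms of the short period. The formula is valid
    near E, although E itself is not in the bands for period L * p.\<close>
  define g where "g y = 2 * cos (of_nat L * ?q y) - t / a 0 * (sol a b y 0 1 p * sin (of_nat L * ?q y) / sin (?q y))" for y
  have gd: "discr a (pert b (L * p) t) (L * p) y = g y" if "y \<in> bands a b p" for y
  proof -
    have "sol a b y 0 1 (L * p) = sol a b y 0 1 p * sin (of_nat L * ?q y) / sin (?q y)"
      using sol_mult[OF that, of L] quasimom(2)[OF that] by (simp add: field_simps)
    then show ?thesis unfolding q.discr_pert g_def discr_mult[OF that] by simp
  qed
  obtain S' where S': "\<And>x. ((\<lambda>x. sol a b x 0 1 p) has_real_derivative S' x) (at x)"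
    using sol_DERIV[of a b 0 1 p] by blast
  have dq: "(?q has_real_derivative ?q') (at E)" unfolding quasimom'_def by (rule quasimom_DERIV[OF E(1)])
  have s0: "sin (of_nat L * ?q E) = 0" unfolding E(2) using sin_npi_int[of m] by (simp add: mult.commute)
  have c1: "\<bar>cos (of_nat L * ?q E)\<bar> = 1" using sin_zero_abs_cos_one[OF s0] .
  have sE: "sin (?q E) \<noteq> 0" using quasimom(2)[OF E(1)] by simp
  \<comment> \<open>At E the sine of L times the quasimomentum is 0, so every term of the derivative
    containing it drops out and this single product remains.\<close>
  define d where "d = - (t / a 0) * (sol a b E 0 1 p * (cos (of_nat L * ?q E) * (of_nat L * ?q')) / sin (?q E))"
  have gd': "(g has_real_derivative d) (at E)"
    unfolding g_def
    by (rule derivative_eq_intros dq S' sE refl)+ (use s0 sE in \<open>simp add: d_def power2_eq_square mult_ac\<close>)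
  have d0: "d \<noteq> 0"
  proof -
    have "?q' \<noteq> 0" using discr'_nonzero[OF E(1)] sE by (simp add: quasimom'_def)
    moreover have "cos (of_nat L * ?q E) \<noteq> 0" using c1 by auto
    ultimately show ?thesis unfolding d_def using t a_pos[of 0] sol_nonzero[OF E(1)] sE L by simp
  qed
  have gE: "\<bar>g E\<bar> = 2" unfolding g_def s0 using c1 by (simp add: abs_mult)
  obtain r where r: "r > 0" "ball E r \<subseteq> bands a b p"
    using open_bands[of a b p] E(1) unfolding open_contains_ball by blast
  have er: "min e r > 0" using e r(1) by simp
  obtain y where y: "\<bar>y - E\<bar> < min e r" "\<bar>g y\<bar> > 2"
    by (rule exceeds_near[OF gE _ gd' d0 er]) auto
  have "y \<in> bands a b p" using r(2) y(1) by (auto simp: dist_real_def abs_minus_commute)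
  then show thesis using that[of y] y gd by simp
qed

text \<open>A point already in a gap stays there for multiples of the period and small t. Otherwise
  the interval contains a piece of band on which the quasimomentum covers an interval (lo, hi), and
  a grid of mesh pi / L meets it once L is large. The threshold is independent of t.\<close>

lemma gap_in_interval:
  fixes u v :: real
  assumes uv: "u < v"
  obtains L\<^sub>0 where "\<And>L t. L \<ge> L\<^sub>0 \<Longrightarrow> L > 0 \<Longrightarrow> t \<longlonglongrightarrow> 0 \<Longrightarrow> (\<And>m. t m \<noteq> 0) \<Longrightarrow>
     \<forall>\<^sub>F m in sequentially. \<exists>y\<in>{u<..<v}. 2 < \<bar>discr a (pert b (L * p) (t m)) (L * p) y\<bar>"
proof (cases "\<exists>y\<in>{u<..<v}. 2 < \<bar>discr a b p y\<bar>")
  case True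
  then obtain y where y: "y \<in> {u<..<v}" "2 < \<bar>discr a b p y\<bar>" by blast
  have "\<forall>\<^sub>F m in sequentially. \<exists>y\<in>{u<..<v}. 2 < \<bar>discr a (pert b (L * p) (t m)) (L * p) y\<bar>"
    if L: "L > 0" and t: "t \<longlonglongrightarrow> 0" for L and t :: "nat \<Rightarrow> real"
  proof -
    interpret q: periodic_jacobi a b "L * p" by (rule periodic_multiple[OF L])
    have "2 < \<bar>discr a b (L * p) y\<bar>" using discr_mult_outside[of y L] y(2) L by simp
    from q.bands_pert_eventually(2)[OF t this] show ?thesis
      by eventually_elim (use y(1) in blast)
  qed
  then show thesis using that[of 0] by blast
next
  case False
  have "finite ({x::real. discr a b p x = 2} \<union> {x. discr a b p x = -2})" using finite_discr_level by blast
  then have "infinite ({u<..<v} - ({x::real. discr a b p x = 2} \<union> {x. discr a b p x = -2}))"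
    using uv by (intro Diff_infinite_finite) auto
  then have "{u<..<v} - ({x::real. discr a b p x = 2} \<union> {x. discr a b p x = -2}) \<noteq> {}"
    by (rule infinite_imp_nonempty)
  then obtain x0 where "x0 \<in> {u<..<v} - ({x::real. discr a b p x = 2} \<union> {x. discr a b p x = -2})" by blast
  then have x0: "x0 \<in> {u<..<v}" "discr a b p x0 \<noteq> 2" "discr a b p x0 \<noteq> -2" by auto
  then have x0b: "x0 \<in> bands a b p" using False by (force simp: bands_def)
  have "open (bands a b p \<inter> {u<..<v})" by (intro open_Int open_bands open_greaterThanLessThan)
  then obtain r where r: "r > 0" "ball x0 r \<subseteq> bands a b p \<inter> {u<..<v}"
    using x0(1) x0b unfolding open_contains_ball by blast
  define x1 where "x1 = x0 + r / 2"
  have x1: "x0 < x1" using r(1) by (simp add: x1_def)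
  have seg: "x \<in> bands a b p \<and> x \<in> {u<..<v}" if "x \<in> {x0..x1}" for x
    using r that by (auto simp: x1_def dist_real_def subset_iff)
  let ?q = "quasimom a b p"
  have cq: "continuous_on {x0..x1} ?q"
    by (rule continuous_on_subset[OF continuous_quasimom]) (use seg in blast)
  have ne: "?q x0 \<noteq> ?q x1"
  proof -
    have "\<exists>z. x0 < z \<and> z < x1 \<and> ?q x1 - ?q x0 = (x1 - x0) * quasimom' a b p z"
      by (rule MVT2[OF x1]) (use seg quasimom_DERIV in \<open>auto simp: quasimom'_def\<close>)
    then obtain z where z: "x0 < z" "z < x1" "?q x1 - ?q x0 = (x1 - x0) * quasimom' a b p z" by blast
    have zb: "z \<in> bands a b p" using seg[of z] z by auto
    have "quasimom' a b p z \<noteq> 0" using discr'_nonzero[OF zb] quasimom(2)[OF zb] by (simp add: quasimom'_def)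
    then show ?thesis using z x1 by auto
  qed
  define lo where "lo = min (?q x0) (?q x1)"
  define hi where "hi = max (?q x0) (?q x1)"
  have lh: "lo < hi" using ne by (auto simp: lo_def hi_def)
  obtain L0 :: nat where L0: "pi / (hi - lo) < real L0" using reals_Archimedean2 by blast
  have "\<forall>\<^sub>F m in sequentially. \<exists>y\<in>{u<..<v}. 2 < \<bar>discr a (pert b (L * p) (t m)) (L * p) y\<bar>"
    if L: "L \<ge> L0" "L > 0" and t: "\<And>m. t m \<noteq> 0" for L and t :: "nat \<Rightarrow> real"
  proof -
    have Lr: "pi / (hi - lo) < real L" using L0 L by linarith
    then have "pi / real L < hi - lo" using lh L(2) by (simp add: divide_less_eq mult.commute)
    moreover have "pi / real L > 0" using L(2) by simp
    ultimately obtain m :: int where m: "lo < pi / real L * m" "pi / real L * m < hi"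
      using multiple_between by blast
    have "\<exists>E. x0 \<le> E \<and> E \<le> x1 \<and> ?q E = pi / real L * m"
    proof (cases "?q x0 \<le> ?q x1")
      case True
      then show ?thesis using IVT'[of ?q x0 "pi / real L * m" x1] m x1 cq by (auto simp: lo_def hi_def)
    next
      case False
      then show ?thesis using IVT2'[of ?q x1 "pi / real L * m" x0] m x1 cq by (auto simp: lo_def hi_def)
    qed
    then obtain E where E: "E \<in> {x0..x1}" "?q E = pi / real L * m" by auto
    have Eb: "E \<in> bands a b p" "E \<in> {u<..<v}" using seg[OF E(1)] by auto
    have Em: "of_nat L * ?q E = pi * of_int m" using E(2) L(2) by simp
    have "\<exists>y\<in>{u<..<v}. 2 < \<bar>discr a (pert b (L * p) (t n)) (L * p) y\<bar>" for n
    proof -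
      obtain y where "\<bar>y - E\<bar> < min (E - u) (v - E)" "2 < \<bar>discr a (pert b (L * p) (t n)) (L * p) y\<bar>"
        using gap_opens[OF L(2) Eb(1) Em t, of "min (E - u) (v - E)" n] Eb(2) by auto
      then show ?thesis by (intro bexI[of _ y]) auto
    qed
    then show ?thesis by simp
  qed
  then show thesis using that by blast
qed

end

text \<open>Dyadic cells of length 2^-n, whose left ends i / 2^n with \<bar>i\<bar> \<le> 4^n run
  over [-2^n, 2^n]: finitely many conditions per stage, which together break every interval as n
  grows.\<close>

definition gap_cells :: "(int \<Rightarrow> real) \<Rightarrow> nat \<Rightarrow> (int \<Rightarrow> real) \<Rightarrow> bool" where
  "gap_cells a n b \<longleftrightarrow> (\<forall>i::int. \<bar>i\<bar> \<le> 4 ^ n \<longrightarrow>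
     (\<exists>y\<in>{of_int i / 2 ^ n<..<(of_int i + 1) / (2::real) ^ n}. complex_of_real y \<in> resolvent_set (jacobi a b)))"

text \<open>Finitely many gap points have a common positive distance m from the bands; half of it is
  a radius within which they all remain in the resolvent set.\<close>

lemma (in periodic_jacobi) gap_cells_stable:
  assumes "\<And>i::int. \<bar>i\<bar> \<le> 4 ^ n \<Longrightarrow> \<exists>y\<in>{of_int i / 2 ^ n<..<(of_int i + 1) / (2::real) ^ n}. 2 < \<bar>discr a b p y\<bar>"
  obtains r where "r > 0" "\<And>c. bseq c \<Longrightarrow> (\<And>k. \<bar>c k - b k\<bar> \<le> r) \<Longrightarrow> gap_cells a n c"
proof -
  obtain y where y: "\<And>i::int. \<bar>i\<bar> \<le> 4 ^ n \<Longrightarrow> y i \<in> {of_int i / 2 ^ n<..<(of_int i + 1) / (2::real) ^ n} \<and> 2 < \<bar>discr a b p (y i)\<bar>"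
    using assms by metis
  have "\<exists>d>0. \<forall>x\<in>bands a b p. d \<le> \<bar>x - y i\<bar>" if i: "\<bar>i\<bar> \<le> 4 ^ n" for i
  proof -
    have o: "open {x::real. 2 < \<bar>discr a b p x\<bar>}"
      by (intro open_Collect_less continuous_intros continuous_discr)
    have "y i \<in> {x. 2 < \<bar>discr a b p x\<bar>}" using y[OF i] by simp
    then obtain d where d: "d > 0" "ball (y i) d \<subseteq> {x. 2 < \<bar>discr a b p x\<bar>}"
      using o unfolding open_contains_ball by blast
    have "d \<le> \<bar>x - y i\<bar>" if "x \<in> bands a b p" for x
    proof (rule ccontr)
      assume "\<not> d \<le> \<bar>x - y i\<bar>"
      then have "x \<in> ball (y i) d" by (simp add: dist_real_def abs_minus_commute)
      then have "2 < \<bar>discr a b p x\<bar>" using d(2) by blast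
      then show False using that by (simp add: bands_def)
    qed
    then show ?thesis using d(1) by blast
  qed
  then obtain d where d: "\<And>i::int. \<bar>i\<bar> \<le> 4 ^ n \<Longrightarrow> d i > 0 \<and> (\<forall>x\<in>bands a b p. d i \<le> \<bar>x - y i\<bar>)" by metis
  have fin: "finite {i::int. \<bar>i\<bar> \<le> 4 ^ n}"
    by (rule finite_subset[of _ "{- (4 ^ n)..4 ^ n}"]) auto
  define m where "m = Min (d ` {i::int. \<bar>i\<bar> \<le> 4 ^ n})"
  have m: "m \<le> d i" if "\<bar>i\<bar> \<le> 4 ^ n" for i unfolding m_def by (rule Min_le) (use fin that in auto)
  have "m \<in> d ` {i::int. \<bar>i\<bar> \<le> 4 ^ n}"
    unfolding m_def by (rule Min_in) (use fin in \<open>auto intro!: exI[of _ 0]\<close>)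
  then have m0: "m > 0" using d by auto
  have "gap_cells a n c" if c: "bseq c" "\<And>k. \<bar>c k - b k\<bar> \<le> m / 2" for c
    unfolding gap_cells_def
  proof (intro allI impI)
    fix i :: int assume i: "\<bar>i\<bar> \<le> 4 ^ n"
    have "complex_of_real (y i) \<in> resolvent_set (jacobi a c)"
      by (rule spectrum_near_bands[OF c, of m]) (use m0 m[OF i] d[OF i] in force)+
    then show "\<exists>y\<in>{of_int i / 2 ^ n<..<(of_int i + 1) / (2::real) ^ n}. complex_of_real y \<in> resolvent_set (jacobi a c)"
      using y[OF i] by blast
  qed
  then show thesis using that[of "m / 2"] m0 by simp
qed

text \<open>Refining the period removes only finitely many points from the bands, a null
  set.\<close>

lemma (in periodic_jacobi) thick_multiple:
  assumes L: "L > 0" and U: "thick \<tau> \<delta>\<^sub>0 (bands a b p)"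
  shows "thick \<tau> \<delta>\<^sub>0 (bands a b (L * p))"
  unfolding thick_def
proof (intro ballI allI impI)
  interpret q: periodic_jacobi a b "L * p" by (rule periodic_multiple[OF L])
  fix x \<delta> assume x: "x \<in> bands a b (L * p)" and \<delta>: "0 < \<delta> \<and> \<delta> \<le> \<delta>\<^sub>0"
  let ?I = "{x - \<delta><..<x + \<delta>}"
  define E where "E = {x::real. discr a b (L * p) x = 2} \<union> {x. discr a b (L * p) x = -2}"
  have "finite E" unfolding E_def using q.finite_discr_level by blast
  then have E: "E \<in> lmeasurable" "measure lebesgue E = 0"
    using negligible_finite negligible_imp_measurable negligible_imp_measure0 by blast+
  have sub: "?I \<inter> bands a b p \<subseteq> (?I \<inter> bands a b (L * p)) \<union> E"
  proof
    fix y assume y: "y \<in> ?I \<inter> bands a b p"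
    then have "discr a b (L * p) y = 2 * cos (of_nat L * quasimom a b p y)" using discr_mult by blast
    then have "\<bar>discr a b (L * p) y\<bar> \<le> 2" by (simp add: abs_mult)
    then show "y \<in> (?I \<inter> bands a b (L * p)) \<union> E" using y by (auto simp: bands_def E_def)
  qed
  have "x \<in> bands a b p" using bands_mult_subset[OF L] x by blast
  then have "\<tau> * \<delta> \<le> measure lebesgue (?I \<inter> bands a b p)" using U \<delta> unfolding thick_def by blast
  also have "\<dots> \<le> measure lebesgue ((?I \<inter> bands a b (L * p)) \<union> E)"
    by (rule measure_mono_fmeasurable[OF sub])
      (use lmeasurable_Ioo_Int_open[OF open_bands] E(1) in \<open>auto intro!: fmeasurable.Un\<close>)
  also have "\<dots> \<le> measure lebesgue (?I \<inter> bands a b (L * p)) + measure lebesgue E"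
    by (rule measure_Un_le) (use lmeasurable_Ioo_Int_open[OF open_bands] E(1) in auto)
  finally show "\<tau> * \<delta> \<le> measure lebesgue (?I \<inter> bands a b (L * p))" using E(2) by simp
qed

text \<open>The period multiple L is chosen from the cells alone; afterwards t is taken so small
  that gaps, thickness, kernels and distance are all as required. The radius r' is the room in which
  later steps may move without closing the new gaps.\<close>

lemma (in periodic_jacobi) perturbation_step:
  assumes U: "thick \<tau> \<delta>\<^sub>0 (bands a b p)" and \<tau>: "0 < \<tau>'" "\<tau>' < \<tau>" "\<tau> \<le> 1" and r: "r > 0"
  obtains b' p' r' where "periodic_jacobi a b' p'" "thick \<tau>' \<delta>\<^sub>0 (bands a b' p')" "0 < r'" "r' \<le> r / 2"
    "\<And>k. \<bar>b' k - b k\<bar> \<le> r / 2"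
    "\<And>c. bseq c \<Longrightarrow> (\<And>k. \<bar>c k - b' k\<bar> \<le> r') \<Longrightarrow> gap_cells a n c"
    "\<And>j k. \<bar>j\<bar> \<le> int n \<Longrightarrow> \<bar>k\<bar> \<le> int n \<Longrightarrow>
      (\<integral>x. \<bar>per_kernel a b' p' j k x - per_kernel a b p j k x\<bar> \<partial>lborel) \<le> 1 / 2 ^ n"
proof -
  define C where "C i = {of_int i / 2 ^ n<..<(of_int i + 1) / (2::real) ^ n}" for i :: int
  define t where "t m = 1 / real (Suc m)" for m
  have t: "t \<longlonglongrightarrow> 0" "\<And>m. t m > 0" unfolding t_def using LIMSEQ_Suc[OF lim_1_over_n] by (auto simp: divide_simps)
  define I where "I = {i::int. \<bar>i\<bar> \<le> 4 ^ n}"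
  have fin: "finite I" unfolding I_def by (rule finite_subset[of _ "{- (4 ^ n)..4 ^ n}"]) auto
  define P where "P i L \<longleftrightarrow> (\<forall>\<^sub>F m in sequentially. \<exists>y\<in>C i. 2 < \<bar>discr a (pert b (L * p) (t m)) (L * p) y\<bar>)" for i L
  have "\<exists>L0. \<forall>L\<ge>L0. L > 0 \<longrightarrow> P i L" for i
  proof -
    have "of_int i / 2 ^ n < (of_int i + 1) / (2::real) ^ n" by (simp add: divide_strict_right_mono)
    then obtain L0 where L0: "\<And>L t. L \<ge> L0 \<Longrightarrow> L > 0 \<Longrightarrow> t \<longlonglongrightarrow> 0 \<Longrightarrow> (\<And>m. t m \<noteq> 0) \<Longrightarrow>
       \<forall>\<^sub>F m in sequentially. \<exists>y\<in>{of_int i / 2 ^ n<..<(of_int i + 1) / (2::real) ^ n}. 2 < \<bar>discr a (pert b (L * p) (t m)) (L * p) y\<bar>"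
      using gap_in_interval by blast
    have "t m \<noteq> 0" for m using t(2)[of m] by simp
    then show ?thesis unfolding P_def C_def using L0[OF _ _ t(1)] by blast
  qed
  then obtain L0 where L0: "\<And>i L. L \<ge> L0 i \<Longrightarrow> L > 0 \<Longrightarrow> P i L" by metis
  \<comment> \<open>One positive multiple above the thresholds of all finitely many cells.\<close>
  define L where "L = Suc (\<Sum>i\<in>I. L0 i)"
  have L: "L > 0" "\<And>i. i \<in> I \<Longrightarrow> L0 i \<le> L" using member_le_sum[of _ I L0] fin by (auto simp: L_def intro: le_SucI)
  interpret q: periodic_jacobi a b "L * p" by (rule periodic_multiple[OF L(1)])
  have km: "AE x in lborel. per_kernel a b (L * p) j k x = per_kernel a b p j k x" for j k
    using per_kernel_multiple[OF L(1)] by eventually_elim simp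
  have bq: "thick \<tau> \<delta>\<^sub>0 (bands a b (L * p))" by (rule thick_multiple[OF L(1) U])
  have 1: "\<forall>\<^sub>F m in sequentially. thick \<tau>' \<delta>\<^sub>0 (bands a (pert b (L * p) (t m)) (L * p))"
    by (rule q.thick_pert[OF bq \<tau> t(1)]) (use t(2) less_imp_le in blast)
  have 2: "\<forall>\<^sub>F m in sequentially. \<forall>i\<in>I. \<exists>y\<in>C i. 2 < \<bar>discr a (pert b (L * p) (t m)) (L * p) y\<bar>"
    using fin L0[OF L(2) L(1)] unfolding P_def by (intro eventually_ball_finite ballI) auto
  have "\<forall>\<^sub>F m in sequentially. (\<integral>x. \<bar>per_kernel a (pert b (L * p) (t m)) (L * p) j k x - per_kernel a b (L * p) j k x\<bar> \<partial>lborel) < 1 / 2 ^ n" for j k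
    by (rule order_tendstoD(2)[OF q.per_kernel_pert_L1[OF t(1)]]) simp
  then have 3: "\<forall>\<^sub>F m in sequentially. \<forall>j\<in>centered n. \<forall>k\<in>centered n.
     (\<integral>x. \<bar>per_kernel a (pert b (L * p) (t m)) (L * p) j k x - per_kernel a b (L * p) j k x\<bar> \<partial>lborel) < 1 / 2 ^ n"
    by (intro eventually_ball_finite ballI) auto
  have 4: "\<forall>\<^sub>F m in sequentially. t m < r / 2" by (rule order_tendstoD(2)[OF t(1)]) (use r in simp)
  from eventually_conj[OF 1 eventually_conj[OF 2 eventually_conj[OF 3 4]]]
  obtain m where m1: "thick \<tau>' \<delta>\<^sub>0 (bands a (pert b (L * p) (t m)) (L * p))"
    and m2: "\<forall>i\<in>I. \<exists>y\<in>C i. 2 < \<bar>discr a (pert b (L * p) (t m)) (L * p) y\<bar>"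
    and m3: "\<forall>j\<in>centered n. \<forall>k\<in>centered n.
     (\<integral>x. \<bar>per_kernel a (pert b (L * p) (t m)) (L * p) j k x - per_kernel a b (L * p) j k x\<bar> \<partial>lborel) < 1 / 2 ^ n"
    and m4: "t m < r / 2"
    by (auto dest!: eventually_happens)
  let ?b = "pert b (L * p) (t m)"
  interpret s: periodic_jacobi a ?b "L * p" by (rule q.periodic_pert)
  obtain r1 where r1: "r1 > 0" "\<And>c. bseq c \<Longrightarrow> (\<And>k. \<bar>c k - ?b k\<bar> \<le> r1) \<Longrightarrow> gap_cells a n c"
    by (rule s.gap_cells_stable[of n]) (use m2 in \<open>auto simp: I_def C_def\<close>)
  show thesis
  proof (rule that[of ?b "L * p" "min r1 (r / 2)"])
    show "periodic_jacobi a ?b (L * p)" by (rule q.periodic_pert)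
    show "thick \<tau>' \<delta>\<^sub>0 (bands a ?b (L * p))" by (rule m1)
    show "0 < min r1 (r / 2)" "min r1 (r / 2) \<le> r / 2" using r1 r by auto
    show "\<bar>?b k - b k\<bar> \<le> r / 2" for k using pert_diff[of b "L * p" "t m" k] m4 t(2)[of m] by linarith
    show "gap_cells a n c" if "bseq c" "\<And>k. \<bar>c k - ?b k\<bar> \<le> min r1 (r / 2)" for c
      by (rule r1(2)[OF that(1)]) (use that(2) min.bounded_iff in blast)
    fix j k :: int assume jk: "\<bar>j\<bar> \<le> int n" "\<bar>k\<bar> \<le> int n"
    have "(\<integral>x. \<bar>per_kernel a ?b (L * p) j k x - per_kernel a b p j k x\<bar> \<partial>lborel)
       = (\<integral>x. \<bar>per_kernel a ?b (L * p) j k x - per_kernel a b (L * p) j k x\<bar> \<partial>lborel)"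
      by (rule integral_cong_AE) (use km[of j k] in \<open>auto elim: eventually_mono\<close>)
    then show "(\<integral>x. \<bar>per_kernel a ?b (L * p) j k x - per_kernel a b p j k x\<bar> \<partial>lborel) \<le> 1 / 2 ^ n"
      using m3 jk by (auto simp: abs_le_iff intro: less_imp_le)
  qed
qed

section \<open>Limits of periodic approximations\<close>

text \<open>The data kept from the inductive construction: r n bounds the distance from stage n to
  the limit, and the thickness constant and scale are uniform in n.\<close>

locale approximation =
  fixes a b :: "int \<Rightarrow> real" and B :: "nat \<Rightarrow> int \<Rightarrow> real" and p :: "nat \<Rightarrow> nat" and r :: "nat \<Rightarrow> real"
    and \<tau> \<delta>\<^sub>0 :: real
  assumes per: "\<And>n. periodic_jacobi a (B n) (p n)"
    and r_pos: "\<And>n. 0 < r n" and r_lim: "r \<longlonglongrightarrow> 0"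
    and close: "\<And>n k. \<bar>b k - B n k\<bar> \<le> r n"
    and \<tau>: "0 < \<tau>" and \<delta>\<^sub>0: "0 < \<delta>\<^sub>0"
    and thick: "\<And>n. thick \<tau> \<delta>\<^sub>0 (bands a (B n) (p n))"
    and gaps: "\<And>n. gap_cells a n b"
    and kernels: "\<And>n j k. \<bar>j\<bar> \<le> int n \<Longrightarrow> \<bar>k\<bar> \<le> int n \<Longrightarrow>
      (\<integral>x. \<bar>per_kernel a (B (Suc n)) (p (Suc n)) j k x - per_kernel a (B n) (p n) j k x\<bar> \<partial>lborel) \<le> 1 / 2 ^ n"
begin

abbreviation V :: "nat \<Rightarrow> real set" where
  "V n \<equiv> bands a (B n) (p n)"

abbreviation K :: "real set" where
  "K \<equiv> real_spectrum (jacobi a b)"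

lemma not_in_K: "y \<notin> K \<longleftrightarrow> complex_of_real y \<in> resolvent_set (jacobi a b)"
  by (simp add: real_spectrum_def spectrum_def)

lemma bseq_a: "bseq a"
  by (rule periodic_jacobi.bseq_ab(1)[OF per])

lemma bseq_b: "bseq b"
proof -
  obtain C where C: "\<And>k. \<bar>B 0 k\<bar> \<le> C"
    using periodic_jacobi.bseq_ab(2)[OF per[of 0]] unfolding bseq_def by blast
  have "\<bar>b k\<bar> \<le> C + r 0" for k using C[of k] close[of k 0] by linarith
  then show ?thesis unfolding bseq_def by blast
qed

lemma B_lim: "(\<lambda>n. B n k) \<longlonglongrightarrow> b k"
proof (rule LIM_zero_cancel, rule Lim_null_comparison[OF _ r_lim])
  show "\<forall>\<^sub>F n in sequentially. norm (B n k - b k) \<le> r n"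
    using close[of k] by (simp add: abs_minus_commute)
qed

lemma ac: "purely_absolutely_continuous_spectrum (jacobi a b)"
proof -
  obtain g where "spectral_kernel a b g"
    by (rule spectral_kernel_limit[of a B "\<lambda>n. per_kernel a (B n) (p n)" b])
      (auto intro: periodic_jacobi.spectral_kernel_per_kernel[OF per] B_lim kernels)
  then show ?thesis by (rule spectral_kernel_imp_ac[OF bseq_a bseq_b])
qed

lemma K_near:
  assumes "x \<in> K" "r n < d"
  obtains y where "y \<in> V n" "\<bar>x - y\<bar> < d"
proof (rule ccontr)
  assume "\<not> thesis"
  then have far: "d \<le> \<bar>y - x\<bar>" if "y \<in> V n" for y
    using that \<open>\<And>y. y \<in> V n \<Longrightarrow> \<bar>x - y\<bar> < d \<Longrightarrow> thesis\<close> by (metis abs_minus_commute not_le)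
  have "complex_of_real x \<in> resolvent_set (jacobi a b)"
    by (rule periodic_jacobi.spectrum_near_bands[OF per bseq_b close assms(2) far])
  then show False using assms(1) not_in_K by blast
qed

text \<open>With \<open>K_near\<close> this is convergence of the band sets to K in the Hausdorff
  sense: points of K are close to V n, and points off K stay away from V n for large n.\<close>

lemma K_far:
  assumes "y \<notin> K"
  obtains \<delta> where "\<delta> > 0" "\<And>n x. x \<in> V n \<Longrightarrow> \<delta> \<le> r n + \<bar>x - y\<bar>"
proof -
  obtain \<delta> where \<delta>: "\<delta> > 0" "\<And>b' p x r. periodic_jacobi a b' p \<Longrightarrow> x \<in> bands a b' p \<Longrightarrow> (\<And>n. \<bar>b n - b' n\<bar> \<le> r) \<Longrightarrow> \<delta> \<le> r + \<bar>x - y\<bar>"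
    using resolvent_set_far_from_bands[OF bseq_a bseq_b] assms not_in_K by blast
  show thesis by (rule that[OF \<delta>(1)], rule \<delta>(2)[OF per], assumption, rule close)
qed

lemma r_small: "e > 0 \<Longrightarrow> \<exists>n\<ge>N. r n < e"
proof -
  assume "e > 0"
  then have "\<forall>\<^sub>F n in sequentially. r n < e" by (rule order_tendstoD(2)[OF r_lim])
  then show ?thesis unfolding eventually_sequentially by (meson nat_le_linear)
qed

lemma closed_K: "closed K"
  unfolding closed_def open_dist
proof
  fix y assume "y \<in> - K"
  then have "y \<notin> K" by simp
  then obtain \<delta> where \<delta>: "\<delta> > 0" "\<And>n x. x \<in> V n \<Longrightarrow> \<delta> \<le> r n + \<bar>x - y\<bar>" by (rule K_far) blast
  obtain n where n: "r n < \<delta> / 4" using r_small[of "\<delta> / 4" 0] \<delta>(1) by auto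
  show "\<exists>e>0. \<forall>z. dist z y < e \<longrightarrow> z \<in> - K"
  proof (intro exI conjI allI impI)
    show "\<delta> / 4 > 0" using \<delta>(1) by simp
    fix z assume z: "dist z y < \<delta> / 4"
    show "z \<in> - K"
    proof
      assume "z \<in> K"
      then obtain x where x: "x \<in> V n" "\<bar>z - x\<bar> < \<delta> / 4" by (rule K_near[OF _ n])
      have "\<delta> \<le> r n + \<bar>x - y\<bar>" by (rule \<delta>(2)[OF x(1)])
      moreover have "\<bar>x - y\<bar> \<le> \<bar>z - y\<bar> + \<bar>z - x\<bar>" using abs_triangle_ineq4[of "z - y" "z - x"] by simp
      ultimately show False using n x(2) z \<delta>(1) unfolding dist_real_def by linarith
    qed
  qed
qed

lemma bounded_K: "bounded K"
proof -
  obtain C where C: "\<And>x. x \<in> V 0 \<Longrightarrow> \<bar>x\<bar> \<le> C"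
    using periodic_jacobi.bounded_bands[OF per[of 0]] unfolding bounded_iff real_norm_def by blast
  have "\<bar>x\<bar> \<le> C + (r 0 + 1)" if x: "x \<in> K" for x
  proof -
    obtain y where "y \<in> V 0" "\<bar>x - y\<bar> < r 0 + 1" by (rule K_near[OF x, of 0 "r 0 + 1"]) auto
    then show ?thesis using C[of y] by linarith
  qed
  then show ?thesis unfolding bounded_iff real_norm_def by blast
qed

lemma compact_K: "compact K"
  using closed_K bounded_K by (simp add: compact_eq_bounded_closed)

lemma limsup_K:
  assumes "\<And>N. \<exists>n\<ge>N. y \<in> V n"
  shows "y \<in> K"
proof (rule ccontr)
  assume "y \<notin> K"
  then obtain \<delta> where \<delta>: "\<delta> > 0" "\<And>n x. x \<in> V n \<Longrightarrow> \<delta> \<le> r n + \<bar>x - y\<bar>" by (rule K_far) blast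
  have "\<forall>\<^sub>F n in sequentially. r n < \<delta>" by (rule order_tendstoD(2)[OF r_lim \<delta>(1)])
  then obtain N where N: "\<And>n. n \<ge> N \<Longrightarrow> r n < \<delta>" unfolding eventually_sequentially by blast
  obtain n where n: "n \<ge> N" "y \<in> V n" using assms by blast
  show False using \<delta>(2)[OF n(2)] N[OF n(1)] by simp
qed

lemma open_V: "open (V n)"
  by (rule open_bands)

text \<open>Continuity from above along the decreasing unions of V n over n \<ge> N, whose
  intersection lies in K by \<open>limsup_K\<close>. Lower bounds for the bands thus pass to the
  spectrum.\<close>

lemma measure_limsup:
  assumes J: "J = {x - \<delta><..<x + \<delta>}" and m: "\<And>n. s n \<le> measure lebesgue (J \<inter> V n)" and s: "s \<longlonglongrightarrow> s'"
  shows "s' \<le> measure lebesgue (J \<inter> K)"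
proof -
  define W where "W N = J \<inter> (\<Union>n\<in>{N..}. V n)" for N
  have Wm: "W N \<in> lmeasurable" for N
    unfolding W_def J by (rule lmeasurable_Ioo_Int_open) (intro open_UN ballI open_V)
  have lim: "(\<lambda>N. measure lebesgue (W N)) \<longlonglongrightarrow> measure lebesgue (\<Inter>N. W N)"
  proof (rule Lim_measure_decseq)
    show "range W \<subseteq> sets lebesgue" using Wm by (auto simp: fmeasurable_def)
    show "decseq W" unfolding W_def by (rule decseq_SucI) (auto dest: Suc_leD)
    show "emeasure lebesgue (W i) \<noteq> \<infinity>" for i using Wm[of i] by (auto simp: fmeasurable_def)
  qed
  have "s N \<le> measure lebesgue (W N)" for N
  proof -
    have "measure lebesgue (J \<inter> V N) \<le> measure lebesgue (W N)"
      by (rule measure_mono_fmeasurable[OF _ _ Wm])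
        (use lmeasurable_Ioo_Int_open[OF open_V[of N], of "x - \<delta>" "x + \<delta>"] in \<open>auto simp: W_def J fmeasurable_def\<close>)
    then show ?thesis using m[of N] by linarith
  qed
  then have "s' \<le> measure lebesgue (\<Inter>N. W N)" using LIMSEQ_le[OF s lim] by blast
  also have "\<dots> \<le> measure lebesgue (J \<inter> K)"
  proof (rule measure_mono_fmeasurable)
    show "(\<Inter>N. W N) \<subseteq> J \<inter> K"
    proof
      fix y assume y: "y \<in> (\<Inter>N. W N)"
      have "y \<in> K" by (rule limsup_K) (use y in \<open>auto simp: W_def\<close>)
      then show "y \<in> J \<inter> K" using y by (auto simp: W_def)
    qed
    show "(\<Inter>N. W N) \<in> sets lebesgue"
      by (rule sets.countable_INT'') (use Wm in \<open>auto simp: fmeasurable_def\<close>)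
    show "J \<inter> K \<in> lmeasurable" unfolding J
      by (intro fmeasurable_Int_fmeasurable) (use closed_K in \<open>auto intro: borel_closed\<close>)
  qed
  finally show ?thesis .
qed

lemma homogeneous_K: "homogeneous \<tau> K"
  unfolding homogeneous_def
proof (intro conjI compact_K exI[of _ \<delta>\<^sub>0] ballI allI impI \<delta>\<^sub>0)
  fix x \<delta> assume x: "x \<in> K" and \<delta>: "0 < \<delta> \<and> \<delta> \<le> \<delta>\<^sub>0"
  have "\<tau> * \<delta> - 4 * r n \<le> measure lebesgue ({x - \<delta><..<x + \<delta>} \<inter> V n)" for n
  proof -
    \<comment> \<open>Any width above r n would do; 2 * r n tends to 0 and turns the two strips into
      the error 4 * r n.\<close>
    define d where "d = 2 * r n"
    have d: "d > 0" "r n < d" using r_pos[of n] by (auto simp: d_def)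
    obtain y where y: "y \<in> V n" "\<bar>x - y\<bar> < d" by (rule K_near[OF x d(2)])
    have I: "{x - \<delta><..<x + \<delta>} \<inter> V n \<in> lmeasurable" by (rule lmeasurable_Ioo_Int_open[OF open_V])
    have "\<tau> * \<delta> \<le> measure lebesgue ({y - \<delta><..<y + \<delta>} \<inter> V n)"
      using thick[of n] y(1) \<delta> unfolding thick_def by blast
    also have "\<dots> \<le> measure lebesgue (({x - \<delta><..<x + \<delta>} \<inter> V n) \<union> ({x - \<delta> - d..x - \<delta>} \<union> {x + \<delta>..x + \<delta> + d}))"
    proof (rule measure_mono_fmeasurable)
      show "{y - \<delta><..<y + \<delta>} \<inter> V n \<subseteq> ({x - \<delta><..<x + \<delta>} \<inter> V n) \<union> ({x - \<delta> - d..x - \<delta>} \<union> {x + \<delta>..x + \<delta> + d})"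
        using y(2) by auto
      show "{y - \<delta><..<y + \<delta>} \<inter> V n \<in> sets lebesgue"
        using lmeasurable_Ioo_Int_open[OF open_V] by (simp add: fmeasurable_def)
      show "({x - \<delta><..<x + \<delta>} \<inter> V n) \<union> ({x - \<delta> - d..x - \<delta>} \<union> {x + \<delta>..x + \<delta> + d}) \<in> lmeasurable"
        by (intro fmeasurable.Un I) auto
    qed
    also have "\<dots> \<le> measure lebesgue ({x - \<delta><..<x + \<delta>} \<inter> V n)
        + (measure lebesgue {x - \<delta> - d..x - \<delta>} + measure lebesgue {x + \<delta>..x + \<delta> + d})"
      using I by (intro order_trans[OF measure_Un_le] add_mono order_refl measure_Un_le) (auto simp: fmeasurable_def)
    also have "measure lebesgue {x - \<delta> - d..x - \<delta>} = d" using d by simp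
    also have "measure lebesgue {x + \<delta>..x + \<delta> + d} = d" using d by simp
    finally show ?thesis by (simp add: d_def)
  qed
  moreover have "(\<lambda>n. \<tau> * \<delta> - 4 * r n) \<longlonglongrightarrow> \<tau> * \<delta>"
    using tendsto_diff[OF tendsto_const tendsto_mult[OF tendsto_const r_lim], of "\<tau> * \<delta>" 4] by simp
  ultimately show "\<tau> * \<delta> \<le> measure lebesgue ({x - \<delta><..<x + \<delta>} \<inter> K)"
    by (rule measure_limsup[OF refl])
qed

text \<open>Zeros of the discriminants lie in the bands and stay bounded; by \<open>K_far\<close> a
  limit point of them cannot lie off K.\<close>

lemma K_nonempty: "K \<noteq> {}"
proof -
  have "\<exists>x. x \<in> V n" for n
  proof -
    interpret periodic_jacobi a "B n" "p n" by (rule per)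
    have "card {x::real. discr a (B n) (p n) x = 0} = p n" by (rule card_level_set) simp
    then have "{x::real. discr a (B n) (p n) x = 0} \<noteq> {}" using p_pos by (metis card.empty less_irrefl)
    then obtain x :: real where "discr a (B n) (p n) x = 0" by blast
    then show ?thesis by (intro exI[of _ x]) (simp add: bands_def)
  qed
  then obtain x where x: "\<And>n. x n \<in> V n" by metis
  obtain A where A: "\<And>n. \<bar>a n\<bar> \<le> A" using bseq_a unfolding bseq_def by blast
  obtain C where C: "\<And>n. \<bar>b n\<bar> \<le> C" using bseq_b unfolding bseq_def by blast
  obtain M where M: "\<And>n. \<bar>r n\<bar> \<le> M"
    using convergent_imp_Bseq[OF convergentI[OF r_lim]] unfolding Bseq_def real_norm_def by blast
  have bd: "\<bar>x n\<bar> \<le> 2 * A + (C + M)" for n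
  proof (rule periodic_jacobi.bands_bounded[OF per x A])
    show "\<bar>B n k\<bar> \<le> C + M" for k using C[of k] M[of n] close[of k n] by linarith
  qed
  have "x n \<in> {- (2 * A + (C + M))..2 * A + (C + M)}" for n
    using bd[of n] unfolding atLeastAtMost_iff by linarith
  moreover have "seq_compact {- (2 * A + (C + M))..2 * A + (C + M)}"
    by (rule compact_imp_seq_compact) simp
  ultimately obtain y \<rho> where y: "strict_mono (\<rho> :: nat \<Rightarrow> nat)" "(x \<circ> \<rho>) \<longlonglongrightarrow> y"
    unfolding seq_compact_def by metis
  have "y \<in> K"
  proof (rule ccontr)
    assume "y \<notin> K"
    then obtain \<delta> where \<delta>: "\<delta> > 0" "\<And>n x. x \<in> V n \<Longrightarrow> \<delta> \<le> r n + \<bar>x - y\<bar>" by (rule K_far) blast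
    have "(\<lambda>n. (r \<circ> \<rho>) n + \<bar>(x \<circ> \<rho>) n - y\<bar>) \<longlonglongrightarrow> 0 + \<bar>y - y\<bar>"
      by (intro tendsto_intros y(2) LIMSEQ_subseq_LIMSEQ[OF r_lim y(1)])
    then have "\<delta> \<le> 0 + \<bar>y - y\<bar>" by (rule LIMSEQ_le_const) (use \<delta>(2)[OF x] in auto)
    then show False using \<delta>(1) by simp
  qed
  then show ?thesis by blast
qed

text \<open>Near an isolated point K would have measure zero, against homogeneity.\<close>

lemma K_not_isolated:
  assumes x: "x \<in> K"
  shows "\<not> x isolated_in K"
proof
  assume "x isolated_in K"
  then obtain T where T: "open T" "T \<inter> K = {x}" unfolding isolated_in_def by blast
  have "x \<in> T" using T(2) by blast
  then obtain e where e: "e > 0" "ball x e \<subseteq> T" using T(1) unfolding open_contains_ball by blast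
  obtain \<delta>' where \<delta>': "\<delta>' > 0" "\<And>\<delta>. 0 < \<delta> \<Longrightarrow> \<delta> \<le> \<delta>' \<Longrightarrow> \<tau> * \<delta> \<le> measure lebesgue ({x - \<delta><..<x + \<delta>} \<inter> K)"
    using homogeneous_K x unfolding homogeneous_def by blast
  define \<delta> where "\<delta> = min e \<delta>'"
  have \<delta>: "\<delta> > 0" "\<delta> \<le> \<delta>'" "\<delta> \<le> e" using e(1) \<delta>'(1) by (auto simp: \<delta>_def)
  have "{x - \<delta><..<x + \<delta>} \<subseteq> ball x e" using \<delta>(3) by (auto simp: dist_real_def)
  then have "{x - \<delta><..<x + \<delta>} \<inter> K = {x}" using e(2) T(2) x \<delta>(1) by auto
  then have "\<tau> * \<delta> \<le> measure lebesgue {x}" using \<delta>'(2)[OF \<delta>(1,2)] by simp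
  moreover have "measure lebesgue {x} = 0" by (rule negligible_imp_measure0[OF negligible_sing])
  ultimately show False using \<tau> \<delta>(1) by (simp add: mult_le_0_iff)
qed

lemma K_totally_disconnected: "totally_disconnected K"
  unfolding totally_disconnected_def
proof (intro allI impI)
  fix C assume C: "C \<subseteq> K \<and> connected C"
  have no: False if uv: "u \<in> C" "v \<in> C" "u < v" for u v
  proof -
    have sub: "{u..v} \<subseteq> K" using connected_contains_Icc[of C u v] C uv by blast
    \<comment> \<open>The first entry makes the interval longer than two cells, so it contains a
      whole one; the others keep the index i of that cell within 4^n.\<close>
    define M where "M = max (2 / (v - u)) (max (\<bar>u\<bar> + 1) 1)"
    obtain n where n: "M < (2::real) ^ n" using real_arch_pow[of 2 M] by auto
    define i where "i = \<lfloor>u * 2 ^ n\<rfloor> + 1"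
    have i1: "u * 2 ^ n < of_int i" "of_int i \<le> u * 2 ^ n + 1" unfolding i_def by linarith+
    have n1: "2 < (v - u) * 2 ^ n" "\<bar>u\<bar> + 1 < 2 ^ n" "(1::real) < 2 ^ n"
      using n uv(3) by (auto simp: M_def divide_less_eq mult.commute)
    have "\<bar>i\<bar> \<le> 4 ^ n"
    proof -
      have "\<bar>real_of_int i\<bar> \<le> \<bar>u\<bar> * 2 ^ n + 1"
      proof -
        have "\<bar>u * 2 ^ n\<bar> = \<bar>u\<bar> * 2 ^ n" by (simp add: abs_mult)
        then show ?thesis using i1 by linarith
      qed
      also have "\<dots> \<le> (\<bar>u\<bar> + 1) * 2 ^ n" using n1(3) by (simp add: algebra_simps)
      also have "\<dots> \<le> 2 ^ n * 2 ^ n" using n1(2) by (intro mult_right_mono) auto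
      also have "\<dots> = 4 ^ n" by (simp add: power_mult_distrib[symmetric])
      finally have "real_of_int \<bar>i\<bar> \<le> real_of_int (4 ^ n)" by simp
      then show ?thesis by (simp only: of_int_le_iff)
    qed
    then obtain y where y: "y \<in> {of_int i / 2 ^ n<..<(of_int i + 1) / 2 ^ n}" "complex_of_real y \<in> resolvent_set (jacobi a b)"
      using gaps[of n] unfolding gap_cells_def by blast
    have "u < of_int i / 2 ^ n" using i1(1) by (simp add: less_divide_eq)
    moreover have "(of_int i + 1) / 2 ^ n < v"
    proof -
      have "of_int i + 1 < v * 2 ^ n" using i1(2) n1(1) by (simp add: algebra_simps)
      then show ?thesis by (simp add: divide_less_eq)
    qed
    ultimately have "y \<in> {u..v}" using y(1) by auto
    then have "y \<in> K" using sub by blast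
    then show False using y(2) not_in_K by blast
  qed
  show "\<exists>x. C \<subseteq> {x}"
  proof (cases "C = {}")
    case False
    then obtain x where x: "x \<in> C" by blast
    have "C \<subseteq> {x}" using no x by (metis insertI1 linorder_neqE subsetI)
    then show ?thesis by blast
  qed simp
qed

lemma cantor_K: "cantor_set K"
  unfolding cantor_set_def using K_nonempty compact_K K_totally_disconnected K_not_isolated by blast

end

section \<open>Density\<close>

text \<open>Dependent choice over triples of potential, period and radius. Each radius is at most
  half the preceding one and also bounds all later displacements, so the limit stays in every
  neighbourhood in which gaps were secured.\<close>

lemma approximation_exists:
  assumes per: "periodic_jacobi a b\<^sub>0 p\<^sub>0" and e: "0 < e" and \<tau>: "0 < \<tau>" "\<tau> < 1"
  obtains b B p r \<delta>\<^sub>0 where "approximation a b B p r \<tau> \<delta>\<^sub>0" "\<And>k. \<bar>b k - b\<^sub>0 k\<bar> \<le> e"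
proof -
  \<comment> \<open>Thickness constants that decrease strictly from 1 and stay above \<tau>, leaving
    each step something to lose.\<close>
  define T where "T n = \<tau> + (1 - \<tau>) / 2 ^ n" for n :: nat
  have T: "\<tau> < T n" "T n \<le> 1" "T (Suc n) < T n" for n
  proof -
    show "\<tau> < T n" using \<tau> by (simp add: T_def)
    have "(1 - \<tau>) / 2 ^ n \<le> (1 - \<tau>) / 1" using \<tau> by (intro divide_left_mono) auto
    then show "T n \<le> 1" by (simp add: T_def)
    show "T (Suc n) < T n" using \<tau> by (simp add: T_def field_simps)
  qed
  obtain \<delta>\<^sub>0 where \<delta>\<^sub>0: "\<delta>\<^sub>0 > 0" "thick 1 \<delta>\<^sub>0 (bands a b\<^sub>0 p\<^sub>0)"
    using periodic_jacobi.bands_thick[OF per] by blast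
  define P where "P n s \<longleftrightarrow> periodic_jacobi a (fst s) (fst (snd s)) \<and> thick (T n) \<delta>\<^sub>0 (bands a (fst s) (fst (snd s)))
     \<and> 0 < snd (snd s) \<and> (n = 0 \<longrightarrow> fst s = b\<^sub>0 \<and> snd (snd s) = e)" for n :: nat and s :: "(int \<Rightarrow> real) \<times> nat \<times> real"
  define Q where "Q n s s' \<longleftrightarrow> snd (snd s') \<le> snd (snd s) / 2 \<and> (\<forall>k. \<bar>fst s' k - fst s k\<bar> \<le> snd (snd s) / 2)
     \<and> (\<forall>c. bseq c \<longrightarrow> (\<forall>k. \<bar>c k - fst s' k\<bar> \<le> snd (snd s')) \<longrightarrow> gap_cells a n c)
     \<and> (\<forall>j k. \<bar>j\<bar> \<le> int n \<longrightarrow> \<bar>k\<bar> \<le> int n \<longrightarrow>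
      (\<integral>x. \<bar>per_kernel a (fst s') (fst (snd s')) j k x - per_kernel a (fst s) (fst (snd s)) j k x\<bar> \<partial>lborel) \<le> 1 / 2 ^ n)"
    for n :: nat and s s' :: "(int \<Rightarrow> real) \<times> nat \<times> real"
  have "\<exists>f. \<forall>n. P n (f n) \<and> Q n (f n) (f (Suc n))"
  proof (rule dependent_nat_choice)
    have "T 0 = 1" by (simp add: T_def)
    then show "\<exists>s. P 0 s" using per \<delta>\<^sub>0 e by (intro exI[of _ "(b\<^sub>0, p\<^sub>0, e)"]) (simp add: P_def)
  next
    fix s n assume "P n s"
    then have s: "periodic_jacobi a (fst s) (fst (snd s))" "thick (T n) \<delta>\<^sub>0 (bands a (fst s) (fst (snd s)))" "0 < snd (snd s)"
      by (auto simp: P_def)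
    have "0 < T (Suc n)" using T(1)[of "Suc n"] \<tau> by linarith
    from periodic_jacobi.perturbation_step[OF s(1,2) this T(3) T(2) s(3), of n]
    obtain b' p' r' where b': "periodic_jacobi a b' p'" "thick (T (Suc n)) \<delta>\<^sub>0 (bands a b' p')" "0 < r'" "r' \<le> snd (snd s) / 2"
      "\<And>k. \<bar>b' k - fst s k\<bar> \<le> snd (snd s) / 2"
      "\<And>c. bseq c \<Longrightarrow> (\<And>k. \<bar>c k - b' k\<bar> \<le> r') \<Longrightarrow> gap_cells a n c"
      "\<And>j k. \<bar>j\<bar> \<le> int n \<Longrightarrow> \<bar>k\<bar> \<le> int n \<Longrightarrow>
        (\<integral>x. \<bar>per_kernel a b' p' j k x - per_kernel a (fst s) (fst (snd s)) j k x\<bar> \<partial>lborel) \<le> 1 / 2 ^ n"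
      by blast
    show "\<exists>y. P (Suc n) y \<and> Q n s y"
      by (rule exI[of _ "(b', p', r')"]) (use b' in \<open>simp add: P_def Q_def\<close>)
  qed
  then obtain f where f: "\<And>n. P n (f n)" "\<And>n. Q n (f n) (f (Suc n))" by blast
  define B where "B n = fst (f n)" for n
  define p where "p n = fst (snd (f n))" for n
  define r where "r n = snd (snd (f n))" for n
  have per': "periodic_jacobi a (B n) (p n)" for n using f(1)[of n] by (simp add: P_def B_def p_def)
  have th: "thick (T n) \<delta>\<^sub>0 (bands a (B n) (p n))" for n using f(1)[of n] by (simp add: P_def B_def p_def)
  have r0: "0 < r n" for n using f(1)[of n] by (simp add: P_def r_def)
  have start: "B 0 = b\<^sub>0" "r 0 = e" using f(1)[of 0] by (simp_all add: P_def B_def r_def)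
  have rS: "r (Suc n) \<le> r n / 2" and BS: "\<bar>B (Suc n) k - B n k\<bar> \<le> r n / 2"
    and gS: "bseq c \<Longrightarrow> (\<And>k. \<bar>c k - B (Suc n) k\<bar> \<le> r (Suc n)) \<Longrightarrow> gap_cells a n c"
    and kS: "\<bar>j\<bar> \<le> int n \<Longrightarrow> \<bar>l\<bar> \<le> int n \<Longrightarrow>
      (\<integral>x. \<bar>per_kernel a (B (Suc n)) (p (Suc n)) j l x - per_kernel a (B n) (p n) j l x\<bar> \<partial>lborel) \<le> 1 / 2 ^ n" for n k c j l
    using f(2)[of n] by (auto simp: Q_def B_def p_def r_def)
  have re: "r n \<le> e / 2 ^ n" for n
  proof (induction n)
    case (Suc n)
    then have "r n / 2 \<le> e / 2 ^ n / 2" by (rule divide_right_mono) simp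
    with rS[of n] have "r (Suc n) \<le> e / 2 ^ n / 2" by (rule order_trans)
    then show ?case by (simp add: mult.commute)
  qed (simp add: start)
  have rl: "r \<longlonglongrightarrow> 0"
  proof (rule tendsto_sandwich[OF _ _ tendsto_const])
    show "\<forall>\<^sub>F n in sequentially. 0 \<le> r n" using r0 by (simp add: less_imp_le)
    show "\<forall>\<^sub>F n in sequentially. r n \<le> e / 2 ^ n" using re by simp
    show "(\<lambda>n. e / 2 ^ n) \<longlonglongrightarrow> 0"
      using tendsto_mult[OF tendsto_const LIMSEQ_power_zero[of "1 / 2 :: real"], of e] by (simp add: power_divide)
  qed
  \<comment> \<open>A displacement of at most r n / 2 is bounded by r n - r (Suc n), so the
    displacements telescope to less than r n.\<close>
  have cl: "\<bar>B (n + i) k - B n k\<bar> \<le> r n - r (n + i)" for n i k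
  proof (induction i)
    case (Suc i)
    have "\<bar>B (n + Suc i) k - B (n + i) k\<bar> \<le> r (n + i) / 2" using BS[of "n + i" k] by simp
    moreover have "r (n + Suc i) \<le> r (n + i) / 2" using rS[of "n + i"] by simp
    ultimately show ?case using Suc by linarith
  qed simp
  have cauchy: "Cauchy (\<lambda>n. B n k)" for k
  proof (rule metric_CauchyI)
    fix \<epsilon> :: real assume "\<epsilon> > 0"
    then have "\<forall>\<^sub>F n in sequentially. r n < \<epsilon> / 2" by (intro order_tendstoD(2)[OF rl]) simp
    then obtain N where N: "r N < \<epsilon> / 2" unfolding eventually_sequentially by blast
    have "\<bar>B n k - B N k\<bar> < \<epsilon> / 2" if "n \<ge> N" for n
      using cl[of N "n - N" k] that r0[of n] N by simp
    then have "dist (B m k) (B n k) < \<epsilon>" if "m \<ge> N" "n \<ge> N" for m n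
      using that unfolding dist_real_def by (smt (verit) field_sum_of_halves)
    then show "\<exists>M. \<forall>m\<ge>M. \<forall>n\<ge>M. dist (B m k) (B n k) < \<epsilon>" by blast
  qed
  define b where "b k = lim (\<lambda>n. B n k)" for k
  have bl: "(\<lambda>n. B n k) \<longlonglongrightarrow> b k" for k
    unfolding b_def using cauchy[of k] by (simp add: Cauchy_convergent_iff convergent_LIMSEQ_iff)
  have close: "\<bar>b k - B n k\<bar> \<le> r n" for n k
  proof (rule LIMSEQ_le_const2)
    show "(\<lambda>i. \<bar>B (i + n) k - B n k\<bar>) \<longlonglongrightarrow> \<bar>b k - B n k\<bar>"
      by (intro tendsto_intros LIMSEQ_ignore_initial_segment bl)
    have "\<bar>B (i + n) k - B n k\<bar> \<le> r n" for i
      using cl[of n i k] r0[of "n + i"] by (simp add: add.commute)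
    then show "\<exists>N. \<forall>i\<ge>N. \<bar>B (i + n) k - B n k\<bar> \<le> r n" by blast
  qed
  have bb: "bseq b"
  proof -
    obtain C where C: "\<And>k. \<bar>B 0 k\<bar> \<le> C"
      using periodic_jacobi.bseq_ab(2)[OF per'[of 0]] unfolding bseq_def by blast
    have "\<bar>b k\<bar> \<le> C + r 0" for k using C[of k] close[of k 0] by linarith
    then show ?thesis unfolding bseq_def by blast
  qed
  have "approximation a b B p r \<tau> \<delta>\<^sub>0"
  proof (rule approximation.intro)
    show "thick \<tau> \<delta>\<^sub>0 (bands a (B n) (p n))" for n
      unfolding thick_def
    proof (intro ballI allI impI)
      fix x \<delta> assume x: "x \<in> bands a (B n) (p n)" and \<delta>: "0 < \<delta> \<and> \<delta> \<le> \<delta>\<^sub>0"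
      have "\<tau> * \<delta> \<le> T n * \<delta>" using T(1)[of n] \<delta> by (intro mult_right_mono) auto
      also have "\<dots> \<le> measure lebesgue ({x - \<delta><..<x + \<delta>} \<inter> bands a (B n) (p n))"
        using th[of n] x \<delta> unfolding thick_def by blast
      finally show "\<tau> * \<delta> \<le> measure lebesgue ({x - \<delta><..<x + \<delta>} \<inter> bands a (B n) (p n))" .
    qed
    show "gap_cells a n b" for n by (rule gS[OF bb close])
  qed (fact per' r0 rl close \<tau>(1) \<delta>\<^sub>0(1) | rule kS, assumption, assumption)+
  moreover have "\<bar>b k - b\<^sub>0 k\<bar> \<le> e" for k using close[of k 0] start by simp
  ultimately show thesis using that by blast
qed

lemma common_period:
  assumes "\<And>n. a n > 0" "periodic a" "periodic b"
  obtains p where "periodic_jacobi a b p"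
proof -
  obtain P where P: "P > 0" "\<And>n. a (n + P) = a n" using assms(2) unfolding periodic_def by blast
  obtain Q where Q: "Q > 0" "\<And>n. b (n + Q) = b n" using assms(3) unfolding periodic_def by blast
  have mult: "f (n + int k * R) = f n" if "\<And>n. f (n + R) = f n" for f :: "int \<Rightarrow> real" and n R k
  proof (induction k)
    case (Suc k)
    have "n + int (Suc k) * R = (n + int k * R) + R" by (simp add: algebra_simps)
    then show ?case using that Suc by metis
  qed simp
  have "periodic_jacobi a b (nat P * nat Q)"
  proof
    show "0 < nat P * nat Q" using P Q by simp
    show "a n > 0" for n by (rule assms)
    show "a (n + int (nat P * nat Q)) = a n" for n
      using mult[of a P n "nat Q", OF P(2)] P(1) by (simp add: mult.commute)
    show "b (n + int (nat P * nat Q)) = b n" for n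
      using mult[of b Q n "nat P", OF Q(2)] Q(1) by simp
  qed
  then show thesis by (rule that)
qed

lemma bseq_bcontfun: "bseq f \<Longrightarrow> f \<in> bcontfun"
  unfolding bseq_def bcontfun_def by (auto simp: bounded_iff)

text \<open>It is enough to start at periodic sequences, which are dense in
  \<open>limit_periodic\<close> by definition. The constructed limit is limit-periodic, its stages
  being periodic and uniformly close.\<close>

lemma homogeneous_ac_near_periodic:
  assumes a: "\<And>n. a n > 0" "periodic a" and \<tau>: "0 < \<tau>" "\<tau> < 1"
    and c: "periodic (apply_bcontfun c)" and e: "0 < e"
  obtains g where "g \<in> homogeneous_ac a \<tau>" "dist g c \<le> e"
proof -
  obtain p\<^sub>0 where "periodic_jacobi a (apply_bcontfun c) p\<^sub>0" using common_period[OF a c] .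
  from approximation_exists[OF this e \<tau>]
  obtain b B p r \<delta>\<^sub>0 where A: "approximation a b B p r \<tau> \<delta>\<^sub>0" and d: "\<And>k. \<bar>b k - apply_bcontfun c k\<bar> \<le> e" by blast
  interpret approximation a b B p r \<tau> \<delta>\<^sub>0 by (rule A)
  define g where "g = Bcontfun b"
  have g: "apply_bcontfun g = b" unfolding g_def by (rule Bcontfun_inverse[OF bseq_bcontfun[OF bseq_b]])
  have "g \<in> limit_periodic"
    unfolding limit_periodic_def closure_approachable
  proof (intro allI impI)
    fix \<epsilon> :: real assume "\<epsilon> > 0"
    then obtain n where n: "r n < \<epsilon>" using r_small[of \<epsilon> 0] by blast
    interpret q: periodic_jacobi a "B n" "p n" by (rule per)
    define h where "h = Bcontfun (B n)"
    have h: "apply_bcontfun h = B n" unfolding h_def by (rule Bcontfun_inverse[OF bseq_bcontfun[OF q.bseq_ab(2)]])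
    have "dist h g \<le> r n"
      by (rule dist_bound) (use close in \<open>simp add: g h dist_real_def abs_minus_commute\<close>)
    moreover have "periodic (apply_bcontfun h)"
      unfolding periodic_def h using q.p_pos q.b_per by (intro exI[of _ "int (p n)"]) auto
    ultimately show "\<exists>y\<in>{f. periodic (apply_bcontfun f)}. dist y g < \<epsilon>" using n by (intro bexI[of _ h]) auto
  qed
  then have "g \<in> homogeneous_ac a \<tau>"
    unfolding homogeneous_ac_def using homogeneous_K cantor_K ac by (simp add: g)
  moreover have "dist g c \<le> e"
    by (rule dist_bound) (use d in \<open>simp add: g dist_real_def\<close>)
  ultimately show thesis using that by blast
qed

theorem theorem1p1:
  fixes a :: "int \<Rightarrow> real" and \<tau> :: real
  assumes "\<And>n. a n > 0" and "periodic a" and "0 < \<tau>" and "\<tau> < 1"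
  shows "(top_of_set limit_periodic) closure_of (homogeneous_ac a \<tau>) = limit_periodic"
proof -
  have sub: "homogeneous_ac a \<tau> \<subseteq> limit_periodic" by (auto simp: homogeneous_ac_def)
  have "limit_periodic \<subseteq> closure (homogeneous_ac a \<tau>)"
  proof
    fix f assume f: "f \<in> limit_periodic"
    show "f \<in> closure (homogeneous_ac a \<tau>)"
      unfolding closure_approachable
    proof (intro allI impI)
      fix e :: real assume e: "e > 0"
      then obtain c where c: "periodic (apply_bcontfun c)" "dist c f < e / 2"
        using f unfolding limit_periodic_def closure_approachable by (metis half_gt_zero mem_Collect_eq)
      obtain g where g: "g \<in> homogeneous_ac a \<tau>" "dist g c \<le> e / 2"
        using homogeneous_ac_near_periodic[OF assms c(1), of "e / 2"] e by auto
      have "dist g f < e" using dist_triangle[of g f c] g(2) c(2) by linarith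
      then show "\<exists>y\<in>homogeneous_ac a \<tau>. dist y f < e" using g(1) by blast
    qed
  qed
  moreover have "closure (homogeneous_ac a \<tau>) \<subseteq> limit_periodic"
    by (rule closure_minimal[OF sub]) (simp add: limit_periodic_def)
  ultimately show ?thesis
    by (simp add: closure_of_subtopology Int_absorb1[OF sub] Int_commute)
qed

end
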